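(* The edge-forcing problem is NP-complete: given a finite simple graph $G$ and an integer $k$, deciding whether $G$ has an edge-forcing set of cardinality at most $k$ is NP-complete.
   Context: Forcing (closure) rule: for a graph $G=(V,E)$ and $T\subseteq V$, the closure $C_G(T)$ is obtained by starting with $C_G(T)=T$ and, as long as some vertex of $C_G(T)$ has exactly one neighbor not in $C_G(T)$, adding that neighbor to $C_G(T)$. Edge-forcing set: for a set $K$ of pairwise independent edges (a matching) of $G$, let $T$ be the set of all endpoints of edges of $K$; $K$ is an edge-forcing set of $G$ if $C_G(T)=V$. The edge-forcing number $\zeta_e(G)$ is the minimum cardinality of an edge-forcing set, and the edge-forcing problem is to determine it (decision version as stated in the claim). *)

theory Defs
  imports Main "HOL-Computational_Algebra.Polynomial"
begin

section \<open>Graphs, forcing and edge-forcing sets\<close>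

definition simple_graph :: "'a set \<Rightarrow> 'a set set \<Rightarrow> bool" where
  "simple_graph V E \<longleftrightarrow> finite V \<and> (\<forall>e\<in>E. e \<subseteq> V \<and> card e = 2)"

definition neighbors :: "'a set set \<Rightarrow> 'a \<Rightarrow> 'a set" where
  "neighbors E u = {v. {u, v} \<in> E}"

inductive force_step :: "'a set set \<Rightarrow> 'a set \<Rightarrow> 'a set \<Rightarrow> bool" for E where
  "u \<in> S \<Longrightarrow> neighbors E u - S = {v} \<Longrightarrow> force_step E S (insert v S)"

text \<open>The set at which the iterated forcing rule stops; lemma \<open>forcing_closure_ex1\<close> below
  shows that the description is proper for finite graphs.\<close>

definition forcing_closure :: "'a set set \<Rightarrow> 'a set \<Rightarrow> 'a set" where
  "forcing_closure E T =
     (THE C. (force_step E)\<^sup>*\<^sup>* T C \<and> (\<nexists>C'. force_step E C C'))"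

definition matching :: "'a set set \<Rightarrow> 'a set set \<Rightarrow> bool" where
  "matching E K \<longleftrightarrow> K \<subseteq> E \<and> pairwise disjnt K"

definition edge_forcing_set :: "'a set \<Rightarrow> 'a set set \<Rightarrow> 'a set set \<Rightarrow> bool" where
  "edge_forcing_set V E K \<longleftrightarrow> matching E K \<and> forcing_closure E (\<Union>K) = V"

lemma force_step_subset: "simple_graph V E \<Longrightarrow> force_step E S S' \<Longrightarrow> S \<subseteq> V \<Longrightarrow> S' \<subseteq> V"
  by (auto simp: simple_graph_def neighbors_def elim!: force_step.cases) blast

lemma force_step_psubset: "force_step E S S' \<Longrightarrow> S \<subset> S'"
  by (auto elim!: force_step.cases)

lemma force_steps_subset_stable:
  assumes "(force_step E)\<^sup>*\<^sup>* T A" "T \<subseteq> C" "\<nexists>C'. force_step E C C'"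
  shows "A \<subseteq> C"
  using assms(1)
proof (induction rule: rtranclp_induct)
  case base
  show ?case using assms(2) .
next
  case (step A B)
  from step.hyps(2) show ?case
  proof cases
    case (1 u v)
    have "v \<in> C"
    proof (rule ccontr)
      assume "v \<notin> C"
      hence "neighbors E u - C = {v}" using 1 step.IH by blast
      thus False using assms(3) 1 step.IH force_step.intros[of u C E v] by blast
    qed
    thus ?thesis using 1 step.IH by simp
  qed
qed

lemma forcing_closure_ex1:
  assumes G: "simple_graph V E" and T: "T \<subseteq> V"
  shows "\<exists>!C. (force_step E)\<^sup>*\<^sup>* T C \<and> (\<nexists>C'. force_step E C C')"
proof (rule ex_ex1I)
  have sub: "S \<subseteq> V" if "(force_step E)\<^sup>*\<^sup>* T S" for S
    using that by induction (use T force_step_subset[OF G] in auto)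
  have fin: "finite {S. (force_step E)\<^sup>*\<^sup>* T S}"
  proof (rule finite_subset)
    show "{S. (force_step E)\<^sup>*\<^sup>* T S} \<subseteq> Pow V" using sub by blast
    show "finite (Pow V)" using G by (simp add: simple_graph_def)
  qed
  have "T \<in> {S. (force_step E)\<^sup>*\<^sup>* T S}" by simp
  then obtain C where C: "(force_step E)\<^sup>*\<^sup>* T C"
    and max: "\<And>S. (force_step E)\<^sup>*\<^sup>* T S \<Longrightarrow> C \<subseteq> S \<Longrightarrow> S = C"
    using finite_has_maximal[OF fin] by blast
  have "\<nexists>C'. force_step E C C'"
    using C max force_step_psubset by (metis psubset_eq rtranclp.rtrancl_into_rtrancl)
  thus "\<exists>C. (force_step E)\<^sup>*\<^sup>* T C \<and> (\<nexists>C'. force_step E C C')" using C by blast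
next
  have inc: "T \<subseteq> S" if "(force_step E)\<^sup>*\<^sup>* T S" for S
    using that by induction (auto dest: force_step_psubset)
  fix C D
  assume "(force_step E)\<^sup>*\<^sup>* T C \<and> (\<nexists>C'. force_step E C C')"
    and "(force_step E)\<^sup>*\<^sup>* T D \<and> (\<nexists>C'. force_step E D C')"
  thus "C = D" using inc force_steps_subset_stable by (metis subset_antisym)
qed

section \<open>Deterministic multi-tape Turing machines\<close>

text \<open>States are the numbers below \<open>num_states\<close>, with start state 0; tape symbols are the
  numbers below \<open>num_symbols\<close>. Symbol 0 is the blank, 1 and 2 are the bits 0 and 1, and 3 is
  a separator. Tapes are infinite in both directions; a tape is its content together with the
  head position. The input is on the first tape and the output on the last one, both starting
  at cell 0. A halted machine stays in its configuration.\<close>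

datatype dir = MoveLeft | Stay | MoveRight

record machine =
  num_tapes :: nat
  num_symbols :: nat
  num_states :: nat
  accept_state :: nat
  reject_state :: nat
  trans :: "nat \<Rightarrow> nat list \<Rightarrow> nat \<times> (nat \<times> dir) list"

definition turing_machine :: "machine \<Rightarrow> bool" where
  "turing_machine M \<longleftrightarrow>
     num_tapes M \<ge> 1 \<and> num_symbols M \<ge> 4 \<and> num_states M > 0 \<and>
     accept_state M < num_states M \<and> reject_state M < num_states M \<and>
     accept_state M \<noteq> reject_state M \<and>
     (\<forall>q ss q' as. q < num_states M \<and> length ss = num_tapes M \<and>
        (\<forall>s\<in>set ss. s < num_symbols M) \<and> trans M q ss = (q', as) \<longrightarrow>
        q' < num_states M \<and> length as = num_tapes M \<and> (\<forall>(s, d)\<in>set as. s < num_symbols M))"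

type_synonym tape = "(int \<Rightarrow> nat) \<times> int"
type_synonym config = "nat \<times> tape list"

fun dir_offset :: "dir \<Rightarrow> int" where
  "dir_offset MoveLeft = -1"
| "dir_offset Stay = 0"
| "dir_offset MoveRight = 1"

fun read_tape :: "tape \<Rightarrow> nat" where
  "read_tape (f, h) = f h"

fun act_tape :: "nat \<times> dir \<Rightarrow> tape \<Rightarrow> tape" where
  "act_tape (s, d) (f, h) = (f(h := s), h + dir_offset d)"

definition halted :: "machine \<Rightarrow> config \<Rightarrow> bool" where
  "halted M c \<longleftrightarrow> fst c = accept_state M \<or> fst c = reject_state M"

definition step :: "machine \<Rightarrow> config \<Rightarrow> config" where
  "step M c =
     (if halted M c then c
      else let (q', as) = trans M (fst c) (map read_tape (snd c))
           in (q', map2 act_tape as (snd c)))"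

definition content_of :: "nat list \<Rightarrow> int \<Rightarrow> nat" where
  "content_of w i = (if 0 \<le> i \<and> i < int (length w) then w ! nat i else 0)"

definition init_config :: "machine \<Rightarrow> nat list \<Rightarrow> config" where
  "init_config M w =
     (0, (content_of w, 0) # replicate (num_tapes M - 1) (content_of [], 0))"

definition run :: "machine \<Rightarrow> nat list \<Rightarrow> nat \<Rightarrow> config" where
  "run M w t = (step M ^^ t) (init_config M w)"

definition halts_within :: "machine \<Rightarrow> nat list \<Rightarrow> nat \<Rightarrow> bool" where
  "halts_within M w t \<longleftrightarrow> halted M (run M w t)"

definition accepts :: "machine \<Rightarrow> nat list \<Rightarrow> bool" where
  "accepts M w \<longleftrightarrow> (\<exists>t. fst (run M w t) = accept_state M)"

definition outputs :: "machine \<Rightarrow> nat list \<Rightarrow> nat list \<Rightarrow> bool" where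
  "outputs M w v \<longleftrightarrow>
     (\<exists>t. halted M (run M w t) \<and> fst (last (snd (run M w t))) = content_of v)"

definition word :: "bool list \<Rightarrow> nat list" where
  "word x = map (\<lambda>b. if b then 2 else 1) x"

definition word_pair :: "bool list \<Rightarrow> bool list \<Rightarrow> nat list" where
  "word_pair x y = word x @ [3] @ word y"

section \<open>NP-completeness\<close>

definition in_NP :: "bool list set \<Rightarrow> bool" where
  "in_NP A \<longleftrightarrow>
     (\<exists>M (p :: nat poly) (q :: nat poly).
        turing_machine M \<and>
        (\<forall>x y. halts_within M (word_pair x y) (poly p (length (word_pair x y)))) \<and>
        (\<forall>x. x \<in> A \<longleftrightarrow> (\<exists>y. length y \<le> poly q (length x) \<and> accepts M (word_pair x y))))"

definition polytime_computable :: "(bool list \<Rightarrow> bool list) \<Rightarrow> bool" where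
  "polytime_computable f \<longleftrightarrow>
     (\<exists>M (p :: nat poly). turing_machine M \<and>
        (\<forall>x. halts_within M (word x) (poly p (length x)) \<and> outputs M (word x) (word (f x))))"

definition polytime_reducible :: "bool list set \<Rightarrow> bool list set \<Rightarrow> bool" where
  "polytime_reducible A B \<longleftrightarrow> (\<exists>f. polytime_computable f \<and> (\<forall>x. x \<in> A \<longleftrightarrow> f x \<in> B))"

definition NP_hard :: "bool list set \<Rightarrow> bool" where
  "NP_hard B \<longleftrightarrow> (\<forall>A. in_NP A \<longrightarrow> polytime_reducible A B)"

definition NP_complete :: "bool list set \<Rightarrow> bool" where
  "NP_complete B \<longleftrightarrow> in_NP B \<and> NP_hard B"

section \<open>The edge-forcing problem\<close>

text \<open>A graph with vertex set \<open>{..<n}\<close> is encoded by \<open>n\<close> in unary, a terminating zero and the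
  adjacency matrix row by row. An integer is encoded by its sign followed by the binary digits
  of its absolute value, least significant first and without superfluous zeros.\<close>

fun binary :: "nat \<Rightarrow> bool list" where
  "binary m = (if m = 0 then [] else odd m # binary (m div 2))"

declare binary.simps [simp del]

definition encode_int :: "int \<Rightarrow> bool list" where
  "encode_int k = (k < 0) # binary (nat \<bar>k\<bar>)"

definition encode_graph :: "nat \<Rightarrow> nat set set \<Rightarrow> bool list" where
  "encode_graph n E =
     replicate n True @ [False] @ concat (map (\<lambda>i. map (\<lambda>j. {i, j} \<in> E) [0..<n]) [0..<n])"

definition encode_instance :: "nat \<Rightarrow> nat set set \<Rightarrow> int \<Rightarrow> bool list" where
  "encode_instance n E k = encode_graph n E @ encode_int k"

definition edge_forcing_problem :: "bool list set" where
  "edge_forcing_problem =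
     {encode_instance n E k | n E k.
        simple_graph {..<n} E \<and> (\<exists>K. edge_forcing_set {..<n} E K \<and> int (card K) \<le> k)}"

lemma binary_inject: "binary m = binary m' \<Longrightarrow> m = m'"
proof (induction m arbitrary: m' rule: less_induct)
  case (less m)
  show ?case
  proof (cases "m = 0 \<or> m' = 0")
    case True
    thus ?thesis using less.prems
      by (auto simp: binary.simps[of m] binary.simps[of m'] binary.simps[of 0] split: if_splits)
  next
    case False
    hence "odd m = odd m'" "binary (m div 2) = binary (m' div 2)"
      using less.prems by (auto simp: binary.simps[of m] binary.simps[of m'])
    moreover from this have "m div 2 = m' div 2" using less.IH[of "m div 2"] False by simp
    ultimately show ?thesis
      by (metis mod2_eq_if mult_div_mod_eq)
  qed
qed

lemma encode_instance_inject:
  assumes G: "simple_graph {..<n} E" and G': "simple_graph {..<n'} E'"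
    and eq: "encode_instance n E k = encode_instance n' E' k'"
  shows "n = n' \<and> E = E' \<and> k = k'"
proof -
  have tw: "takeWhile (\<lambda>b. b) (encode_instance m F l) = replicate m True" for m F l
    by (simp add: encode_instance_def encode_graph_def takeWhile_append)
  have n: "n = n'" using arg_cong[OF eq, of "\<lambda>w. length (takeWhile (\<lambda>b. b) w)"]
    by (simp add: tw)
  let ?row = "\<lambda>F i. map (\<lambda>j. {i, j} \<in> F) [0..<n]"
  have len: "length (concat (map (?row F) xs)) = length xs * n" for F :: "nat set set" and xs
    by (induction xs) auto
  from eq have mat: "concat (map (?row E) [0..<n]) = concat (map (?row E') [0..<n])"
    and int: "encode_int k = encode_int k'"
    by (auto simp: encode_instance_def encode_graph_def n[symmetric] len append_eq_append_conv)
  have "map (?row E) [0..<n] = map (?row E') [0..<n]"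
    using mat by (intro concat_injective) (auto simp: zip_map_map zip_same_conv_map)
  hence adj: "{i, j} \<in> E \<longleftrightarrow> {i, j} \<in> E'" if "i < n" "j < n" for i j
    using that by auto
  have "e \<in> E \<longleftrightarrow> e \<in> E'" for e
  proof -
    have "\<exists>i j. e = {i, j} \<and> i < n \<and> j < n" if "e \<in> E \<or> e \<in> E'"
    proof -
      have "card e = 2" "e \<subseteq> {..<n}" using that G G' n by (auto simp: simple_graph_def)
      thus ?thesis by (auto simp: card_2_iff)
    qed
    thus ?thesis using adj by blast
  qed
  moreover have "k = k'"
    using int binary_inject[of "nat \<bar>k\<bar>" "nat \<bar>k'\<bar>"] by (auto simp: encode_int_def)
  ultimately show ?thesis using n by blast
qed

end

theory Submission
  imports Defs
begin

text \<open>
  Turing machines are programmed through unary counters: a counter is the head position on a tape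
  with a single mark. Arithmetical expressions built from sums over bounded ranges, truncated
  differences and tests on the input compile to such programs, and all their values, hence their
  running times, are polynomially bounded. Polynomial-time computability thus reduces to definability
  by bounded formulas with counting, which covers both the verification of a certificate (a matching
  together with the successive stages of its forcing process) and the adjacency matrix of the graph
  that the hardness proof outputs.

  For hardness, an NP machine is described by Horn clauses deriving the facts of its computation,
  except that the certificate is guessed, and a CNF formula is turned into a graph. The complement of
  a set stable under forcing is a fort: every outside vertex has zero or at least two neighbours in it.
  The graph contains pairwise disjoint forts, one for each variable and each gate, such that no edge
  meets two of them; with one matching edge allowed per fort, each variable receives exactly one edge,
  which selects the literal that is coloured. Gates then colour the clauses that are satisfied, and
  the remaining literals are forced if and only if all clauses are.
\<close>


section \<open>Counter machines on Turing machines\<close>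

text \<open>Three obstacles shape the development. Machines are concrete, so neither direction can
  appeal to an informal polynomial-time algorithm: whatever is computed has to be a bounded
  arithmetical term. Time bounds are kept in the form \<open>B ^ k\<close>, where \<open>B\<close>
  is any number that is at least 2 and bounds the input length and the variables; a loop body is
  analysed with a power of \<open>B\<close> in place of \<open>B\<close>, so nesting never leaves
  this form. Secondly, the bound of an instance is given in binary and may be exponential in the
  input length, hence it is never turned into a counter. Thirdly, an edge-forcing set may use any
  edges, so it must be compelled to spend its budget as intended. The budget equals the number of
  forts; therefore every edge meets exactly one fort, and edges outside all forts, such as those at
  \<open>Sp 3\<close>, are unaffordable. On the machine side an assignment may make more facts true
  than the run does; this is harmless because only the fact of rejection is forbidden, and that one
  is derived whenever the run rejects.\<close>

datatype instr = Inc nat | Dec nat | Fwd | Back | Emit nat | Jz nat nat | Jeq nat nat | Jback nat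

type_synonym store = "int \<times> (nat \<Rightarrow> nat) \<times> nat list"

text \<open>Jumps are relative, \<open>Jz\<close> and \<open>Jeq\<close> forwards and
  \<open>Jback\<close> backwards, so that a block of instructions behaves in the same way at every
  place of a program.\<close>

fun exec_instr :: "nat list \<Rightarrow> instr \<Rightarrow> nat \<Rightarrow> store \<Rightarrow> nat \<times> store" where
  "exec_instr w (Inc i) pc (p, c, out) = (Suc pc, p, c(i := Suc (c i)), out)"
| "exec_instr w (Dec i) pc (p, c, out) = (Suc pc, p, c(i := c i - 1), out)"
| "exec_instr w Fwd pc (p, c, out) = (Suc pc, p + 1, c, out)"
| "exec_instr w Back pc (p, c, out) = (Suc pc, p - 1, c, out)"
| "exec_instr w (Emit s) pc (p, c, out) = (Suc pc, p, c, out @ [s])"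
| "exec_instr w (Jz i d) pc (p, c, out) = (if c i = 0 then pc + d else Suc pc, p, c, out)"
| "exec_instr w (Jeq s d) pc (p, c, out) = (if content_of w p = s then pc + d else Suc pc, p, c, out)"
| "exec_instr w (Jback d) pc (p, c, out) = (pc - d, p, c, out)"

text \<open>Jumps past the end are cut to \<open>length P\<close>, the only halting position, so
  that finitely many machine states suffice.\<close>

fun cstep :: "nat list \<Rightarrow> instr list \<Rightarrow> nat \<times> store \<Rightarrow> nat \<times> store" where
  "cstep w P (pc, st) =
     (if pc < length P
      then (min (fst (exec_instr w (P ! pc) pc st)) (length P), snd (exec_instr w (P ! pc) pc st))
      else (pc, st))"

fun act_instr :: "nat \<Rightarrow> instr \<Rightarrow> nat \<Rightarrow> nat \<Rightarrow> nat \<times> dir" where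
  "act_instr K (Inc i) j s = (s, if j = Suc i then MoveRight else Stay)"
| "act_instr K (Dec i) j s = (s, if j = Suc i \<and> s \<noteq> 3 then MoveLeft else Stay)"
| "act_instr K Fwd j s = (s, if j = 0 then MoveRight else Stay)"
| "act_instr K Back j s = (s, if j = 0 then MoveLeft else Stay)"
| "act_instr K (Emit a) j s = (if j = Suc K then (a, MoveRight) else (s, Stay))"
| "act_instr K _ j s = (s, Stay)"

fun target_instr :: "instr \<Rightarrow> nat \<Rightarrow> nat list \<Rightarrow> nat" where
  "target_instr (Jz i d) pc ss = (if ss ! Suc i = 3 then pc + d else Suc pc)"
| "target_instr (Jeq s d) pc ss = (if ss ! 0 = s then pc + d else Suc pc)"
| "target_instr (Jback d) pc ss = pc - d"
| "target_instr _ pc ss = Suc pc"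

text \<open>State \<open>0\<close> writes the marks, state \<open>pc + 1\<close> stands for
  instruction \<open>pc\<close>, and state \<open>length P + 1\<close> is the final test of counter
  \<open>0\<close>, which leads to \<open>length P + 2\<close> or
  \<open>length P + 3\<close>.\<close>

definition mach_trans :: "nat \<Rightarrow> instr list \<Rightarrow> nat \<Rightarrow> nat list \<Rightarrow> nat \<times> (nat \<times> dir) list" where
  "mach_trans K P q ss =
     (if q = 0
      then (1, map (\<lambda>j. (if 1 \<le> j \<and> j \<le> K then 3 else ss ! j, Stay)) [0..<K + 2])
      else if q \<le> length P
      then (Suc (min (target_instr (P ! (q - 1)) (q - 1) ss) (length P)),
            map (\<lambda>j. act_instr K (P ! (q - 1)) j (ss ! j)) [0..<K + 2])
      else (if q = Suc (length P) then (if ss ! 1 = 3 then length P + 3 else length P + 2) else q,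
            map (\<lambda>j. (ss ! j, Stay)) [0..<K + 2]))"

text \<open>Tape 0 holds the input, tape \<open>i + 1\<close> holds counter \<open>i\<close> and tape \<open>K + 1\<close> is the output.
  A counter tape contains nothing but the symbol 3 at cell 0, written in the first step; the value
  of the counter is the position of the head. The machine accepts if counter 0 is finally positive.\<close>

definition mach :: "nat \<Rightarrow> instr list \<Rightarrow> machine" where
  "mach K P = \<lparr>num_tapes = K + 2, num_symbols = 4, num_states = length P + 4,
     accept_state = length P + 2, reject_state = length P + 3, trans = mach_trans K P\<rparr>"

fun wf_instr :: "nat \<Rightarrow> instr \<Rightarrow> bool" where
  "wf_instr K (Inc i) = (i < K)"
| "wf_instr K (Dec i) = (i < K)"
| "wf_instr K (Emit a) = (a < 4)"
| "wf_instr K (Jz i d) = (i < K)"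
| "wf_instr K _ = True"

definition marker :: "int \<Rightarrow> nat" where
  "marker j = (if j = 0 then 3 else 0)"

fun store_tape :: "nat \<Rightarrow> nat list \<Rightarrow> store \<Rightarrow> nat \<Rightarrow> tape" where
  "store_tape K w (p, c, out) j =
     (if j = 0 then (content_of w, p)
      else if j \<le> K then (marker, int (c (j - 1)))
      else (content_of out, int (length out)))"

definition store_config :: "nat \<Rightarrow> nat list \<Rightarrow> nat \<times> store \<Rightarrow> config" where
  "store_config K w s = (Suc (fst s), map (store_tape K w (snd s)) [0..<K + 2])"

lemma turing_machine_mach:
  assumes "\<forall>ins\<in>set P. wf_instr K ins"
  shows "turing_machine (mach K P)"
proof -
  have "s' < 4" if "act_instr K ins j s = (s', d)" "wf_instr K ins" "s < 4" for ins j s s' d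
    using that by (cases ins) (auto split: if_splits)
  moreover have "wf_instr K (P ! i)" if "i < length P" for i
    using that assms by simp
  ultimately show ?thesis
    unfolding turing_machine_def mach_def
    by (auto simp: mach_trans_def split: if_splits)
qed

lemma content_of_snoc: "content_of (out @ [s]) = (content_of out)(int (length out) := s)"
  by (auto simp: content_of_def fun_eq_iff nth_append)

lemma map2_map_upt: "map2 g (map f [0..<n]) (map h [0..<n]) = map (\<lambda>j. g (f j) (h j)) [0..<n]"
  by (intro nth_equalityI) auto

lemma act_store_tape:
  assumes "wf_instr K ins" "j < K + 2"
  shows "act_tape (act_instr K ins j (read_tape (store_tape K w st j))) (store_tape K w st j) =
           store_tape K w (snd (exec_instr w ins pc st)) j"
proof -
  obtain p c out where st: "st = (p, c, out)" by (cases st)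
  show ?thesis using assms unfolding st
    by (cases ins) (auto simp: marker_def content_of_snoc fun_upd_idem)
qed

lemma target_exec:
  assumes "wf_instr K ins"
  shows "target_instr ins pc (map (\<lambda>j. read_tape (store_tape K w st j)) [0..<K + 2]) =
           fst (exec_instr w ins pc st)"
proof -
  obtain p c out where st: "st = (p, c, out)" by (cases st)
  show ?thesis using assms unfolding st
    by (cases ins) (auto simp: marker_def simp del: upt_Suc)
qed

lemma step_store_config:
  assumes wf: "\<forall>ins\<in>set P. wf_instr K ins" and pc: "fst s < length P"
  shows "step (mach K P) (store_config K w s) = store_config K w (cstep w P s)"
proof -
  obtain pc st where s: "s = (pc, st)" by (cases s)
  have "wf_instr K (P ! pc)" using wf pc s by auto
  note act = act_store_tape[OF this] and tgt = target_exec[OF this]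
  show ?thesis using pc
    by (simp add: step_def halted_def mach_def store_config_def s mach_trans_def tgt
        del: upt_Suc add_2_eq_Suc' exec_instr.simps store_tape.simps)
      (simp add: comp_def tgt[unfolded add_2_eq_Suc'] map2_map_upt act[simplified] del: upt_Suc exec_instr.simps store_tape.simps)
qed

lemma run_Suc: "run M w (Suc t) = step M (run M w t)"
  by (simp add: run_def)

lemma run_halted: "halted M (run M w t) \<Longrightarrow> run M w (t + d) = run M w t"
  by (induction d) (auto simp: run_Suc step_def)

lemma halts_within_mono: "halts_within M w t \<Longrightarrow> t \<le> t' \<Longrightarrow> halts_within M w t'"
  using run_halted[of M w t "t' - t"] by (simp add: halts_within_def)

lemma run_halted_unique:
  assumes "halted M (run M w t)" "halted M (run M w t')"
  shows "run M w t = run M w t'"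
  using run_halted[OF assms(1), of "t' - t"] run_halted[OF assms(2), of "t - t'"]
  by (cases "t \<le> t'") auto

text \<open>\<open>cstep\<close> idles at the end of the program whereas the machine goes on to its
  final test; hence only some \<open>T' \<le> T\<close> is claimed.\<close>

lemma steps_store_config:
  assumes wf: "\<forall>ins\<in>set P. wf_instr K ins"
    and "(cstep w P ^^ T) s = s'" "fst s' = length P"
  shows "\<exists>T'\<le>T. (step (mach K P) ^^ T') (store_config K w s) = store_config K w s'"
  using assms(2)
proof (induction T arbitrary: s)
  case (Suc T)
  show ?case
  proof (cases "fst s < length P")
    case True
    obtain T' where "T' \<le> T"
      "(step (mach K P) ^^ T') (store_config K w (cstep w P s)) = store_config K w s'"
      using Suc.IH[of "cstep w P s"] Suc.prems by (auto simp: funpow_swap1)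
    thus ?thesis using step_store_config[OF wf True, of w]
      by (intro exI[of _ "Suc T'"]) (simp add: funpow_swap1)
  next
    case False
    hence "cstep w P s = s" by (cases s) auto
    hence "(cstep w P ^^ n) s = s" for n by (induction n) auto
    thus ?thesis using Suc.prems by (intro exI[of _ 0]) (metis funpow_0 zero_le)
  qed
qed auto

text \<open>The time is an upper bound, so the rounds of a loop may be charged equally although they
  take different times.\<close>

definition reach :: "nat list \<Rightarrow> instr list \<Rightarrow> nat \<times> store \<Rightarrow> nat \<Rightarrow> nat \<times> store \<Rightarrow> bool" where
  "reach w P a T b \<longleftrightarrow> (\<exists>T'\<le>T. (cstep w P ^^ T') a = b)"

lemma reach_trans:
  assumes "reach w P a T b" "reach w P b T' c"
  shows "reach w P a (T + T') c"
proof -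
  obtain t t' where "t \<le> T" "(cstep w P ^^ t) a = b" "t' \<le> T'" "(cstep w P ^^ t') b = c"
    using assms by (auto simp: reach_def)
  hence "t' + t \<le> T + T'" "(cstep w P ^^ (t' + t)) a = c" by (auto simp: funpow_add)
  thus ?thesis unfolding reach_def by blast
qed

lemma reach_mono: "reach w P a T b \<Longrightarrow> T \<le> T' \<Longrightarrow> reach w P a T' b"
  unfolding reach_def using le_trans by blast

lemma reach_refl: "reach w P a 0 a"
  by (auto simp: reach_def)

lemma reach_step: "cstep w P a = b \<Longrightarrow> reach w P a 1 b"
  unfolding reach_def by (intro exI[of _ 1]) simp

lemma reach_iter:
  assumes "\<And>j. j < n \<Longrightarrow> reach w P (a j) T (a (Suc j))"
  shows "reach w P (a 0) (n * T) (a n)"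
  using assms
proof (induction n)
  case (Suc n)
  thus ?case using reach_trans[of w P "a 0" "n * T" "a n" T] by (simp add: add.commute)
qed (simp add: reach_refl)

text \<open>The two extra steps are the first one, which writes the marks, and the final
  test.\<close>

lemma mach_correct:
  assumes wf: "\<forall>ins\<in>set P. wf_instr K ins" and K: "K \<ge> 1"
    and r: "reach w P (0, 0, \<lambda>_. 0, []) T (length P, p, c, out)"
  shows "halts_within (mach K P) w (T + 2)" (is ?A)
    and "accepts (mach K P) w \<longleftrightarrow> c 0 > 0" (is ?B)
    and "outputs (mach K P) w out" (is ?C)
proof -
  let ?M = "mach K P"
  let ?s = "(length P, p, c, out)"
  obtain T' where T': "T' \<le> T"
    "(step ?M ^^ T') (store_config K w (0, 0, \<lambda>_. 0, [])) = store_config K w ?s"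
  proof -
    obtain t where t: "t \<le> T" "(cstep w P ^^ t) (0, 0, \<lambda>_. 0, []) = ?s"
      using r by (auto simp: reach_def)
    obtain T' where "T' \<le> t"
      "(step ?M ^^ T') (store_config K w (0, 0, \<lambda>_. 0, [])) = store_config K w ?s"
      using steps_store_config[OF wf t(2)] by auto
    with t(1) have "T' \<le> T" by simp
    thus ?thesis using that \<open>(step ?M ^^ T') _ = _\<close> by blast
  qed
  have init: "init_config ?M w = (0, map (\<lambda>j. (if j = 0 then content_of w else content_of [], 0)) [0..<K + 2])"
    by (auto simp: init_config_def mach_def intro!: nth_equalityI simp: nth_Cons' simp del: upt_Suc)
  have "step ?M (0, map f [0..<K + 2]) =
      (1, map (\<lambda>j. act_tape (if 1 \<le> j \<and> j \<le> K then 3 else read_tape (f j), Stay) (f j)) [0..<K + 2])" for f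
    by (simp add: step_def halted_def mach_def mach_trans_def comp_def map2_map_upt del: upt_Suc)
  hence "step ?M (init_config ?M w) = store_config K w (0, 0, \<lambda>_. 0, [])"
    by (simp add: init store_config_def marker_def content_of_def fun_eq_iff del: upt_Suc)
  hence run1: "run ?M w (Suc T') = store_config K w ?s"
    using T' by (simp add: run_def funpow_swap1)
  have "step ?M (Suc (length P), map f [0..<K + 2]) =
      (if read_tape (f 1) = 3 then length P + 3 else length P + 2,
       map (\<lambda>j. act_tape (read_tape (f j), Stay) (f j)) [0..<K + 2])" for f
    by (simp add: step_def halted_def mach_def mach_trans_def comp_def map2_map_upt del: upt_Suc)
  hence "run ?M w (Suc (Suc T')) =
    (if c 0 = 0 then length P + 3 else length P + 2, map (store_tape K w (p, c, out)) [0..<K + 2])"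
    unfolding run_Suc[of _ _ "Suc T'"] run1 store_config_def using K
    by (simp add: marker_def fun_eq_iff del: upt_Suc)
  moreover have "last (map (store_tape K w (p, c, out)) [0..<K + 2]) = (content_of out, int (length out))"
    by simp
  moreover have "accept_state ?M = length P + 2" "reject_state ?M = length P + 3"
    by (auto simp: mach_def)
  ultimately have fin: "halted ?M (run ?M w (Suc (Suc T')))"
      "fst (run ?M w (Suc (Suc T'))) = accept_state ?M \<longleftrightarrow> c 0 > 0"
      "fst (last (snd (run ?M w (Suc (Suc T'))))) = content_of out"
    by (auto simp: halted_def simp del: upt_Suc)
  show ?A using T' fin(1) halts_within_mono[of ?M w "Suc (Suc T')" "T + 2"]
    by (simp add: halts_within_def)
  show ?B using fin(1,2) run_halted_unique[of ?M w] unfolding accepts_def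
    by (metis halted_def)
  show ?C using fin(1,3) unfolding outputs_def by blast
qed

section \<open>Program fragments with running times\<close>

text \<open>A Hoare triple with a time bound. Quantifying over the surrounding code makes it
  position independent, which composition and loops rely on.\<close>

definition frag :: "nat list \<Rightarrow> instr list \<Rightarrow> store \<Rightarrow> nat \<Rightarrow> store \<Rightarrow> bool" where
  "frag w Q s T s' \<longleftrightarrow>
     (\<forall>pre post. reach w (pre @ Q @ post) (length pre, s) T (length pre + length Q, s'))"

lemma frag_mono: "frag w Q s T s' \<Longrightarrow> T \<le> T' \<Longrightarrow> frag w Q s T' s'"
  unfolding frag_def by (meson reach_mono)

lemma frag_Nil: "frag w [] s 0 s"
  by (simp add: frag_def reach_refl)

lemma frag_append:
  assumes "frag w Q s T s1" "frag w Q' s1 T' s2"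
  shows "frag w (Q @ Q') s (T + T') s2"
  unfolding frag_def
proof (intro allI)
  fix pre post
  have "reach w (pre @ Q @ Q' @ post) (length pre, s) T (length pre + length Q, s1)"
    using assms(1) by (simp add: frag_def)
  moreover have "reach w ((pre @ Q) @ Q' @ post) (length (pre @ Q), s1) T' (length (pre @ Q) + length Q', s2)"
    using assms(2) unfolding frag_def by blast
  ultimately show "reach w (pre @ (Q @ Q') @ post) (length pre, s) (T + T')
      (length pre + length (Q @ Q'), s2)"
    using reach_trans by (fastforce simp: add.assoc)
qed

lemma frag_Cons: "frag w [ins] s T s1 \<Longrightarrow> frag w Q s1 T' s2 \<Longrightarrow> frag w (ins # Q) s (T + T') s2"
  using frag_append[of w "[ins]"] by simp

lemma frag_Inc: "frag w [Inc i] (p, c, out) 1 (p, c(i := Suc (c i)), out)"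
  and frag_Dec: "frag w [Dec i] (p, c, out) 1 (p, c(i := c i - 1), out)"
  and frag_Fwd: "frag w [Fwd] (p, c, out) 1 (p + 1, c, out)"
  and frag_Back: "frag w [Back] (p, c, out) 1 (p - 1, c, out)"
  and frag_Emit: "frag w [Emit a] (p, c, out) 1 (p, c, out @ [a])"
  by (auto simp: frag_def nth_append intro!: reach_step[simplified])

lemma frag_replicate_Inc: "frag w (replicate n (Inc i)) (p, c, out) n (p, c(i := c i + n), out)"
proof (induction n arbitrary: c)
  case 0
  show ?case by (simp add: frag_Nil)
next
  case (Suc n)
  show ?case using frag_Cons[OF frag_Inc[of w i p c out] Suc.IH[of "c(i := Suc (c i))"]]
    by (simp only: fun_upd_upd replicate_Suc) simp
qed

text \<open>The exit jump skips the body and the jump back; the latter stands at offset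
  \<open>length Q + 1\<close> and returns to the test.\<close>

definition wh :: "nat \<Rightarrow> instr list \<Rightarrow> instr list" where
  "wh i Q = [Jz i (length Q + 2)] @ Q @ [Jback (length Q + 1)]"

text \<open>Each round costs the body and the two jumps, and one more step is the test that leaves
  the loop. The sequence of stores before the rounds serves as the loop invariant.\<close>

lemma frag_wh:
  assumes body: "\<And>j. j < n \<Longrightarrow> frag w Q (s j) T (s (Suc j))"
    and pos: "\<And>j. j < n \<Longrightarrow> fst (snd (s j)) i \<noteq> 0"
    and zero: "fst (snd (s n)) i = 0"
  shows "frag w (wh i Q) (s 0) (n * (T + 2) + 1) (s n)"
  unfolding frag_def
proof (intro allI)
  fix pre post
  let ?P = "pre @ wh i Q @ post"
  have len: "length (wh i Q) = length Q + 2" by (simp add: wh_def)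
  have loop: "reach w ?P (length pre, s j) (T + 2) (length pre, s (Suc j))" if "j < n" for j
  proof -
    have 1: "reach w ?P (length pre, s j) 1 (length pre + 1, s j)"
      using pos[OF that] by (cases "s j") (auto simp: wh_def nth_append intro!: reach_step[simplified])
    have "reach w ((pre @ [Jz i (length Q + 2)]) @ Q @ (Jback (length Q + 1) # post))
      (length (pre @ [Jz i (length Q + 2)]), s j) T
      (length (pre @ [Jz i (length Q + 2)]) + length Q, s (Suc j))"
      using body[OF that] unfolding frag_def by blast
    hence 2: "reach w ?P (length pre + 1, s j) T (length pre + 1 + length Q, s (Suc j))"
      by (simp add: wh_def)
    have 3: "reach w ?P (length pre + 1 + length Q, s (Suc j)) 1 (length pre, s (Suc j))"
      by (cases "s (Suc j)") (auto simp: wh_def nth_append intro!: reach_step[simplified])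
    show ?thesis using reach_trans[OF reach_trans[OF 1 2] 3] by (simp add: add.commute add.left_commute)
  qed
  have iter: "reach w ?P (length pre, s 0) (n * (T + 2)) (length pre, s n)"
    using reach_iter[where a = "\<lambda>j. (length pre, s j)", OF loop] .
  have "reach w ?P (length pre, s n) 1 (length pre + length (wh i Q), s n)"
    using zero by (cases "s n") (auto simp: wh_def nth_append intro!: reach_step[simplified])
  thus "reach w ?P (length pre, s 0) (n * (T + 2) + 1) (length pre + length (wh i Q), s n)"
    using reach_trans[OF iter, of 1] by simp
qed

section \<open>Bounded arithmetic over the input word\<close>

text \<open>Numbers are unary, so that sums are bounded loops and all values stay polynomially bounded.
  Variables are de Bruijn indices; \<open>Sum\<close> binds variable 0 of its second argument.\<close>

datatype uexp = Const nat | Var nat | Len | Plus uexp uexp | Minus uexp uexp | Sum uexp uexp | Is nat uexp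

fun eval :: "uexp \<Rightarrow> nat list \<Rightarrow> (nat \<Rightarrow> nat) \<Rightarrow> nat" where
  "eval (Const n) w v = n"
| "eval (Var i) w v = v i"
| "eval Len w v = length w"
| "eval (Plus a b) w v = eval a w v + eval b w v"
| "eval (Minus a b) w v = eval a w v - eval b w v"
| "eval (Sum a b) w v = (\<Sum>i<eval a w v. eval b w (case_nat i v))"
| "eval (Is s a) w v = of_bool (content_of w (int (eval a w v)) = s)"

text \<open>\<open>code e \<rho> r t\<close> adds the value of \<open>e\<close> to counter \<open>r\<close>, where variable \<open>i\<close> is in counter
  \<open>\<rho> i\<close> and the counters from \<open>t\<close> on are free.\<close>

fun code :: "uexp \<Rightarrow> (nat \<Rightarrow> nat) \<Rightarrow> nat \<Rightarrow> nat \<Rightarrow> instr list" where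
  "code (Const n) \<rho> r t = replicate n (Inc r)"
| "code (Var i) \<rho> r t = wh (\<rho> i) [Dec (\<rho> i), Inc r, Inc t] @ wh t [Dec t, Inc (\<rho> i)]"
| "code Len \<rho> r t = [Jeq 0 5, Inc r, Inc t, Fwd, Jback 4] @ wh t [Dec t, Back]"
| "code (Plus a b) \<rho> r t = code a \<rho> r t @ code b \<rho> r t"
| "code (Minus a b) \<rho> r t =
     code a \<rho> t (t + 2) @ code b \<rho> (t + 1) (t + 2) @
     wh (t + 1) [Dec (t + 1), Dec t] @ wh t [Dec t, Inc r]"
| "code (Sum a b) \<rho> r t =
     code a \<rho> t (t + 2) @
     wh t ([Dec t] @ code b (case_nat (t + 1) \<rho>) r (t + 2) @ [Inc (t + 1)]) @
     wh (t + 1) [Dec (t + 1)]"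
| "code (Is s a) \<rho> r t =
     code a \<rho> t (t + 2) @ wh t [Dec t, Inc (t + 1), Fwd] @
     [Inc r, Jeq s 2, Dec r] @ wh (t + 1) [Dec (t + 1), Back]"

text \<open>The end of the test in \<open>Is\<close>: the result counter has been increased in
  advance, and the decrease is jumped over if the symbol matches.\<close>

lemma frag_Jeq_Dec: "frag w [Jeq s 2, Dec r] (p, c, out) 2
    (p, if content_of w p = s then c else c(r := c r - 1), out)"
  unfolding frag_def
proof (intro allI)
  fix pre post
  let ?P = "pre @ [Jeq s 2, Dec r] @ post"
  show "reach w ?P (length pre, p, c, out) 2
    (length pre + length [Jeq s 2, Dec r], p, if content_of w p = s then c else c(r := c r - 1), out)"
  proof (cases "content_of w p = s")
    case True
    thus ?thesis
      by (intro reach_mono[OF reach_step]) (auto simp: nth_append)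
  next
    case False
    have "reach w ?P (length pre, p, c, out) 1 (length pre + 1, p, c, out)"
      using False by (intro reach_step) (auto simp: nth_append)
    moreover have "reach w ?P (length pre + 1, p, c, out) 1 (length pre + 2, p, c(r := c r - 1), out)"
      by (intro reach_step) (auto simp: nth_append)
    ultimately show ?thesis using False reach_trans[of w ?P _ 1 _ 1] by (simp add: numeral_2_eq_2)
  qed
qed

text \<open>The head runs to the first blank, so a blank inside \<open>w\<close> would end the count
  too early. The offsets \<open>5\<close> and \<open>4\<close> lead just behind the block and to its
  beginning.\<close>

lemma frag_Len:
  assumes "0 \<notin> set w" "r \<noteq> t"
  shows "frag w [Jeq 0 5, Inc r, Inc t, Fwd, Jback 4] (0, c, out) (length w * 5 + 1)
    (int (length w), c(r := c r + length w, t := c t + length w), out)"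
  unfolding frag_def
proof (intro allI)
  fix pre post
  let ?Q = "[Jeq 0 5, Inc r, Inc t, Fwd, Jback 4]"
  let ?P = "pre @ ?Q @ post"
  let ?s = "\<lambda>j. (int j, c(r := c r + j, t := c t + j), out)"
  have loop: "reach w ?P (length pre, ?s j) 5 (length pre, ?s (Suc j))" if "j < length w" for j
  proof -
    have "content_of w (int j) \<noteq> 0"
      using that assms(1) nth_mem[OF that] by (cases "w ! j") (auto simp: content_of_def)
    hence "(cstep w ?P ^^ 5) (length pre, ?s j) = (length pre, ?s (Suc j))"
      using assms(2) by (simp add: numeral_eq_Suc nth_append fun_upd_twist)
    thus ?thesis unfolding reach_def by blast
  qed
  have iter: "reach w ?P (length pre, ?s 0) (length w * 5) (length pre, ?s (length w))"
    using reach_iter[where a = "\<lambda>j. (length pre, ?s j)", OF loop] .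
  have "reach w ?P (length pre, ?s (length w)) 1 (length pre + length ?Q, ?s (length w))"
    by (intro reach_step) (auto simp: nth_append content_of_def)
  thus "reach w ?P (length pre, 0, c, out) (length w * 5 + 1) (length pre + length ?Q, ?s (length w))"
    using reach_trans[OF iter, of 1] by simp
qed

fun straight :: "instr \<Rightarrow> bool" where
  "straight (Jz i d) = False"
| "straight (Jeq s d) = False"
| "straight (Jback d) = False"
| "straight _ = True"

text \<open>The effect of a block without jumps is obtained by evaluation. The program counter
  \<open>0\<close> is a dummy, as the effect on the store does not depend on it.\<close>

lemma frag_straight:
  assumes "\<forall>ins\<in>set Q. straight ins" "length Q = T" "fold (\<lambda>ins s. snd (exec_instr w ins 0 s)) Q s = s'"
  shows "frag w Q s T s'"
  using assms
proof (induction Q arbitrary: s T)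
  case Nil
  thus ?case by (simp add: frag_Nil)
next
  case (Cons ins Q)
  obtain p c out where s: "s = (p, c, out)" by (cases s)
  have "frag w [ins] s 1 (snd (exec_instr w ins 0 s))"
    using Cons.prems(1) frag_Inc[of w _ p c out] frag_Dec[of w _ p c out] frag_Fwd[of w p c out]
      frag_Back[of w p c out] frag_Emit[of w _ p c out]
    unfolding s by (cases ins) (auto simp del: One_nat_def)
  from frag_Cons[OF this Cons.IH[OF _ refl]] show ?case using Cons.prems by auto
qed

text \<open>Every bound has the form \<open>B ^ k\<close> with \<open>2 \<le> B\<close>, so that
  sums, products and constants only change the exponent: here both summands are at most
  \<open>B ^ (x + y)\<close>, and the factor \<open>2\<close> costs one more
  \<open>B\<close>.\<close>

lemma pow_add:
  assumes "(2::nat) \<le> B" "a \<le> B ^ x" "b \<le> B ^ y"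
  shows "a + b \<le> B ^ (x + y + 1)"
proof -
  have "B ^ x \<le> B ^ (x + y)" "B ^ y \<le> B ^ (x + y)" using assms(1) by (auto intro!: power_increasing)
  hence "a + b \<le> 2 * B ^ (x + y)" using assms by linarith
  also have "\<dots> \<le> B * B ^ (x + y)" using assms(1) by (intro mult_right_mono) auto
  finally show ?thesis by simp
qed

lemma pow_mult: "(a::nat) \<le> B ^ x \<Longrightarrow> b \<le> B ^ y \<Longrightarrow> a * b \<le> B ^ (x + y)"
  unfolding power_add by (rule mult_mono) auto

lemma pow_const: "(2::nat) \<le> B \<Longrightarrow> n \<le> B ^ n"
  by (meson le_trans less_imp_le less_exp power_mono zero_le)

lemma pow_lin: "(2::nat) \<le> B \<Longrightarrow> a \<le> B ^ x \<Longrightarrow> n * a + m \<le> B ^ (n + x + m + 1)"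
  by (intro pow_add pow_mult pow_const)

text \<open>One exponent serves all inputs, environments and counter layouts. \<open>B\<close> is
  universally quantified so that the claim about the body of a sum can be used with a larger bound.
  Scratch counters and the head are given back as found.\<close>

definition code_within :: "uexp \<Rightarrow> nat \<Rightarrow> bool" where
  "code_within e k \<longleftrightarrow>
     (\<forall>w v \<rho> r t c out B. 0 \<notin> set w \<longrightarrow> r < t \<longrightarrow> (\<forall>i. \<rho> i < t \<and> \<rho> i \<noteq> r \<and> c (\<rho> i) = v i) \<longrightarrow>
        (\<forall>j\<ge>t. c j = 0) \<longrightarrow> 2 \<le> B \<longrightarrow> length w \<le> B \<longrightarrow> (\<forall>i. v i \<le> B) \<longrightarrow>
        eval e w v \<le> B ^ k \<and>
        frag w (code e \<rho> r t) (0, c, out) (B ^ k) (0, c(r := c r + eval e w v), out))"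

lemma code_withinD:
  assumes "code_within e k" "0 \<notin> set w" "r < t" "\<And>i. \<rho> i < t \<and> \<rho> i \<noteq> r \<and> c (\<rho> i) = v i"
    "\<And>j. j \<ge> t \<Longrightarrow> c j = 0" "2 \<le> B" "length w \<le> B" "\<And>i. v i \<le> B"
  shows "eval e w v \<le> B ^ k"
    "frag w (code e \<rho> r t) (0, c, out) (B ^ k) (0, c(r := c r + eval e w v), out)"
  using assms unfolding code_within_def by blast+

lemma code_withinI:
  assumes "\<And>w v \<rho> r t c out B. 0 \<notin> set w \<Longrightarrow> r < t \<Longrightarrow> (\<And>i. \<rho> i < t \<and> \<rho> i \<noteq> r \<and> c (\<rho> i) = v i) \<Longrightarrow>
        (\<And>j. j \<ge> t \<Longrightarrow> c j = 0) \<Longrightarrow> 2 \<le> B \<Longrightarrow> length w \<le> B \<Longrightarrow> (\<And>i. v i \<le> B) \<Longrightarrow>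
        \<exists>T m. eval e w v \<le> B ^ m \<and> m \<le> k \<and> T \<le> B ^ k \<and>
        frag w (code e \<rho> r t) (0, c, out) T (0, c(r := c r + eval e w v), out)"
  shows "\<exists>k. code_within e k"
proof (intro exI[of _ k], unfold code_within_def, intro allI impI)
  fix w :: "nat list" and v \<rho> c :: "nat \<Rightarrow> nat" and r t B :: nat and out :: "nat list"
  assume a: "0 \<notin> set w" "r < t" "\<forall>i. \<rho> i < t \<and> \<rho> i \<noteq> r \<and> c (\<rho> i) = v i" "\<forall>j\<ge>t. c j = 0"
    "2 \<le> B" "length w \<le> B" "\<forall>i. v i \<le> B"
  then obtain T m where T: "eval e w v \<le> B ^ m" "m \<le> k" "T \<le> B ^ k"
    "frag w (code e \<rho> r t) (0, c, out) T (0, c(r := c r + eval e w v), out)"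
    using assms[of w r t \<rho> c v B out] by blast
  have "B ^ m \<le> B ^ k" using T(2) a(5) by (intro power_increasing) auto
  with T show "eval e w v \<le> B ^ k \<and>
    frag w (code e \<rho> r t) (0, c, out) (B ^ k) (0, c(r := c r + eval e w v), out)"
    using frag_mono le_trans by blast
qed

lemma frag_reach: "frag w Q s T s' \<Longrightarrow> reach w Q (0, s) T (length Q, s')"
  unfolding frag_def by (drule spec[of _ "[]"], drule spec[of _ "[]"]) simp

text \<open>Shared by \<open>Sum\<close> and \<open>For\<close>: counter \<open>t\<close> counts
  down the rounds left, \<open>t + 1\<close> counts up and is the loop variable. \<open>C\<close>
  and \<open>U\<close> describe counters and output after \<open>j\<close> rounds; a sum changes
  only the former, an output loop only the latter.\<close>

lemma frag_for:
  assumes P1: "frag w P1 (0, c, out) T1 (0, c(t := n), out)"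
    and body: "\<And>j. j < n \<Longrightarrow> frag w P2 (0, (C j)(t := n - Suc j, t + 1 := j), U j) T2
        (0, (C (Suc j))(t := n - Suc j, t + 1 := j), U (Suc j))"
    and C: "C 0 = c" "U 0 = out" "\<And>j. C j t = 0" "\<And>j. C j (t + 1) = 0"
  shows "frag w (P1 @ wh t ([Dec t] @ P2 @ [Inc (t + 1)]) @ wh (t + 1) [Dec (t + 1)]) (0, c, out)
      (T1 + ((n * (T2 + 2 + 2) + 1) + (3 * n + 1))) (0, C n, U n)"
proof -
  let ?Q = "[Dec t] @ P2 @ [Inc (t + 1)]"
  let ?s = "\<lambda>j. (0, (C j)(t := n - j, t + 1 := j), U j)"
  have loop: "frag w (wh t ?Q) (?s 0) (n * (T2 + 2 + 2) + 1) (?s n)"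
  proof (rule frag_wh[where s = ?s])
    fix j assume j: "j < n"
    have 1: "frag w [Dec t] (?s j) 1 (0, (C j)(t := n - Suc j, t + 1 := j), U j)"
      by (intro frag_straight) (auto simp: fun_eq_iff)
    have "frag w [Inc (t + 1)] (0, (C (Suc j))(t := n - Suc j, t + 1 := j), U (Suc j)) 1 (?s (Suc j))"
      by (intro frag_straight) (auto simp: fun_eq_iff)
    from frag_append[OF 1 frag_append[OF body[OF j] this]]
    show "frag w ?Q (?s j) (T2 + 2) (?s (Suc j))" by simp
  qed auto
  have s0: "?s 0 = (0, c(t := n), out)" using C(1,2) C(4)[of 0] by (auto simp: fun_eq_iff)
  let ?s' = "\<lambda>j. (0, (C n)(t := 0, t + 1 := n - j), U n)"
  have clear: "frag w (wh (t + 1) [Dec (t + 1)]) (?s' 0) (n * (1 + 2) + 1) (?s' n)"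
  proof (rule frag_wh[where s = ?s'])
    show "frag w [Dec (t + 1)] (?s' j) 1 (?s' (Suc j))" if "j < n" for j
      using that by (intro frag_straight) (auto simp: fun_eq_iff)
  qed auto
  have s1: "?s' n = (0, C n, U n)" using C(3)[of n] C(4)[of n] by (auto simp: fun_eq_iff)
  have "frag w (wh (t + 1) [Dec (t + 1)]) (?s n) (3 * n + 1) (0, C n, U n)"
    using frag_mono[OF clear[unfolded s1], of "3 * n + 1"] by simp
  from frag_append[OF P1 frag_append[OF loop[unfolded s0] this]] show ?thesis .
qed

text \<open>The exponent is the one composed by \<open>pow_add\<close>, \<open>pow_mult\<close> and
  \<open>pow_lin\<close>; the body runs with bound \<open>B ^ (k1 + 1)\<close>, hence in time
  \<open>(B ^ (k1 + 1)) ^ k2\<close>.\<close>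

lemma for_time:
  assumes B: "(2::nat) \<le> B" and n: "n \<le> B ^ k1"
  shows "B ^ k1 + ((n * ((B ^ (k1 + 1)) ^ k2 + 2 + 2) + 1) + (3 * n + 1)) \<le>
    B ^ (k1 + ((1 + (k1 + (1 + (k1 + 1) * k2 + (2 + 2) + 1)) + 1 + 1) + (3 + k1 + 1 + 1) + 1) + 1)"
proof -
  let ?b = "(k1 + 1) * k2"
  have "n * (1 * B ^ ?b + (2 + 2)) \<le> B ^ (k1 + (1 + ?b + (2 + 2) + 1))"
    by (rule pow_mult[OF n pow_lin[OF B order_refl]])
  from pow_lin[OF B this, of 1 1]
  have "n * ((B ^ (k1 + 1)) ^ k2 + 2 + 2) + 1 \<le> B ^ (1 + (k1 + (1 + ?b + (2 + 2) + 1)) + 1 + 1)"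
    by (simp only: power_mult mult_1 add.assoc)
  from pow_add[OF B order_refl pow_add[OF B this pow_lin[OF B n]]] show ?thesis .
qed

text \<open>Only a sum enlarges the environment: its index stays below a range of at most
  \<open>B ^ k1\<close>, so the body is used with the bound \<open>B ^ (k1 + 1)\<close>.\<close>

lemma code_correct: "\<exists>k. code_within e k"
proof (induction e)
  case (Const n)
  show ?case
  proof (rule code_withinI[where k = n], intro exI conjI)
    fix w :: "nat list" and v \<rho> c :: "nat \<Rightarrow> nat" and r t B :: nat and out :: "nat list"
    assume "2 \<le> B"
    thus "eval (Const n) w v \<le> B ^ n" "n \<le> B ^ n" by (simp_all add: pow_const)
    show "frag w (code (Const n) \<rho> r t) (0, c, out) n (0, c(r := c r + eval (Const n) w v), out)"
      by (simp add: frag_replicate_Inc)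
  qed auto
next
  case (Var i)
  show ?case
  proof (rule code_withinI[where k = "9 + 1 + 2 + 1"], intro exI conjI)
    fix w :: "nat list" and v \<rho> c :: "nat \<Rightarrow> nat" and r t B :: nat and out :: "nat list"
    assume a: "r < t" "\<And>i. \<rho> i < t \<and> \<rho> i \<noteq> r \<and> c (\<rho> i) = v i" "\<And>j. j \<ge> t \<Longrightarrow> c j = 0" "2 \<le> B"
      "\<And>i. v i \<le> B"
    from a(5) show 1: "eval (Var i) w v \<le> B ^ 1" by simp
    show "9 * v i + 2 \<le> B ^ (9 + 1 + 2 + 1)" using 1 a(4) by (intro pow_lin) auto
    have ne: "\<rho> i < t" "\<rho> i \<noteq> r" "c (\<rho> i) = v i" using a(2)[of i] by auto
    \<comment> \<open>Reading a counter destroys it: the first loop moves it into \<open>r\<close>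
      and \<open>t\<close>, the second restores it from \<open>t\<close>.\<close>
    let ?s = "\<lambda>j. (0, c(\<rho> i := v i - j, r := c r + j, t := j), out)"
    let ?s' = "\<lambda>j. (0, c(\<rho> i := j, r := c r + v i, t := v i - j), out)"
    have "frag w (wh (\<rho> i) [Dec (\<rho> i), Inc r, Inc t]) (?s 0) (v i * (3 + 2) + 1) (?s (v i))"
    proof (rule frag_wh)
      show "frag w [Dec (\<rho> i), Inc r, Inc t] (?s j) 3 (?s (Suc j))" if "j < v i" for j
        using ne a(1) that
        by (intro frag_straight) (auto simp: fun_eq_iff)
    qed (use ne a(1) in auto)
    moreover have "frag w (wh t [Dec t, Inc (\<rho> i)]) (?s' 0) (v i * (2 + 2) + 1) (?s' (v i))"
    proof (rule frag_wh)
      show "frag w [Dec t, Inc (\<rho> i)] (?s' j) 2 (?s' (Suc j))" if "j < v i" for j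
        using ne a(1) that
        by (intro frag_straight) (auto simp: fun_eq_iff)
    qed (use ne a(1) in auto)
    moreover have "?s 0 = (0, c, out)" using a(3)[of t] ne by (auto simp: fun_eq_iff)
    moreover have "?s (v i) = ?s' 0" by simp
    moreover have "?s' (v i) = (0, c(r := c r + eval (Var i) w v), out)"
      using a(1) a(3)[of t] ne by (auto simp: fun_eq_iff)
    ultimately show "frag w (code (Var i) \<rho> r t) (0, c, out) (9 * v i + 2)
        (0, c(r := c r + eval (Var i) w v), out)"
      using frag_append by fastforce
  qed auto
next
  case Len
  show ?case
  proof (rule code_withinI[where k = "9 + 1 + 2 + 1"], intro exI conjI)
    fix w :: "nat list" and v \<rho> c :: "nat \<Rightarrow> nat" and r t B :: nat and out :: "nat list"
    assume a: "0 \<notin> set w" "r < t" "\<And>j. j \<ge> t \<Longrightarrow> c j = 0" "2 \<le> B" "length w \<le> B"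
    from a(5) show 1: "eval Len w v \<le> B ^ 1" by simp
    show "9 * length w + 2 \<le> B ^ (9 + 1 + 2 + 1)" using 1 a(4) by (intro pow_lin) auto
    let ?n = "length w"
    let ?s = "\<lambda>j. (int (?n - j), c(r := c r + ?n, t := ?n - j), out)"
    have "frag w [Jeq 0 5, Inc r, Inc t, Fwd, Jback 4] (0, c, out) (?n * 5 + 1) (?s 0)"
      using frag_Len[OF a(1), of r t c out] a(2,3) by simp
    moreover have "frag w (wh t [Dec t, Back]) (?s 0) (?n * (2 + 2) + 1) (?s ?n)"
    proof (rule frag_wh)
      show "frag w [Dec t, Back] (?s j) 2 (?s (Suc j))" if "j < ?n" for j
        using a(2) that
        by (intro frag_straight) (auto simp: fun_eq_iff)
    qed (use a(2) in auto)
    moreover have "?s ?n = (0, c(r := c r + eval Len w v), out)"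
      using a(2,3) by (auto simp: fun_eq_iff)
    ultimately show "frag w (code Len \<rho> r t) (0, c, out) (9 * length w + 2)
        (0, c(r := c r + eval Len w v), out)"
      using frag_append by fastforce
  qed auto
next
  case (Plus e1 e2)
  then obtain k1 k2 where k: "code_within e1 k1" "code_within e2 k2" by blast
  show ?case
  proof (rule code_withinI[where k = "k1 + k2 + 1"], intro exI conjI)
    fix w :: "nat list" and v \<rho> c :: "nat \<Rightarrow> nat" and r t B :: nat and out :: "nat list"
    assume a: "0 \<notin> set w" "r < t" "\<And>i. \<rho> i < t \<and> \<rho> i \<noteq> r \<and> c (\<rho> i) = v i"
      "\<And>j. j \<ge> t \<Longrightarrow> c j = 0" "2 \<le> B" "length w \<le> B" "\<And>i. v i \<le> B"
    note 1 = code_withinD[where \<rho> = \<rho> and c = c and v = v, OF k(1) a]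
    have "frag w (code e2 \<rho> r t) (0, c(r := c r + eval e1 w v), out) (B ^ k2)
       (0, (c(r := c r + eval e1 w v))(r := (c(r := c r + eval e1 w v)) r + eval e2 w v), out)"
      using a by (intro code_withinD(2)[OF k(2)]) auto
    from frag_append[OF 1(2) this]
    show "frag w (code (Plus e1 e2) \<rho> r t) (0, c, out) (B ^ k1 + B ^ k2)
        (0, c(r := c r + eval (Plus e1 e2) w v), out)"
      by (simp add: add.assoc)
    show "eval (Plus e1 e2) w v \<le> B ^ (k1 + k2 + 1)"
      using 1(1) code_withinD(1)[where \<rho> = \<rho> and c = c and v = v, OF k(2) a] a(5) pow_add by simp
    show "B ^ k1 + B ^ k2 \<le> B ^ (k1 + k2 + 1)" using a(5) by (intro pow_add) auto
  qed auto
next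
  case (Minus e1 e2)
  then obtain k1 k2 where k: "code_within e1 k1" "code_within e2 k2" by blast
  show ?case
  proof (rule code_withinI[where k = "k1 + (k2 + (4 + (k1 + k2 + 1) + 2 + 1) + 1) + 1"], intro exI conjI)
    fix w :: "nat list" and v \<rho> c :: "nat \<Rightarrow> nat" and r t B :: nat and out :: "nat list"
    assume a: "0 \<notin> set w" "r < t" "\<And>i. \<rho> i < t \<and> \<rho> i \<noteq> r \<and> c (\<rho> i) = v i"
      "\<And>j. j \<ge> t \<Longrightarrow> c j = 0" "2 \<le> B" "length w \<le> B" "\<And>i. v i \<le> B"
    let ?x = "eval e1 w v" and ?y = "eval e2 w v"
    have ne: "\<rho> i < t" for i using a(3) by blast
    have ne': "\<rho> i < t + 2 \<and> \<rho> i \<noteq> t \<and> c (\<rho> i) = v i" for i using a(3)[of i] by auto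
    have "frag w (code e1 \<rho> t (t + 2)) (0, c, out) (B ^ k1) (0, c(t := c t + ?x), out)"
      using a ne' by (intro code_withinD(2)[OF k(1)]) auto
    hence 1: "frag w (code e1 \<rho> t (t + 2)) (0, c, out) (B ^ k1) (0, c(t := ?x), out)"
      using a(4) by simp
    have "frag w (code e2 \<rho> (t + 1) (t + 2)) (0, c(t := ?x), out) (B ^ k2)
        (0, (c(t := ?x))(t + 1 := (c(t := ?x)) (t + 1) + ?y), out)"
    proof (rule code_withinD(2)[OF k(2)])
      show "\<rho> i < t + 2 \<and> \<rho> i \<noteq> t + 1 \<and> (c(t := ?x)) (\<rho> i) = v i" for i
        using ne[of i] a(3)[of i] by auto
    qed (use a in auto)
    hence 2: "frag w (code e2 \<rho> (t + 1) (t + 2)) (0, c(t := ?x), out) (B ^ k2)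
        (0, c(t := ?x, t + 1 := ?y), out)"
      using a(4) by simp
    let ?s = "\<lambda>j. (0, c(t := ?x - j, t + 1 := ?y - j), out)"
    have "frag w (wh (t + 1) [Dec (t + 1), Dec t]) (?s 0) (?y * (2 + 2) + 1) (?s ?y)"
    proof (rule frag_wh)
      show "frag w [Dec (t + 1), Dec t] (?s j) 2 (?s (Suc j))" if "j < ?y" for j
        using that by (intro frag_straight) (auto simp: fun_eq_iff)
    qed auto
    hence 3: "frag w (wh (t + 1) [Dec (t + 1), Dec t]) (0, c(t := ?x, t + 1 := ?y), out) (?y * 4 + 1)
        (0, c(t := ?x - ?y), out)"
      using a(4)[of "Suc t"] by (simp add: fun_upd_idem)
    let ?s' = "\<lambda>j. (0, c(t := ?x - ?y - j, r := c r + j), out)"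
    have "frag w (wh t [Dec t, Inc r]) (?s' 0) ((?x - ?y) * (2 + 2) + 1) (?s' (?x - ?y))"
    proof (rule frag_wh)
      show "frag w [Dec t, Inc r] (?s' j) 2 (?s' (Suc j))" if "j < ?x - ?y" for j
        using that a(2) by (intro frag_straight) (auto simp: fun_eq_iff)
    qed (use a(2) in auto)
    moreover have "?s' 0 = (0, c(t := ?x - ?y), out)" using a(2) by (auto simp: fun_eq_iff)
    moreover have "?s' (?x - ?y) = (0, c(r := c r + eval (Minus e1 e2) w v), out)"
      using a(4)[of t] a(2) by (auto simp: fun_eq_iff)
    ultimately have "frag w (wh t [Dec t, Inc r]) (0, c(t := ?x - ?y), out) ((?x - ?y) * 4 + 1)
       (0, c(r := c r + eval (Minus e1 e2) w v), out)" by simp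
    from frag_append[OF 1 frag_append[OF 2 frag_append[OF 3 this]]]
    show "frag w (code (Minus e1 e2) \<rho> r t) (0, c, out)
        (B ^ k1 + (B ^ k2 + ((?y * 4 + 1) + ((?x - ?y) * 4 + 1))))
        (0, c(r := c r + eval (Minus e1 e2) w v), out)" by simp
    have x: "?x \<le> B ^ k1" and y: "?y \<le> B ^ k2"
      using code_withinD(1)[where \<rho> = \<rho> and c = c and v = v, OF k(1) a] code_withinD(1)[where \<rho> = \<rho> and c = c and v = v, OF k(2) a] by auto
    show "eval (Minus e1 e2) w v \<le> B ^ k1" using x by simp
    have "(?y * 4 + 1) + (d * 4 + 1) \<le> 4 * (?x + ?y) + 2" if "d \<le> ?x" for d
      using that by simp
    note this[OF diff_le_self]
    also have "\<dots> \<le> B ^ (4 + (k1 + k2 + 1) + 2 + 1)"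
      using x y a(5) by (intro pow_lin pow_add)
    finally have "(?y * 4 + 1) + ((?x - ?y) * 4 + 1) \<le> B ^ (4 + (k1 + k2 + 1) + 2 + 1)" .
    from pow_add[OF a(5) order_refl pow_add[OF a(5) order_refl this]]
    show "B ^ k1 + (B ^ k2 + ((?y * 4 + 1) + ((?x - ?y) * 4 + 1)))
        \<le> B ^ (k1 + (k2 + (4 + (k1 + k2 + 1) + 2 + 1) + 1) + 1)" .
  qed simp
next
  case (Sum e1 e2)
  then obtain k1 k2 where k: "code_within e1 k1" "code_within e2 k2" by blast
  let ?b = "(k1 + 1) * k2"
  show ?case
  proof (rule code_withinI[where
        k = "k1 + ((1 + (k1 + (1 + ?b + (2 + 2) + 1)) + 1 + 1) + (3 + k1 + 1 + 1) + 1) + 1"], intro exI conjI)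
    fix w :: "nat list" and v \<rho> c :: "nat \<Rightarrow> nat" and r t B :: nat and out :: "nat list"
    assume a: "0 \<notin> set w" "r < t" "\<And>i. \<rho> i < t \<and> \<rho> i \<noteq> r \<and> c (\<rho> i) = v i"
      "\<And>j. j \<ge> t \<Longrightarrow> c j = 0" "2 \<le> B" "length w \<le> B" "\<And>i. v i \<le> B"
    let ?x = "eval e1 w v" and ?y = "\<lambda>j. \<Sum>i<j. eval e2 w (case_nat i v)"
    have ne': "\<rho> i < t + 2 \<and> \<rho> i \<noteq> t \<and> c (\<rho> i) = v i" for i using a(3)[of i] by auto
    have x: "?x \<le> B ^ k1" using code_withinD(1)[where \<rho> = \<rho> and c = c and v = v, OF k(1) a] by auto
    \<comment> \<open>\<open>B ^ (k1 + 1)\<close> bounds the old variables and all indices of the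
      sum at once.\<close>
    have B': "B \<le> B ^ (k1 + 1)" "B ^ k1 \<le> B ^ (k1 + 1)" using a(5) by auto
    have "frag w (code e1 \<rho> t (t + 2)) (0, c, out) (B ^ k1) (0, c(t := c t + ?x), out)"
      using a ne' by (intro code_withinD(2)[OF k(1)]) auto
    hence 1: "frag w (code e1 \<rho> t (t + 2)) (0, c, out) (B ^ k1) (0, c(t := ?x), out)"
      using a(4) by simp
    let ?C = "\<lambda>j. c(r := c r + ?y j)"
    have body: "eval e2 w (case_nat j v) \<le> (B ^ (k1 + 1)) ^ k2 \<and>
      frag w (code e2 (case_nat (t + 1) \<rho>) r (t + 2)) (0, (?C j)(t := ?x - Suc j, t + 1 := j), out)
        ((B ^ (k1 + 1)) ^ k2) (0, (?C (Suc j))(t := ?x - Suc j, t + 1 := j), out)" if j: "j < ?x" for j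
    proof -
      let ?c = "(?C j)(t := ?x - Suc j, t + 1 := j)"
      have h: "case_nat (t + 1) \<rho> i < t + 2 \<and> case_nat (t + 1) \<rho> i \<noteq> r \<and>
        ?c (case_nat (t + 1) \<rho> i) = case_nat j v i" for i
        using a(2) a(3)[of "i - 1"] by (auto split: nat.splits)
      have h': "case_nat j v i \<le> B ^ (k1 + 1)" for i
        using a(7)[of "i - 1"] j x B' by (auto split: nat.splits simp del: power_Suc power_add)
      have r: "r < t + 2" using a(2) by simp
      have z: "?c i = 0" if "i \<ge> t + 2" for i using that a(2,4) by simp
      have B2: "2 \<le> B ^ (k1 + 1)" "length w \<le> B ^ (k1 + 1)" using B'(1) a(5,6) by linarith+
      note D = code_withinD[where \<rho> = "case_nat (t + 1) \<rho>" and c = ?c and v = "case_nat j v",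
          OF k(2) a(1) r h z B2 h']
      have f: "eval e2 w (case_nat j v) \<le> (B ^ (k1 + 1)) ^ k2"
        "frag w (code e2 (case_nat (t + 1) \<rho>) r (t + 2)) (0, ?c, out) ((B ^ (k1 + 1)) ^ k2)
        (0, ?c(r := ?c r + eval e2 w (case_nat j v)), out)"
        by (rule D, assumption)+
      have "?c(r := ?c r + eval e2 w (case_nat j v)) = (?C (Suc j))(t := ?x - Suc j, t + 1 := j)"
        using a(2) by (auto simp: fun_eq_iff)
      thus ?thesis using f by (simp only: simp_thms)
    qed
    have "frag w (code (Sum e1 e2) \<rho> r t) (0, c, out)
       (B ^ k1 + ((?x * ((B ^ (k1 + 1)) ^ k2 + 2 + 2) + 1) + (3 * ?x + 1))) (0, ?C ?x, out)"
      unfolding code.simps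
    proof (rule frag_for[OF 1, where C = ?C and U = "\<lambda>_. out"])
      show "frag w (code e2 (case_nat (t + 1) \<rho>) r (t + 2)) (0, (?C j)(t := ?x - Suc j, t + 1 := j), out)
        ((B ^ (k1 + 1)) ^ k2) (0, (?C (Suc j))(t := ?x - Suc j, t + 1 := j), out)" if "j < ?x" for j
        using body[OF that] by (rule conjunct2)
    qed (use a(2,4) in auto)
    thus "frag w (code (Sum e1 e2) \<rho> r t) (0, c, out)
       (B ^ k1 + ((?x * ((B ^ (k1 + 1)) ^ k2 + 2 + 2) + 1) + (3 * ?x + 1)))
       (0, c(r := c r + eval (Sum e1 e2) w v), out)" by (simp only: eval.simps)
    have "?y ?x \<le> (\<Sum>i<?x. B ^ ?b)"
    proof (rule sum_mono)
      fix i assume "i \<in> {..<?x}"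
      hence "eval e2 w (case_nat i v) \<le> (B ^ (k1 + 1)) ^ k2" using body by blast
      thus "eval e2 w (case_nat i v) \<le> B ^ ?b" by (simp only: power_mult)
    qed
    also have "\<dots> \<le> B ^ (k1 + ?b)" using pow_mult[OF x, of "B ^ ?b"] by simp
    finally show "eval (Sum e1 e2) w v \<le> B ^ (k1 + ?b)" by simp
    show "B ^ k1 + ((?x * ((B ^ (k1 + 1)) ^ k2 + 2 + 2) + 1) + (3 * ?x + 1))
      \<le> B ^ (k1 + ((1 + (k1 + (1 + ?b + (2 + 2) + 1)) + 1 + 1) + (3 + k1 + 1 + 1) + 1) + 1)"
      by (rule for_time[OF a(5) x])
  qed simp
next
  case (Is s e)
  then obtain k where k: "code_within e k" by blast
  show ?case
  proof (rule code_withinI[where k = "k + (9 + k + 5 + 1) + 1"], intro exI conjI)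
    fix w :: "nat list" and v \<rho> c :: "nat \<Rightarrow> nat" and r t B :: nat and out :: "nat list"
    assume a: "0 \<notin> set w" "r < t" "\<And>i. \<rho> i < t \<and> \<rho> i \<noteq> r \<and> c (\<rho> i) = v i"
      "\<And>j. j \<ge> t \<Longrightarrow> c j = 0" "2 \<le> B" "length w \<le> B" "\<And>i. v i \<le> B"
    let ?x = "eval e w v"
    have ne': "\<rho> i < t + 2 \<and> \<rho> i \<noteq> t \<and> c (\<rho> i) = v i" for i using a(3)[of i] by auto
    have "frag w (code e \<rho> t (t + 2)) (0, c, out) (B ^ k) (0, c(t := c t + ?x), out)"
      using a ne' by (intro code_withinD(2)[OF k]) auto
    hence 1: "frag w (code e \<rho> t (t + 2)) (0, c, out) (B ^ k) (0, c(t := ?x), out)"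
      using a(4) by simp
    let ?s = "\<lambda>j. (int j, c(t := ?x - j, t + 1 := j), out)"
    have "frag w (wh t [Dec t, Inc (t + 1), Fwd]) (?s 0) (?x * (3 + 2) + 1) (?s ?x)"
    proof (rule frag_wh)
      show "frag w [Dec t, Inc (t + 1), Fwd] (?s j) 3 (?s (Suc j))" if "j < ?x" for j
        using that by (intro frag_straight) (auto simp: fun_eq_iff)
    qed auto
    moreover have "?s 0 = (0, c(t := ?x), out)" using a(4)[of "t + 1"] by (auto simp: fun_eq_iff)
    ultimately have 2: "frag w (wh t [Dec t, Inc (t + 1), Fwd]) (0, c(t := ?x), out) (?x * 5 + 1) (?s ?x)"
      by simp
    let ?z = "eval (Is s e) w v"
    let ?s' = "\<lambda>j. (int (?x - j), c(t := 0, t + 1 := ?x - j, r := c r + ?z), out)"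
    have "frag w [Inc r] (?s ?x) 1 (int ?x, c(t := 0, t + 1 := ?x, r := Suc (c r)), out)"
      using a(2) by (intro frag_straight) (auto simp: fun_eq_iff)
    moreover have "frag w [Jeq s 2, Dec r] (int ?x, c(t := 0, t + 1 := ?x, r := Suc (c r)), out) 2 (?s' 0)"
      using frag_Jeq_Dec[of w s r "int ?x" "c(t := 0, t + 1 := ?x, r := Suc (c r))" out] by auto
    ultimately have 3: "frag w [Inc r, Jeq s 2, Dec r] (?s ?x) (1 + 2) (?s' 0)"
      using frag_append by fastforce
    have "frag w (wh (t + 1) [Dec (t + 1), Back]) (?s' 0) (?x * (2 + 2) + 1) (?s' ?x)"
    proof (rule frag_wh)
      show "frag w [Dec (t + 1), Back] (?s' j) 2 (?s' (Suc j))" if "j < ?x" for j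
        using that a(2) by (intro frag_straight) (auto simp: fun_eq_iff)
    qed (use a(2) in auto)
    moreover have "?s' ?x = (0, c(r := c r + ?z), out)"
      using a(4)[of t] a(4)[of "t + 1"] a(2) by (auto simp: fun_eq_iff)
    ultimately have 4: "frag w (wh (t + 1) [Dec (t + 1), Back]) (?s' 0) (?x * 4 + 1)
      (0, c(r := c r + ?z), out)" by simp
    from frag_mono[OF frag_append[OF 1 frag_append[OF 2 frag_append[OF 3 4]]], of "B ^ k + (9 * ?x + 5)"]
    show "frag w (code (Is s e) \<rho> r t) (0, c, out) (B ^ k + (9 * ?x + 5)) (0, c(r := c r + ?z), out)"
      by (simp del: eval.simps)
    have x: "?x \<le> B ^ k" using code_withinD(1)[where \<rho> = \<rho> and c = c and v = v, OF k a] by auto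
    show "B ^ k + (9 * ?x + 5) \<le> B ^ (k + (9 + k + 5 + 1) + 1)"
      by (rule pow_add[OF a(5) order_refl pow_lin[OF a(5) x]])
    show "eval (Is s e) w v \<le> B ^ 0" by simp
  qed simp
qed


section \<open>Programs that write an output\<close>

text \<open>There is no conditional: a loop over an expression with value \<open>0\<close> or
  \<open>1\<close> takes its place.\<close>

datatype uprog = Out nat | Then uprog uprog | For uexp uprog

fun prog_out :: "uprog \<Rightarrow> nat list \<Rightarrow> (nat \<Rightarrow> nat) \<Rightarrow> nat list" where
  "prog_out (Out a) w v = [a]"
| "prog_out (Then p q) w v = prog_out p w v @ prog_out q w v"
| "prog_out (For e p) w v = concat (map (\<lambda>i. prog_out p w (case_nat i v)) [0..<eval e w v])"

fun prog_code :: "uprog \<Rightarrow> (nat \<Rightarrow> nat) \<Rightarrow> nat \<Rightarrow> instr list" where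
  "prog_code (Out a) \<rho> t = [Emit a]"
| "prog_code (Then p q) \<rho> t = prog_code p \<rho> t @ prog_code q \<rho> t"
| "prog_code (For e p) \<rho> t =
     code e \<rho> t (t + 2) @
     wh t ([Dec t] @ prog_code p (case_nat (t + 1) \<rho>) (t + 2) @ [Inc (t + 1)]) @
     wh (t + 1) [Dec (t + 1)]"

definition prog_within :: "uprog \<Rightarrow> nat \<Rightarrow> bool" where
  "prog_within p k \<longleftrightarrow>
     (\<forall>w v \<rho> t c out B. 0 \<notin> set w \<longrightarrow> (\<forall>i. \<rho> i < t \<and> c (\<rho> i) = v i) \<longrightarrow>
        (\<forall>j\<ge>t. c j = 0) \<longrightarrow> 2 \<le> B \<longrightarrow> length w \<le> B \<longrightarrow> (\<forall>i. v i \<le> B) \<longrightarrow>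
        frag w (prog_code p \<rho> t) (0, c, out) (B ^ k) (0, c, out @ prog_out p w v))"

lemma prog_withinD:
  assumes "prog_within p k" "0 \<notin> set w" "\<And>i. \<rho> i < t \<and> c (\<rho> i) = v i"
    "\<And>j. j \<ge> t \<Longrightarrow> c j = 0" "2 \<le> B" "length w \<le> B" "\<And>i. v i \<le> B"
  shows "frag w (prog_code p \<rho> t) (0, c, out) (B ^ k) (0, c, out @ prog_out p w v)"
  using assms unfolding prog_within_def by blast

lemma prog_withinI:
  assumes "\<And>w v \<rho> t c out B. 0 \<notin> set w \<Longrightarrow> (\<And>i. \<rho> i < t \<and> c (\<rho> i) = v i) \<Longrightarrow>
        (\<And>j. j \<ge> t \<Longrightarrow> c j = 0) \<Longrightarrow> 2 \<le> B \<Longrightarrow> length w \<le> B \<Longrightarrow> (\<And>i. v i \<le> B) \<Longrightarrow>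
        \<exists>T. T \<le> B ^ k \<and> frag w (prog_code p \<rho> t) (0, c, out) T (0, c, out @ prog_out p w v)"
  shows "\<exists>k. prog_within p k"
  unfolding prog_within_def using assms frag_mono by (intro exI[of _ k]) blast

lemma prog_correct: "\<exists>k. prog_within p k"
proof (induction p)
  case (Out a)
  show ?case
  proof (rule prog_withinI[where k = 0], intro exI conjI)
    fix w :: "nat list" and v \<rho> c :: "nat \<Rightarrow> nat" and t B :: nat and out :: "nat list"
    show "frag w (prog_code (Out a) \<rho> t) (0, c, out) 1 (0, c, out @ prog_out (Out a) w v)"
      using frag_Emit by simp
  qed simp
next
  case (Then p q)
  then obtain k1 k2 where k: "prog_within p k1" "prog_within q k2" by blast
  show ?case
  proof (rule prog_withinI[where k = "k1 + k2 + 1"], intro exI conjI)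
    fix w :: "nat list" and v \<rho> c :: "nat \<Rightarrow> nat" and t B :: nat and out :: "nat list"
    assume a: "0 \<notin> set w" "\<And>i. \<rho> i < t \<and> c (\<rho> i) = v i"
      "\<And>j. j \<ge> t \<Longrightarrow> c j = 0" "2 \<le> B" "length w \<le> B" "\<And>i. v i \<le> B"
    note D = prog_withinD[where \<rho> = \<rho> and c = c and v = v, OF _ a]
    from frag_append[OF D[OF k(1)] D[OF k(2)]]
    show "frag w (prog_code (Then p q) \<rho> t) (0, c, out) (B ^ k1 + B ^ k2)
      (0, c, out @ prog_out (Then p q) w v)" by simp
    show "B ^ k1 + B ^ k2 \<le> B ^ (k1 + k2 + 1)" using pow_add[OF a(4) order_refl order_refl] .
  qed
next
  case (For e1 e2)
  then obtain k2 where k2: "prog_within e2 k2" by blast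
  obtain k1 where k1: "code_within e1 k1" using code_correct by blast
  show ?case
  proof (rule prog_withinI[where k = "k1 + ((1 + (k1 + (1 + (k1 + 1) * k2 + (2 + 2) + 1)) + 1 + 1)
        + (3 + k1 + 1 + 1) + 1) + 1"], intro exI conjI)
    fix w :: "nat list" and v \<rho> c :: "nat \<Rightarrow> nat" and t B :: nat and out :: "nat list"
    assume a: "0 \<notin> set w" "\<And>i. \<rho> i < t \<and> c (\<rho> i) = v i"
      "\<And>j. j \<ge> t \<Longrightarrow> c j = 0" "2 \<le> B" "length w \<le> B" "\<And>i. v i \<le> B"
    let ?x = "eval e1 w v" and ?O = "\<lambda>j. out @ concat (map (\<lambda>i. prog_out e2 w (case_nat i v)) [0..<j])"
    have ne: "\<rho> i < t + 2 \<and> \<rho> i \<noteq> t \<and> c (\<rho> i) = v i" for i using a(2)[of i] by auto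
    have z: "c i = 0" if "i \<ge> t + 2" for i using that a(3) by simp
    have t2: "t < t + 2" by simp
    note D1 = code_withinD[where \<rho> = \<rho> and c = c and v = v, OF k1 a(1) t2 ne z a(4-6)]
    have x: "?x \<le> B ^ k1" by (rule D1(1), assumption)
    have B': "B \<le> B ^ (k1 + 1)" "B ^ k1 \<le> B ^ (k1 + 1)" using a(4) by auto
    have "frag w (code e1 \<rho> t (t + 2)) (0, c, out) (B ^ k1) (0, c(t := c t + ?x), out)"
      by (rule D1(2), assumption)
    hence 1: "frag w (code e1 \<rho> t (t + 2)) (0, c, out) (B ^ k1) (0, c(t := ?x), out)"
      using a(3) by simp
    have "frag w (prog_code (For e1 e2) \<rho> t) (0, c, out)
       (B ^ k1 + ((?x * ((B ^ (k1 + 1)) ^ k2 + 2 + 2) + 1) + (3 * ?x + 1))) (0, c, ?O ?x)"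
      unfolding prog_code.simps
    proof (rule frag_for[OF 1, where C = "\<lambda>_. c" and U = ?O])
      fix j assume j: "j < ?x"
      let ?c = "c(t := ?x - Suc j, t + 1 := j)"
      have h: "case_nat (t + 1) \<rho> i < t + 2 \<and> ?c (case_nat (t + 1) \<rho> i) = case_nat j v i" for i
        using a(2)[of "i - 1"] by (auto split: nat.splits)
      have h': "case_nat j v i \<le> B ^ (k1 + 1)" for i
        using a(6)[of "i - 1"] j x B' by (auto split: nat.splits simp del: power_Suc power_add)
      have z: "?c i = 0" if "i \<ge> t + 2" for i using that a(3) by simp
      have B2: "2 \<le> B ^ (k1 + 1)" "length w \<le> B ^ (k1 + 1)" using B'(1) a(4,5) by linarith+
      note D = prog_withinD[where \<rho> = "case_nat (t + 1) \<rho>" and c = ?c and v = "case_nat j v",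
          OF k2 a(1) h z B2 h']
      have "frag w (prog_code e2 (case_nat (t + 1) \<rho>) (t + 2)) (0, ?c, ?O j)
        ((B ^ (k1 + 1)) ^ k2) (0, ?c, ?O j @ prog_out e2 w (case_nat j v))"
        by (rule D, assumption)
      thus "frag w (prog_code e2 (case_nat (t + 1) \<rho>) (t + 2)) (0, ?c, ?O j)
        ((B ^ (k1 + 1)) ^ k2) (0, ?c, ?O (Suc j))" by simp
    qed (use a(3) in auto)
    thus "frag w (prog_code (For e1 e2) \<rho> t) (0, c, out)
       (B ^ k1 + ((?x * ((B ^ (k1 + 1)) ^ k2 + 2 + 2) + 1) + (3 * ?x + 1)))
       (0, c, out @ prog_out (For e1 e2) w v)" by (simp only: prog_out.simps)
    show "B ^ k1 + ((?x * ((B ^ (k1 + 1)) ^ k2 + 2 + 2) + 1) + (3 * ?x + 1)) \<le>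
      B ^ (k1 + ((1 + (k1 + (1 + (k1 + 1) * k2 + (2 + 2) + 1)) + 1 + 1) + (3 + k1 + 1 + 1) + 1) + 1)"
      by (rule for_time[OF a(4) x])
  qed
qed

lemma ex_counter_bound:
  "\<forall>ins\<in>set P. \<forall>a. ins = Emit a \<longrightarrow> a < 4 \<Longrightarrow> \<exists>K\<ge>1. \<forall>ins\<in>set P. wf_instr K ins"
proof (induction P)
  case (Cons ins P)
  then obtain K where K: "K \<ge> 1" "\<forall>ins\<in>set P. wf_instr K ins" by auto
  have mono: "wf_instr K' i" if "wf_instr K'' i" "K'' \<le> K'" for K' K'' i
    using that by (cases i) auto
  have "\<exists>L. wf_instr L ins"
    using Cons.prems by (cases ins) auto
  then obtain L where "wf_instr L ins" by blast
  with K mono[of K _ "max K L"] mono[of L ins "max K L"] show ?case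
    by (intro exI[of _ "max K L"]) auto
qed auto

lemma code_no_Emit: "Emit a \<notin> set (code e \<rho> r t)"
  by (induction e arbitrary: \<rho> r t) (auto simp: wh_def)

fun prog_symbols :: "uprog \<Rightarrow> nat set" where
  "prog_symbols (Out a) = {a}"
| "prog_symbols (Then p q) = prog_symbols p \<union> prog_symbols q"
| "prog_symbols (For e p) = prog_symbols p"

lemma prog_code_Emit: "Emit a \<in> set (prog_code p \<rho> t) \<Longrightarrow> a \<in> prog_symbols p"
  by (induction p arbitrary: \<rho> t) (auto simp: wh_def code_no_Emit)

text \<open>\<open>n + 2\<close> is the choice of \<open>B\<close> for input length
  \<open>n\<close>; the summand \<open>2\<close> stands for the first step of the machine and the
  final test.\<close>

definition time_poly :: "nat \<Rightarrow> nat poly" where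
  "time_poly k = [:2, 1:] ^ k + [:2:]"

lemma poly_time_poly: "poly (time_poly k) n = (n + 2) ^ k + 2"
  by (simp add: time_poly_def add.commute)

theorem decide_exp:
  obtains M k where "turing_machine M"
    "\<And>w. 0 \<notin> set w \<Longrightarrow> halts_within M w (poly (time_poly k) (length w))"
    "\<And>w. 0 \<notin> set w \<Longrightarrow> accepts M w \<longleftrightarrow> eval e w (\<lambda>_. 0) > 0"
proof -
  \<comment> \<open>The environment is constantly \<open>0\<close>, so all variables may share
    counter \<open>1\<close>, which is \<open>0\<close>; the result goes to counter
    \<open>0\<close>, which \<open>mach\<close> tests.\<close>
  let ?P = "code e (\<lambda>_. 1) 0 2"
  obtain K where K: "K \<ge> 1" "\<forall>ins\<in>set ?P. wf_instr K ins"
    using ex_counter_bound[of ?P] code_no_Emit by blast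
  obtain k where k: "code_within e k" using code_correct by blast
  have r: "reach w ?P (0, 0, \<lambda>_. 0, []) ((length w + 2) ^ k)
      (length ?P, 0, (\<lambda>_. 0)(0 := eval e w (\<lambda>_. 0)), [])" if "0 \<notin> set w" for w
  proof -
    have "frag w ?P (0, \<lambda>_. 0, []) ((length w + 2) ^ k)
       (0, (\<lambda>_. 0)(0 := (\<lambda>_. 0) (0::nat) + eval e w (\<lambda>_. 0)), [])"
      by (rule code_withinD(2)[OF k that]) auto
    from frag_reach[OF this] show ?thesis by simp
  qed
  show thesis
  proof (rule that[of "mach K ?P" k])
    show "turing_machine (mach K ?P)" by (rule turing_machine_mach[OF K(2)])
    show "halts_within (mach K ?P) w (poly (time_poly k) (length w))" if "0 \<notin> set w" for w
      using mach_correct(1)[OF K(2,1) r[OF that]] by (simp add: poly_time_poly)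
    show "accepts (mach K ?P) w \<longleftrightarrow> eval e w (\<lambda>_. 0) > 0" if "0 \<notin> set w" for w
      using mach_correct(2)[OF K(2,1) r[OF that]] by simp
  qed
qed

theorem compute_prog:
  assumes "prog_symbols p \<subseteq> {..<4}" "\<And>x. prog_out p (word x) (\<lambda>_. 0) = word (f x)"
  shows "polytime_computable f"
proof -
  let ?P = "prog_code p (\<lambda>_. 0) 1"
  have "a < 4" if "Emit a \<in> set ?P" for a
    using prog_code_Emit[OF that] assms(1) by auto
  then obtain K where K: "K \<ge> 1" "\<forall>ins\<in>set ?P. wf_instr K ins"
    using ex_counter_bound[of ?P] by blast
  obtain k where k: "prog_within p k" using prog_correct by blast
  have r: "reach (word x) ?P (0, 0, \<lambda>_. 0, []) ((length (word x) + 2) ^ k)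
      (length ?P, 0, \<lambda>_. 0, word (f x))" for x
  proof -
    have "frag (word x) ?P (0, \<lambda>_. 0, []) ((length (word x) + 2) ^ k)
       (0, \<lambda>_. 0, [] @ prog_out p (word x) (\<lambda>_. 0))"
      by (rule prog_withinD[OF k]) (auto simp: word_def)
    from frag_reach[OF this] show ?thesis using assms(2) by simp
  qed
  have "turing_machine (mach K ?P)" by (rule turing_machine_mach[OF K(2)])
  moreover have "halts_within (mach K ?P) (word x) (poly (time_poly k) (length x))" for x
    using mach_correct(1)[OF K(2,1) r] by (simp add: poly_time_poly word_def)
  moreover have "outputs (mach K ?P) (word x) (word (f x))" for x
    using mach_correct(3)[OF K(2,1) r] by simp
  ultimately show ?thesis unfolding polytime_computable_def by blast
qed

section \<open>Definable functions\<close>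

text \<open>Definability is a property of functions, so the closure rules below apply to HOL terms
  as they stand, and no expression is written out for a concrete problem.\<close>

definition dfn :: "(nat list \<Rightarrow> (nat \<Rightarrow> nat) \<Rightarrow> nat) \<Rightarrow> bool" where
  "dfn F \<longleftrightarrow> (\<exists>e. \<forall>w v. eval e w v = F w v)"

definition dfp :: "(nat list \<Rightarrow> (nat \<Rightarrow> nat) \<Rightarrow> bool) \<Rightarrow> bool" where
  "dfp P \<longleftrightarrow> dfn (\<lambda>w v. of_bool (P w v))"

lemma dfnI: "(\<And>w v. eval e w v = F w v) \<Longrightarrow> dfn F"
  unfolding dfn_def by blast

lemma dfn_const: "dfn (\<lambda>w v. n)"
  by (rule dfnI[of "Const n"]) simp

lemma dfn_var: "dfn (\<lambda>w v. v n)"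
  by (rule dfnI[of "Var n"]) simp

lemma dfn_length: "dfn (\<lambda>w v. length w)"
  by (rule dfnI[of Len]) simp

lemma dfn_plus: "dfn F \<Longrightarrow> dfn G \<Longrightarrow> dfn (\<lambda>w v. F w v + G w v)"
  unfolding dfn_def by (metis eval.simps(4))

lemma dfn_minus: "dfn F \<Longrightarrow> dfn G \<Longrightarrow> dfn (\<lambda>w v. F w v - G w v)"
  unfolding dfn_def by (metis eval.simps(5))

lemma dfn_Suc: "dfn F \<Longrightarrow> dfn (\<lambda>w v. Suc (F w v))"
  using dfn_plus[OF _ dfn_const[of 1]] by simp

text \<open>The body of the sum sees its index as variable \<open>0\<close> and the outer variables
  shifted by one, in accordance with \<open>case_nat i v\<close>.\<close>

lemma dfn_sum:
  assumes "dfn N" "dfn (\<lambda>w v. F w (\<lambda>n. v (Suc n)) (v 0))"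
  shows "dfn (\<lambda>w v. \<Sum>i<N w v. F w v i)"
proof -
  obtain a b where "\<And>w v. eval a w v = N w v" "\<And>w v. eval b w v = F w (\<lambda>n. v (Suc n)) (v 0)"
    using assms unfolding dfn_def by blast
  thus ?thesis by (intro dfnI[of "Sum a b"]) simp
qed

text \<open>Provides weakening: a definable function that is used under a binder gets the shifted
  environment \<open>\<lambda>n. v (Suc n)\<close>.\<close>

lemma eval_rename: "\<exists>e'. \<forall>w v. eval e' w v = eval e w (\<lambda>n. v (g n))"
proof (induction e arbitrary: g)
  case (Const n)
  show ?case by (rule exI[of _ "Const n"]) simp
next
  case (Var i)
  show ?case by (rule exI[of _ "Var (g i)"]) simp
next
  case Len
  show ?case by (rule exI[of _ Len]) simp
next
  case (Plus a b)
  obtain a' b' where "\<forall>w v. eval a' w v = eval a w (\<lambda>n. v (g n))" "\<forall>w v. eval b' w v = eval b w (\<lambda>n. v (g n))"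
    using Plus by metis
  thus ?case by (intro exI[of _ "Plus a' b'"]) simp
next
  case (Minus a b)
  obtain a' b' where "\<forall>w v. eval a' w v = eval a w (\<lambda>n. v (g n))" "\<forall>w v. eval b' w v = eval b w (\<lambda>n. v (g n))"
    using Minus by metis
  thus ?case by (intro exI[of _ "Minus a' b'"]) simp
next
  case (Sum a b)
  obtain a' where a': "\<forall>w v. eval a' w v = eval a w (\<lambda>n. v (g n))" using Sum(1) by metis
  obtain b' where b': "\<forall>w v. eval b' w v = eval b w (\<lambda>n. v (case_nat 0 (\<lambda>m. Suc (g m)) n))"
    using Sum(2) by metis
  have "(\<lambda>n. case_nat i v (case_nat 0 (\<lambda>m. Suc (g m)) n)) = case_nat i (\<lambda>n. v (g n))" for i and v :: "nat \<Rightarrow> nat"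
    by (auto simp: fun_eq_iff split: nat.splits)
  thus ?case using a' b' by (intro exI[of _ "Sum a' b'"]) simp
next
  case (Is s a)
  obtain a' where "\<forall>w v. eval a' w v = eval a w (\<lambda>n. v (g n))" using Is by metis
  thus ?case by (intro exI[of _ "Is s a'"]) simp
qed

lemma dfn_rename: "dfn F \<Longrightarrow> dfn (\<lambda>w v. F w (\<lambda>n. v (g n)))"
  unfolding dfn_def using eval_rename by metis

lemma dfn_mult:
  assumes "dfn F" "dfn G"
  shows "dfn (\<lambda>w v. F w v * G w v)"
  using dfn_sum[OF assms(1), of "\<lambda>w v i. G w v"] dfn_rename[OF assms(2)] by simp

lemma dfn_of_bool: "dfp P \<Longrightarrow> dfn (\<lambda>w v. of_bool (P w v))"
  by (simp add: dfp_def)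

lemma dfn_cong: "dfn F \<Longrightarrow> (\<And>w v. F w v = G w v) \<Longrightarrow> dfn G"
  unfolding dfn_def by simp

lemma dfp_cong: "dfp F \<Longrightarrow> (\<And>w v. F w v = G w v) \<Longrightarrow> dfp G"
  unfolding dfp_def by (erule dfn_cong) simp

lemma dfp_const: "dfp (\<lambda>w v. b)"
  unfolding dfp_def by (rule dfn_const)

lemma dfp_is: "dfn F \<Longrightarrow> dfp (\<lambda>w v. content_of w (int (F w v)) = s)"
  unfolding dfp_def dfn_def by (metis eval.simps(7))

text \<open>\<open>1 - (1 - (G - F))\<close> is the sign of a truncated difference.\<close>

lemma dfp_less: "dfn F \<Longrightarrow> dfn G \<Longrightarrow> dfp (\<lambda>w v. F w v < G w v)"
  unfolding dfp_def
  by (rule dfn_cong[OF dfn_minus[OF dfn_const[of 1] dfn_minus[OF dfn_const[of 1] dfn_minus[of G F]]]]) auto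

lemma dfp_not: "dfp P \<Longrightarrow> dfp (\<lambda>w v. \<not> P w v)"
  unfolding dfp_def by (rule dfn_cong[OF dfn_minus[OF dfn_const[of 1]]]) auto

lemma dfp_conj: "dfp P \<Longrightarrow> dfp Q \<Longrightarrow> dfp (\<lambda>w v. P w v \<and> Q w v)"
  unfolding dfp_def by (drule (1) dfn_mult, erule dfn_cong) simp

lemma dfp_disj: "dfp P \<Longrightarrow> dfp Q \<Longrightarrow> dfp (\<lambda>w v. P w v \<or> Q w v)"
  using dfp_not[OF dfp_conj[OF dfp_not[of P] dfp_not[of Q]]] by simp

lemma dfp_imp: "dfp P \<Longrightarrow> dfp Q \<Longrightarrow> dfp (\<lambda>w v. P w v \<longrightarrow> Q w v)"
  using dfp_disj[OF dfp_not[of P], of Q] by simp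

lemma dfp_iff: "dfp P \<Longrightarrow> dfp Q \<Longrightarrow> dfp (\<lambda>w v. P w v \<longleftrightarrow> Q w v)"
  using dfp_conj[OF dfp_imp[of P Q] dfp_imp[of Q P]] by (rule dfp_cong) auto

lemma dfp_le: "dfn F \<Longrightarrow> dfn G \<Longrightarrow> dfp (\<lambda>w v. F w v \<le> G w v)"
  using dfp_not[OF dfp_less[of G F]] by (simp add: not_less)

lemma dfp_eq: "dfn F \<Longrightarrow> dfn G \<Longrightarrow> dfp (\<lambda>w v. F w v = G w v)"
  using dfp_conj[OF dfp_le[of F G] dfp_le[of G F]] by (rule dfp_cong) auto

lemma dfp_ex:
  assumes "dfn N" "dfp (\<lambda>w v. P w (\<lambda>n. v (Suc n)) (v 0))"
  shows "dfp (\<lambda>w v. \<exists>i<N w v. P w v i)"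
proof -
  have "dfn (\<lambda>w v. \<Sum>i<N w v. of_bool (P w v i))"
    using dfn_sum[OF assms(1), of "\<lambda>w v i. of_bool (P w v i)"] assms(2) by (simp add: dfp_def)
  from dfp_less[OF dfn_const[of 0] this] show ?thesis
    by (rule dfp_cong) (auto simp: sum_nonneg_eq_0_iff simp flip: neq0_conv)
qed

lemma dfp_all:
  assumes "dfn N" "dfp (\<lambda>w v. P w (\<lambda>n. v (Suc n)) (v 0))"
  shows "dfp (\<lambda>w v. \<forall>i<N w v. P w v i)"
  using dfp_not[OF dfp_ex[OF assms(1), of "\<lambda>w v i. \<not> P w v i"]] dfp_not[OF assms(2)] by simp

text \<open>\<open>S\<close> may consist of objects other than numbers, such as the entries of a
  transition table: the quantifier is unfolded into a disjunction that is fixed in advance.\<close>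

lemma dfp_bex_finite:
  assumes "finite S" "\<And>c. c \<in> S \<Longrightarrow> dfp (P c)"
  shows "dfp (\<lambda>w v. \<exists>c\<in>S. P c w v)"
  using assms
proof (induction S rule: finite_induct)
  case empty
  show ?case by (simp add: dfp_const)
next
  case (insert c S)
  thus ?case using dfp_disj[of "P c" "\<lambda>w v. \<exists>c\<in>S. P c w v"] by simp
qed

text \<open>The quotient counts the positive multiples of \<open>b\<close> up to \<open>a\<close>;
  the condition \<open>0 < b\<close> gives the value \<open>0\<close> for division by
  \<open>0\<close>.\<close>

lemma div_eq_sum: "(a::nat) div b = (\<Sum>i<a. of_bool (0 < b \<and> Suc i * b \<le> a))"
proof (cases "b = 0")
  case False
  hence "{i. i < a \<and> Suc i * b \<le> a} = {..<a div b}"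
  proof (intro set_eqI)
    fix i
    have "i < a div b \<longleftrightarrow> Suc i * b \<le> a"
      using False by (simp add: Suc_le_eq[symmetric] less_eq_div_iff_mult_less_eq)
    moreover have "i < a" if "i < a div b" using that div_le_dividend less_le_trans by blast
    ultimately show "i \<in> {i. i < a \<and> Suc i * b \<le> a} \<longleftrightarrow> i \<in> {..<a div b}" by auto
  qed
  moreover have "(\<Sum>i<a. of_bool (0 < b \<and> Suc i * b \<le> a)) = card {i. i < a \<and> Suc i * b \<le> a}"
    using False by (simp add: sum.If_cases of_bool_def Int_def lessThan_def)
  ultimately show ?thesis by simp
qed simp

lemma dfn_div:
  assumes "dfn F" "dfn G"
  shows "dfn (\<lambda>w v. F w v div G w v)"
  unfolding div_eq_sum
  by (intro dfn_sum dfn_of_bool dfp_conj dfp_less dfp_le dfn_mult dfn_Suc dfn_const dfn_var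
      assms assms[THEN dfn_rename])

lemma dfn_mod:
  assumes "dfn F" "dfn G"
  shows "dfn (\<lambda>w v. F w v mod G w v)"
  using dfn_minus[OF assms(1) dfn_mult[OF dfn_div[OF assms] assms(2)]]
  by (simp add: minus_div_mult_eq_mod)

lemma dfp_dvd: "dfn F \<Longrightarrow> dfn G \<Longrightarrow> dfp (\<lambda>w v. F w v dvd G w v)"
  unfolding dvd_eq_mod_eq_0 by (intro dfp_eq dfn_mod dfn_const)

lemma dfn_power: "dfn F \<Longrightarrow> dfn (\<lambda>w v. F w v ^ n)"
  by (induction n) (auto intro: dfn_const dfn_mult)

lemma dfn_poly: "dfn F \<Longrightarrow> dfn (\<lambda>w v. poly p (F w v))"
  by (induction p) (auto intro: dfn_const dfn_mult dfn_plus)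

section \<open>Powers of two and binary digits\<close>

definition pow2 :: "nat \<Rightarrow> bool" where
  "pow2 p \<longleftrightarrow> (\<exists>i. p = 2 ^ i)"

lemma pow2_iff: "pow2 p \<longleftrightarrow> 0 < p \<and> (\<forall>d<Suc p. d dvd p \<longrightarrow> d = 1 \<or> even d)"
proof
  assume "pow2 p"
  then obtain i where i: "p = 2 ^ i" by (auto simp: pow2_def)
  have "d = 1 \<or> even d" if "d dvd 2 ^ i" for d :: nat
  proof -
    have "is_unit d" if "odd d"
      using that \<open>d dvd 2 ^ i\<close> coprime_absorb_left[of d "2 ^ i"] by simp
    thus ?thesis by auto
  qed
  thus "0 < p \<and> (\<forall>d<Suc p. d dvd p \<longrightarrow> d = 1 \<or> even d)" by (auto simp: i)
next
  show "0 < p \<and> (\<forall>d<Suc p. d dvd p \<longrightarrow> d = 1 \<or> even d) \<Longrightarrow> pow2 p"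
  proof (induction p rule: less_induct)
    case (less p)
    show ?case
    proof (cases "p = 1")
      case True
      thus ?thesis by (auto simp: pow2_def intro!: exI[of _ 0])
    next
      case False
      hence "even p" using less.prems by auto
      then obtain q where q: "p = 2 * q" by blast
      have "d = 1 \<or> even d" if "d < Suc q" "d dvd q" for d
        using that q less.prems by (auto simp: less_Suc_eq_le dvd_imp_le)
      hence "pow2 q" using less.IH[of q] less.prems q by auto
      then obtain i where "q = 2 ^ i" by (auto simp: pow2_def)
      thus ?thesis using q by (auto simp: pow2_def intro!: exI[of _ "Suc i"])
    qed
  qed
qed

lemma dfp_pow2:
  assumes "dfn F"
  shows "dfp (\<lambda>w v. pow2 (F w v))"
  unfolding pow2_iff
  by (intro dfp_conj dfp_less dfn_const dfp_all dfn_Suc dfp_imp dfp_dvd dfp_disj dfp_eq dfn_var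
      assms assms[THEN dfn_rename])

lemmas df_intros = dfn_const dfn_var dfn_length dfn_plus dfn_minus dfn_Suc dfn_sum dfn_mult
  dfn_of_bool dfp_const dfp_is dfp_less dfp_not dfp_conj dfp_disj dfp_imp dfp_iff dfp_le dfp_eq
  dfp_ex dfp_all dfn_div dfn_mod dfp_dvd dfn_power dfn_poly dfp_pow2

lemma pow2_between:
  assumes "pow2 q" "2 ^ i < q"
  shows "2 ^ Suc i \<le> q"
proof -
  obtain j where "q = 2 ^ j" using assms by (auto simp: pow2_def)
  hence "i < j" using assms(2) by simp
  thus ?thesis unfolding \<open>q = 2 ^ j\<close> by (intro power_increasing) auto
qed

lemma concat_no_pow2:
  "\<forall>q\<in>set xs. \<not> pow2 q \<Longrightarrow> concat (map (\<lambda>p. if pow2 p then g p else []) xs) = []"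
  by (induction xs) auto

text \<open>Digit \<open>i\<close> is addressed by the number \<open>2 ^ i\<close> instead of
  \<open>i\<close>: scanning all \<open>p\<close> and keeping the powers of \<open>2\<close> meets
  the digits in order.\<close>

lemma concat_pow2: "concat (map (\<lambda>p. if pow2 p then [g p] else []) [0..<2 ^ L]) = map (\<lambda>i. g (2 ^ i)) [0..<L]"
proof (induction L)
  case 0
  have "\<not> pow2 0" by (simp add: pow2_def)
  thus ?case by simp
next
  case (Suc L)
  have "[0..<2 ^ Suc L] = [0..<2 ^ L] @ [2 ^ L] @ [Suc (2 ^ L)..<2 ^ Suc L]"
    using upt_add_eq_append[of 0 "2 ^ L" "2 ^ L"] upt_conv_Cons[of "2 ^ L" "2 ^ Suc L"]
    by (simp add: mult_2)
  moreover have "\<forall>q\<in>set [Suc (2 ^ L)..<2 ^ Suc L]. \<not> pow2 q"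
    using pow2_between[of _ L] by fastforce
  moreover have "pow2 (2 ^ L)" by (auto simp: pow2_def)
  ultimately show ?case using Suc by (simp add: concat_no_pow2)
qed

lemma binary_conv: "binary m = map (\<lambda>i. odd (m div 2 ^ i)) [0..<length (binary m)]
   \<and> m < 2 ^ length (binary m) \<and> (m > 0 \<longrightarrow> 2 ^ (length (binary m) - 1) \<le> m)"
proof (induction m rule: less_induct)
  case (less m)
  show ?case
  proof (cases "m = 0")
    case True
    thus ?thesis by (simp add: binary.simps[of 0])
  next
    case False
    let ?b = "binary (m div 2)"
    have b: "binary m = odd m # ?b" using False by (simp add: binary.simps[of m])
    have IH: "?b = map (\<lambda>i. odd (m div 2 div 2 ^ i)) [0..<length ?b]" "m div 2 < 2 ^ length ?b"
      "m div 2 > 0 \<Longrightarrow> 2 ^ (length ?b - 1) \<le> m div 2"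
      using less[of "m div 2"] False by auto
    have "map (\<lambda>i. odd (m div 2 ^ i)) [0..<length (binary m)] =
      odd m # map (\<lambda>i. odd (m div 2 ^ Suc i)) [0..<length ?b]"
      unfolding b by (simp add: upt_conv_Cons map_Suc_upt[symmetric] comp_def del: upt_Suc)
    also have "\<dots> = binary m" unfolding b using IH(1) by (simp add: div_mult2_eq)
    finally have 1: "binary m = map (\<lambda>i. odd (m div 2 ^ i)) [0..<length (binary m)]" by simp
    have 2: "m < 2 ^ length (binary m)" using IH(2) unfolding b by simp
    have 3: "2 ^ (length (binary m) - 1) \<le> m"
    proof (cases "m div 2 > 0")
      case True
      hence "?b \<noteq> []" by (simp add: binary.simps[of "m div 2"])
      then obtain l where l: "length ?b = Suc l" by (cases ?b) auto
      show ?thesis using IH(3)[OF True] unfolding b by (simp add: l)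
    next
      case f: False
      thus ?thesis using False unfolding b by (simp add: binary.simps[of 0])
    qed
    from 1 2 3 show ?thesis by blast
  qed
qed

lemma nth_binary:
  assumes "i < length (binary m)"
  shows "binary m ! i \<longleftrightarrow> odd (m div 2 ^ i)"
proof -
  from arg_cong[OF conjunct1[OF binary_conv[of m]], of "\<lambda>l. l ! i"]
  have E: "binary m ! i = map (\<lambda>i. odd (m div 2 ^ i)) [0..<length (binary m)] ! i" .
  show ?thesis using assms by (subst E) simp
qed

text \<open>Scanning up to \<open>m\<close> is exact: if \<open>m\<close> is positive and has
  \<open>L\<close> digits, then \<open>2 ^ (L - 1) \<le> m < 2 ^ L\<close>.\<close>

lemma binary_eq_concat: "concat (map (\<lambda>p. if pow2 p then [g p] else []) [0..<Suc m]) =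
    map (\<lambda>i. g (2 ^ i)) [0..<length (binary m)]"
proof -
  let ?L = "length (binary m)"
  have le: "Suc m \<le> 2 ^ ?L" using binary_conv[of m] by auto
  hence "[0..<2 ^ ?L] = [0..<Suc m] @ [Suc m..<2 ^ ?L]"
    using upt_add_eq_append[of 0 "Suc m" "2 ^ ?L - Suc m"] by simp
  moreover have "\<forall>q\<in>set [Suc m..<2 ^ ?L]. \<not> pow2 q"
  proof (cases "m = 0")
    case True
    thus ?thesis by (simp add: binary.simps[of 0])
  next
    case False
    hence "?L \<noteq> 0" by (simp add: binary.simps[of m])
    thus ?thesis using pow2_between[of _ "?L - 1"] binary_conv[of m] False by fastforce
  qed
  ultimately show ?thesis using concat_pow2[of g ?L] by (simp add: concat_no_pow2)
qed

lemma sum_pow2: "(\<Sum>q<n. of_bool (pow2 q)) = length (concat (map (\<lambda>p. if pow2 p then [p] else []) [0..<n]))"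
  by (induction n) auto

text \<open>Counting the powers of \<open>2\<close> below a power of \<open>2\<close> yields its
  logarithm, hence the position of a digit.\<close>

lemma sum_pow2_power: "(\<Sum>q<2 ^ i. of_bool (pow2 q)) = i"
  by (simp add: sum_pow2 concat_pow2)

lemma sum_pow2_length: "(\<Sum>q<Suc m. of_bool (pow2 q)) = length (binary m)"
  unfolding sum_pow2 by (simp add: binary_eq_concat del: upt_Suc)

text \<open>The right-hand side uses only bounded quantifiers, counting and division, so the binary
  encoding of \<open>m\<close> becomes definable.\<close>

lemma eq_binary_iff:
  "ds = binary m \<longleftrightarrow> length ds = (\<Sum>q<Suc m. of_bool (pow2 q)) \<and>
     (\<forall>p<Suc m. pow2 p \<longrightarrow> (ds ! (\<Sum>q<p. of_bool (pow2 q)) \<longleftrightarrow> odd (m div p)))" (is "_ \<longleftrightarrow> ?R")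
proof
  assume ds: "ds = binary m"
  have "ds ! i \<longleftrightarrow> odd (m div 2 ^ i)" if "2 ^ i < Suc m" for i
  proof -
    have "2 ^ i < (2::nat) ^ length (binary m)" using that binary_conv[of m] by linarith
    hence "i < length (binary m)" by simp
    thus ?thesis using nth_binary ds by simp
  qed
  hence "ds ! (\<Sum>q<p. of_bool (pow2 q)) \<longleftrightarrow> odd (m div p)" if p: "p < Suc m" "pow2 p" for p
  proof -
    obtain i where i: "p = 2 ^ i" using p(2) by (auto simp: pow2_def)
    show ?thesis using p(1) \<open>\<And>i. 2 ^ i < Suc m \<Longrightarrow> ds ! i \<longleftrightarrow> odd (m div 2 ^ i)\<close>
      unfolding i sum_pow2_power by blast
  qed
  moreover have "length ds = (\<Sum>q<Suc m. of_bool (pow2 q))" unfolding ds sum_pow2_length ..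
  ultimately show ?R by blast
next
  assume R: ?R
  show "ds = binary m"
  proof (rule nth_equalityI)
    show len: "length ds = length (binary m)" using R by (simp only: sum_pow2_length)
    fix i assume i: "i < length ds"
    hence "m > 0" using len by (cases "m = 0") (auto simp: binary.simps[of 0])
    hence "2 ^ (length (binary m) - 1) \<le> m" using binary_conv[of m] by blast
    moreover have "(2::nat) ^ i \<le> 2 ^ (length (binary m) - 1)" using i len by (intro power_increasing) auto
    ultimately have "2 ^ i < Suc m" by linarith
    moreover have "pow2 (2 ^ i)" by (auto simp: pow2_def)
    ultimately have "ds ! (\<Sum>q<2 ^ i. of_bool (pow2 q)) \<longleftrightarrow> odd (m div 2 ^ i)" using R by blast
    hence "ds ! i \<longleftrightarrow> odd (m div 2 ^ i)" by (simp only: sum_pow2_power)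
    thus "ds ! i = binary m ! i" using nth_binary i len by simp
  qed
qed

lemma binary_surj: "ds = [] \<or> last ds \<Longrightarrow> \<exists>m. ds = binary m"
proof (induction ds)
  case Nil
  show ?case by (rule exI[of _ 0]) (simp add: binary.simps[of 0])
next
  case (Cons d ds)
  show ?case
  proof (cases "ds = []")
    case True
    thus ?thesis using Cons.prems by (intro exI[of _ 1]) (simp add: binary.simps[of "Suc 0"] binary.simps[of 0])
  next
    case False
    then obtain m where m: "ds = binary m" using Cons by auto
    hence "m > 0" using False by (cases "m = 0") (auto simp: binary.simps[of 0])
    thus ?thesis using m
      by (cases d) (intro exI[of _ "Suc (2 * m)"], simp add: binary.simps[of "Suc (2 * m)"],
          intro exI[of _ "2 * m"], simp add: binary.simps[of "2 * m"])
  qed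
qed

lemma binary_canonical: "binary m = [] \<or> last (binary m)"
proof (induction m rule: less_induct)
  case (less m)
  show ?case
  proof (cases "m = 0")
    case False
    hence "binary m = odd m # binary (m div 2)" by (simp add: binary.simps[of m])
    moreover have "odd m" if "binary (m div 2) = []"
      using that False by (cases "m div 2 = 0") (auto simp: binary.simps[of "m div 2"])
    ultimately show ?thesis using less[of "m div 2"] False by auto
  qed (simp add: binary.simps[of 0])
qed

section \<open>Definable output words\<close>

definition dfo :: "(nat list \<Rightarrow> (nat \<Rightarrow> nat) \<Rightarrow> nat list) \<Rightarrow> bool" where
  "dfo G \<longleftrightarrow> (\<exists>p. prog_symbols p \<subseteq> {..<4} \<and> (\<forall>w v. prog_out p w v = G w v))"

lemma dfoI: "prog_symbols p \<subseteq> {..<4} \<Longrightarrow> (\<And>w v. prog_out p w v = G w v) \<Longrightarrow> dfo G"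
  unfolding dfo_def by blast

lemma dfo_append: "dfo G \<Longrightarrow> dfo H \<Longrightarrow> dfo (\<lambda>w v. G w v @ H w v)"
  unfolding dfo_def by (metis Un_least prog_symbols.simps(2) prog_out.simps(2))

lemma dfo_concat:
  assumes "dfn N" "dfo (\<lambda>w v. G w (\<lambda>n. v (Suc n)) (v 0))"
  shows "dfo (\<lambda>w v. concat (map (G w v) [0..<N w v]))"
proof -
  obtain e p where "\<forall>w v. eval e w v = N w v" "prog_symbols p \<subseteq> {..<4}"
    "\<forall>w v. prog_out p w v = G w (\<lambda>n. v (Suc n)) (v 0)"
    using assms unfolding dfn_def dfo_def by blast
  thus ?thesis by (intro dfoI[of "For e p"]) auto
qed

lemma dfo_Nil: "dfo (\<lambda>w v. [])"
  by (rule dfoI[of "For (Const 0) (Out 0)"]) auto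

lemma dfo_single: "s < 4 \<Longrightarrow> dfo (\<lambda>w v. [s])"
  by (rule dfoI[of "Out s"]) auto

lemma prog_out_rename: "\<exists>p'. prog_symbols p' = prog_symbols p \<and> (\<forall>w v. prog_out p' w v = prog_out p w (\<lambda>n. v (g n)))"
proof (induction p arbitrary: g)
  case (Out a)
  show ?case by (rule exI[of _ "Out a"]) simp
next
  case (Then p q)
  obtain p' q' where "prog_symbols p' = prog_symbols p \<and> (\<forall>w v. prog_out p' w v = prog_out p w (\<lambda>n. v (g n)))"
    "prog_symbols q' = prog_symbols q \<and> (\<forall>w v. prog_out q' w v = prog_out q w (\<lambda>n. v (g n)))"
    using Then by metis
  thus ?case by (intro exI[of _ "Then p' q'"]) simp
next
  case (For a b)
  obtain a' where a': "\<forall>w v. eval a' w v = eval a w (\<lambda>n. v (g n))" using eval_rename by metis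
  obtain b' where b': "prog_symbols b' = prog_symbols b"
    "\<forall>w v. prog_out b' w v = prog_out b w (\<lambda>n. v (case_nat 0 (\<lambda>m. Suc (g m)) n))"
    using For by metis
  have "(\<lambda>n. case_nat i v (case_nat 0 (\<lambda>m. Suc (g m)) n)) = case_nat i (\<lambda>n. v (g n))" for i and v :: "nat \<Rightarrow> nat"
    by (auto simp: fun_eq_iff split: nat.splits)
  thus ?case using a' b' by (intro exI[of _ "For a' b'"]) simp
qed

lemma dfo_rename: "dfo G \<Longrightarrow> dfo (\<lambda>w v. G w (\<lambda>n. v (g n)))"
  unfolding dfo_def using prog_out_rename by metis

lemma dfo_if:
  assumes "dfp P" "dfo G" "dfo H"
  shows "dfo (\<lambda>w v. if P w v then G w v else H w v)"
proof -
  have "dfo (\<lambda>w v. concat (map (\<lambda>_. G w v) [0..<of_bool (P w v)]) @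
    concat (map (\<lambda>_. H w v) [0..<of_bool (\<not> P w v)]))"
    by (intro dfo_append dfo_concat dfn_of_bool dfp_not assms(1)
        assms(2,3)[THEN dfo_rename])
  moreover have "concat (map (\<lambda>_. G w v) [0..<of_bool (P w v)]) @
    concat (map (\<lambda>_. H w v) [0..<of_bool (\<not> P w v)]) = (if P w v then G w v else H w v)" for w v
    by auto
  ultimately show ?thesis by simp
qed

lemma polytime_computable_dfo:
  assumes "dfo G" "\<And>x. G (word x) (\<lambda>_. 0) = word (f x)"
  shows "polytime_computable f"
  using assms compute_prog unfolding dfo_def by metis

section \<open>Membership in NP\<close>

definition force_stable :: "'a set set \<Rightarrow> 'a set \<Rightarrow> bool" where
  "force_stable E S \<longleftrightarrow> (\<forall>u\<in>S. \<forall>v. neighbors E u - S \<noteq> {v})"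

lemma stable_iff: "force_stable E S \<longleftrightarrow> (\<nexists>S'. force_step E S S')"
  unfolding force_stable_def by (auto simp: force_step.simps)

lemma stableD:
  assumes "force_stable E S" "u \<in> S" "{u, v} \<in> E" "\<And>w. {u, w} \<in> E \<Longrightarrow> w \<noteq> v \<Longrightarrow> w \<in> S"
  shows "v \<in> S"
proof (rule ccontr)
  assume "v \<notin> S"
  hence "neighbors E u - S = {v}" using assms(3,4) by (auto simp: neighbors_def)
  thus False using assms(1,2) by (auto simp: force_stable_def)
qed

lemma forcing_closure_props:
  assumes G: "simple_graph V E" and T: "T \<subseteq> V"
  shows "T \<subseteq> forcing_closure E T" "forcing_closure E T \<subseteq> V" "force_stable E (forcing_closure E T)"
    "\<And>S. T \<subseteq> S \<Longrightarrow> force_stable E S \<Longrightarrow> forcing_closure E T \<subseteq> S"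
proof -
  let ?C = "forcing_closure E T"
  have C: "(force_step E)\<^sup>*\<^sup>* T ?C" "\<nexists>C'. force_step E ?C C'"
    using theI'[OF forcing_closure_ex1[OF G T]] unfolding forcing_closure_def by auto
  show "T \<subseteq> ?C" using C(1) by induction (auto dest: force_step_psubset)
  show "?C \<subseteq> V" using C(1) by induction (use T force_step_subset[OF G] in auto)
  show "force_stable E ?C" using C(2) by (simp add: stable_iff)
  show "?C \<subseteq> S" if "T \<subseteq> S" "force_stable E S" for S
    using force_steps_subset_stable[OF C(1) that(1)] that(2) by (simp add: stable_iff)
qed

text \<open>The closure is the least stable superset of the endpoints. This form avoids the
  iteration: soundness of the reduction exhibits a stable set, completeness follows the rule inside
  an arbitrary one.\<close>

lemma edge_forcing_set_iff:
  assumes G: "simple_graph V E"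
  shows "edge_forcing_set V E K \<longleftrightarrow>
    matching E K \<and> (\<forall>S. \<Union>K \<subseteq> S \<longrightarrow> S \<subseteq> V \<longrightarrow> force_stable E S \<longrightarrow> S = V)"
proof (cases "matching E K")
  case True
  hence K: "\<Union>K \<subseteq> V" using G by (auto simp: matching_def simple_graph_def)
  note C = forcing_closure_props[OF G K]
  show ?thesis using True C unfolding edge_forcing_set_def by (metis subset_antisym)
qed (simp add: edge_forcing_set_def)

text \<open>\<open>M\<close> is the adjacency matrix, \<open>K\<close> the matching as a symmetric
  relation, \<open>St t\<close> a set coloured at stage \<open>t\<close>. Stages have to be
  justified but not maximal, so the conditions bound them from above, except that the last stage is
  everything.\<close>

definition cert :: "nat \<Rightarrow> (nat \<Rightarrow> nat \<Rightarrow> bool) \<Rightarrow> (nat \<Rightarrow> nat \<Rightarrow> bool) \<Rightarrow> (nat \<Rightarrow> nat \<Rightarrow> bool) \<Rightarrow> bool" where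
  "cert n M K St \<longleftrightarrow>
     (\<forall>i<n. \<forall>j<n. K i j \<longrightarrow> M i j \<and> K j i) \<and>
     (\<forall>i<n. \<forall>j<n. \<forall>j'<n. K i j \<and> K i j' \<longrightarrow> j = j') \<and>
     (\<forall>v<n. St 0 v \<longrightarrow> (\<exists>u<n. K v u)) \<and>
     (\<forall>t<n. \<forall>v<n. St (Suc t) v \<longrightarrow>
        St t v \<or> (\<exists>u<n. St t u \<and> M u v \<and> (\<forall>w<n. M u w \<and> w \<noteq> v \<longrightarrow> St t w))) \<and>
     (\<forall>v<n. St n v)"

lemma cert_cong:
  assumes "\<And>i j. i < n \<Longrightarrow> j < n \<Longrightarrow> M i j = M' i j" "\<And>i j. i < n \<Longrightarrow> j < n \<Longrightarrow> K i j = K' i j"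
    "\<And>t v. t \<le> n \<Longrightarrow> v < n \<Longrightarrow> St t v = St' t v"
  shows "cert n M K St = cert n M' K' St'"
  unfolding cert_def using assms by (simp cong: conj_cong imp_cong)

definition edge_count :: "nat \<Rightarrow> (nat \<Rightarrow> nat \<Rightarrow> bool) \<Rightarrow> nat" where
  "edge_count n K = (\<Sum>i<n. \<Sum>j<i. of_bool (K i j))"

lemma card_edges:
  assumes "\<And>e. e \<in> K \<Longrightarrow> e \<subseteq> {..<n} \<and> card e = 2"
  shows "card K = edge_count n (\<lambda>i j. {i, j} \<in> K)"
proof -
  let ?S = "SIGMA i:{..<n}. {j. j < i \<and> {i, j} \<in> K}"
  have "bij_betw (\<lambda>(i, j). {i, j}) ?S K"
  proof (rule bij_betwI')
    fix x y assume "x \<in> ?S" "y \<in> ?S"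
    thus "((\<lambda>(i, j). {i, j}) x = (\<lambda>(i, j). {i, j}) y) = (x = y)"
      by (auto simp: doubleton_eq_iff)
  next
    fix x assume "x \<in> ?S"
    thus "(\<lambda>(i, j). {i, j}) x \<in> K" by auto
  next
    fix e assume e: "e \<in> K"
    then obtain a b where ab: "e = {a, b}" "a \<noteq> b" using assms[OF e] by (auto simp: card_2_iff)
    hence "e = {max a b, min a b}" "min a b < max a b" "max a b < n"
      using assms[OF e] by (auto simp: max_def min_def)
    thus "\<exists>x\<in>?S. e = (\<lambda>(i, j). {i, j}) x" using e by (intro bexI[of _ "(max a b, min a b)"]) auto
  qed
  hence "card K = card ?S" by (simp add: bij_betw_same_card)
  also have "\<dots> = (\<Sum>i<n. card {j. j < i \<and> {i, j} \<in> K})" by simp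
  also have "\<dots> = edge_count n (\<lambda>i j. {i, j} \<in> K)"
    unfolding edge_count_def by (simp add: of_bool_def sum.If_cases Int_def lessThan_def)
  finally show ?thesis .
qed

text \<open>By induction on \<open>t\<close>, every stage is contained in each stable set that
  contains the matched vertices; the last stage is the whole vertex set.\<close>

lemma cert_sound:
  assumes G: "simple_graph {..<n} E" and M: "\<And>i j. i < n \<Longrightarrow> j < n \<Longrightarrow> M i j \<longleftrightarrow> {i, j} \<in> E"
    and c: "cert n M K St"
  shows "\<exists>L. edge_forcing_set {..<n} E L \<and> card L = edge_count n K"
proof -
  note c' = c[unfolded cert_def]
  have K1: "M i j" "K j i" if "i < n" "j < n" "K i j" for i j
    using conjunct1[OF c'] that by blast+
  have K2: "j = j'" if "i < n" "j < n" "j' < n" "K i j" "K i j'" for i j j'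
    using conjunct1[OF conjunct2[OF c']] that by blast
  have K3: "\<exists>u<n. K v u" if "v < n" "St 0 v" for v
    using conjunct1[OF conjunct2[OF conjunct2[OF c']]] that by blast
  have K4: "\<exists>u<n. St t u \<and> M u v \<and> (\<forall>w<n. M u w \<and> w \<noteq> v \<longrightarrow> St t w)"
    if "t < n" "v < n" "St (Suc t) v" "\<not> St t v" for t v
    using conjunct1[OF conjunct2[OF conjunct2[OF conjunct2[OF c']]]] that by blast
  have K5: "St n v" if "v < n" for v
    using conjunct2[OF conjunct2[OF conjunct2[OF conjunct2[OF c']]]] that by blast
  let ?L = "{{i, j} | i j. i < n \<and> j < n \<and> K i j}"
  have sub: "?L \<subseteq> E" using K1 M by blast
  have mem: "{i, j} \<in> ?L \<longleftrightarrow> K i j" if "i < n" "j < n" for i j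
    using that K1 by (auto simp: doubleton_eq_iff)
  have "pairwise disjnt ?L"
  proof (rule pairwiseI, rule ccontr)
    fix e f assume ef: "e \<in> ?L" "f \<in> ?L" "e \<noteq> f" "\<not> disjnt e f"
    then obtain a where a: "a \<in> e" "a \<in> f" by (auto simp: disjnt_def)
    \<comment> \<open>By symmetry any endpoint of an edge may be put first, so that uniqueness of
      partners applies.\<close>
    have ob: "\<exists>b<n. g = {a, b} \<and> K a b \<and> a < n" if "g \<in> ?L" "a \<in> g" for g
    proof -
      obtain i j where "g = {i, j}" "i < n" "j < n" "K i j" using \<open>g \<in> ?L\<close> by blast
      thus ?thesis using \<open>a \<in> g\<close> K1(2)[of i j] by (auto simp: insert_commute)
    qed
    obtain b where b: "e = {a, b}" "K a b" "a < n" "b < n" using ob[OF ef(1) a(1)] by blast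
    obtain b' where b': "f = {a, b'}" "K a b'" "b' < n" using ob[OF ef(2) a(2)] by blast
    have "b = b'" using K2 b b' by blast
    thus False using ef(3) b b' by simp
  qed
  hence m: "matching E ?L" using sub by (simp add: matching_def)
  have "S = {..<n}" if S: "\<Union>?L \<subseteq> S" "S \<subseteq> {..<n}" "force_stable E S" for S
  proof -
    have "v \<in> S" if "v < n" "t \<le> n" "St t v" for t v
      using that
    proof (induction t arbitrary: v)
      case 0
      then obtain u where "u < n" "K v u" using K3 by blast
      thus ?case using S(1) 0 by blast
    next
      case (Suc t)
      show ?case
      proof (cases "St t v")
        case True
        thus ?thesis using Suc by simp
      next
        case False
        then obtain u where u: "u < n" "St t u" "M u v" "\<forall>w<n. M u w \<and> w \<noteq> v \<longrightarrow> St t w"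
          using Suc.prems K4[of t v] by auto
        show ?thesis
        proof (rule stableD[OF S(3), of u])
          show "u \<in> S" using Suc u by simp
          show "{u, v} \<in> E" using M u Suc.prems by simp
          fix w assume w: "{u, w} \<in> E" "w \<noteq> v"
          hence "w < n" using G unfolding simple_graph_def by blast
          thus "w \<in> S" using u M w Suc by simp
        qed
      qed
    qed
    thus ?thesis using K5 S(2) by blast
  qed
  hence ef: "edge_forcing_set {..<n} E ?L" using m by (simp add: edge_forcing_set_iff[OF G])
  have "card ?L = edge_count n (\<lambda>i j. {i, j} \<in> ?L)"
    by (rule card_edges) (use sub G in \<open>auto simp: simple_graph_def\<close>)
  also have "\<dots> = edge_count n K"
    unfolding edge_count_def
  proof (intro sum.cong refl)
    fix i j assume "i \<in> {..<n}" "j \<in> {..<i}"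
    thus "(of_bool ({i, j} \<in> ?L) :: nat) = of_bool (K i j)" using mem[of i j] by simp
  qed
  finally show ?thesis using ef by blast
qed

text \<open>All forces possible at a stage are applied simultaneously, which makes the stages a
  function of \<open>t\<close>.\<close>

fun stage :: "nat set set \<Rightarrow> nat set \<Rightarrow> nat \<Rightarrow> nat set" where
  "stage E T 0 = T"
| "stage E T (Suc t) = stage E T t \<union> {v. \<exists>u\<in>stage E T t. {u, v} \<in> E \<and> neighbors E u - stage E T t \<subseteq> {v}}"

lemma cert_complete:
  assumes G: "simple_graph {..<n} E" and L: "edge_forcing_set {..<n} E L"
  shows "cert n (\<lambda>i j. {i, j} \<in> E) (\<lambda>i j. {i, j} \<in> L) (\<lambda>t v. v \<in> stage E (\<Union>L) t)"
    and "card L = edge_count n (\<lambda>i j. {i, j} \<in> L)"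
proof -
  have m: "L \<subseteq> E" "pairwise disjnt L" using L by (auto simp: edge_forcing_set_def matching_def)
  have V: "e \<subseteq> {..<n}" "card e = 2" if "e \<in> E" for e using that G by (auto simp: simple_graph_def)
  show "card L = edge_count n (\<lambda>i j. {i, j} \<in> L)" using m V by (intro card_edges) blast
  let ?s = "stage E (\<Union>L)"
  have sub: "?s t \<subseteq> {..<n}" for t
  proof (induction t)
    case 0
    show ?case using m(1) V(1) by auto
  next
    case (Suc t)
    have "v < n" if "{u, v} \<in> E" for u v using V(1)[OF that] by simp
    thus ?case using Suc by auto
  qed
  have T: "\<Union>L \<subseteq> ?s t" for t by (induction t) auto
  \<comment> \<open>A stage that is not yet stable gains a vertex, so stage \<open>n\<close> is
    stable or has at least \<open>n\<close> elements.\<close>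
  have grow: "t \<le> card (?s t) \<or> force_stable E (?s t)" for t
  proof (induction t)
    case (Suc t)
    show ?case
    proof (cases "force_stable E (?s t)")
      case True
      have "?s (Suc t) = ?s t"
        using True by (auto intro: stableD simp: neighbors_def)
      thus ?thesis using True by simp
    next
      case False
      then obtain u v where "u \<in> ?s t" "neighbors E u - ?s t = {v}" by (auto simp: force_stable_def)
      hence "v \<in> ?s (Suc t)" "v \<notin> ?s t" by (auto simp: neighbors_def)
      hence "?s t \<subset> ?s (Suc t)" by auto
      hence "card (?s t) < card (?s (Suc t))" using sub finite_subset by (blast intro: psubset_card_mono)
      thus ?thesis using Suc False by simp
    qed
  qed simp
  have full: "?s n = {..<n}"
    using grow[of n]
  proof
    assume "n \<le> card (?s n)"
    thus ?thesis using sub[of n] by (intro card_subset_eq) (auto dest: card_mono[rotated])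
  next
    assume "force_stable E (?s n)"
    moreover have "\<Union>L \<subseteq> ?s n \<longrightarrow> ?s n \<subseteq> {..<n} \<longrightarrow> force_stable E (?s n) \<longrightarrow> ?s n = {..<n}"
      using conjunct2[OF iffD1[OF edge_forcing_set_iff[OF G] L]] by (rule spec)
    ultimately show ?thesis using T[of n] sub[of n] by simp
  qed
  have uniq: "j = j'" if "{i, j} \<in> L" "{i, j'} \<in> L" for i j j'
  proof -
    have "{i, j} = {i, j'}"
      using pairwiseD[OF m(2) that] by (auto simp: disjnt_def)
    thus ?thesis by (auto simp: doubleton_eq_iff)
  qed
  have init: "\<exists>u<n. {v, u} \<in> L" if v: "v \<in> \<Union>L" for v
  proof -
    obtain e where e: "e \<in> L" "v \<in> e" using v by blast
    hence "card e = 2" "e \<subseteq> {..<n}" using V m by auto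
    then obtain u where "e = {v, u}" using e by (auto simp: card_2_iff)
    thus ?thesis using e \<open>e \<subseteq> {..<n}\<close> by auto
  qed
  have forced: "\<exists>u<n. u \<in> ?s t \<and> {u, v} \<in> E \<and> (\<forall>w<n. {u, w} \<in> E \<and> w \<noteq> v \<longrightarrow> w \<in> ?s t)"
    if "v \<in> ?s (Suc t)" "v \<notin> ?s t" for t v
    using that sub[of t] by (auto simp: neighbors_def)
  show "cert n (\<lambda>i j. {i, j} \<in> E) (\<lambda>i j. {i, j} \<in> L) (\<lambda>t v. v \<in> ?s t)"
    unfolding cert_def
  proof (intro conjI allI impI)
    show "{j, i} \<in> L" if "{i, j} \<in> L" for i j using that by (simp add: insert_commute)
    show "{i, j} \<in> E" if "{i, j} \<in> L" for i j using that m(1) by blast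
    show "\<exists>u<n. {v, u} \<in> L" if "v \<in> ?s 0" for v using that init by simp
    show "v \<in> ?s n" if "v < n" for v using that full by simp
    show "j = j'" if "{i, j} \<in> L \<and> {i, j'} \<in> L" for i j j' using that uniq by blast
    show "v \<in> ?s t \<or> (\<exists>u<n. u \<in> ?s t \<and> {u, v} \<in> E \<and> (\<forall>w<n. {u, w} \<in> E \<and> w \<noteq> v \<longrightarrow> w \<in> ?s t))"
      if "v \<in> ?s (Suc t)" for t v
      using that forced by blast
  qed
qed

section \<open>Reading an encoded instance\<close>

lemma concat_matrix:
  "concat (map (\<lambda>i. map (\<lambda>j. g i j) [0..<n]) [0..<m]) = map (\<lambda>r. g (r div n) (r mod n)) [0..<m * n]"
proof (induction m)
  case (Suc m)
  have "[0..<Suc m * n] = [0..<m * n] @ map (\<lambda>j. m * n + j) [0..<n]"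
    using upt_add_eq_append[of 0 "m * n" n] by (simp add: map_add_upt add.commute)
  moreover have "map (\<lambda>r. g (r div n) (r mod n)) (map (\<lambda>j. m * n + j) [0..<n]) = map (\<lambda>j. g m j) [0..<n]"
    by (intro nth_equalityI) auto
  ultimately show ?case using Suc by simp
qed simp

lemma encode_instance_eq: "encode_instance n E k = replicate n True @ [False] @
    map (\<lambda>r. {r div n, r mod n} \<in> E) [0..<n * n] @ (k < 0) # binary (nat \<bar>k\<bar>)"
  by (simp add: encode_instance_def encode_graph_def encode_int_def concat_matrix)

text \<open>Validity of an encoding, bit by bit: \<open>n\<close> ones and a zero, a symmetric
  matrix with zero diagonal from position \<open>n + 1\<close>, the sign, and digits that end with a
  one unless there are none. A negative bound admits no solution, so its sign bit is rejected
  here.\<close>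

definition instance_bits :: "nat \<Rightarrow> nat \<Rightarrow> (nat \<Rightarrow> bool) \<Rightarrow> bool" where
  "instance_bits l n X \<longleftrightarrow>
     n + n * n + 2 \<le> l \<and> (\<forall>i<n. X i) \<and> \<not> X n \<and>
     (\<forall>i<n. \<forall>j<n. X (n + 1 + (i * n + j)) \<longleftrightarrow> X (n + 1 + (j * n + i))) \<and>
     (\<forall>i<n. \<not> X (n + 1 + (i * n + i))) \<and> \<not> X (n + 1 + n * n) \<and>
     (l = n + n * n + 2 \<or> X (l - 1))"

lemma pair_less: "l < k \<Longrightarrow> e < M \<Longrightarrow> l * M + e < k * (M::nat)"
proof -
  assume "l < k" "e < M"
  hence "l * M + e < Suc l * M" by simp
  also have "\<dots> \<le> k * M" using \<open>l < k\<close> by (intro mult_right_mono) auto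
  finally show ?thesis .
qed

lemma instance_bits_encode:
  fixes k :: int
  assumes G: "simple_graph {..<n} E" and k: "k \<ge> 0" and x: "x = encode_instance n E k"
  shows "instance_bits (length x) n ((!) x)"
    "\<And>i j. i < n \<Longrightarrow> j < n \<Longrightarrow> x ! (n + 1 + (i * n + j)) \<longleftrightarrow> {i, j} \<in> E"
    "drop (n + n * n + 2) x = binary (nat k)"
proof -
  have x': "x = (replicate n True @ [False] @ map (\<lambda>r. {r div n, r mod n} \<in> E) [0..<n * n] @ [False]) @ binary (nat k)"
    using k by (simp add: x encode_instance_eq)
  have len: "length x = n + n * n + 2 + length (binary (nat k))" by (simp add: x')
  show dr: "drop (n + n * n + 2) x = binary (nat k)" by (simp add: x')
  show adj: "x ! (n + 1 + (i * n + j)) \<longleftrightarrow> {i, j} \<in> E" if "i < n" "j < n" for i j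
    using that pair_less[OF that] by (simp add: x' nth_append)
  have irr: "{i, i} \<notin> E" for i using G unfolding simple_graph_def by fastforce
  have "x ! (length x - 1)" if "length x \<noteq> n + n * n + 2"
  proof -
    have "binary (nat k) \<noteq> []" using that len by auto
    moreover from this have "last x = last (binary (nat k))" by (simp add: x')
    ultimately show ?thesis using binary_canonical[of "nat k"] last_conv_nth[of x] by (auto simp: x')
  qed
  moreover have "\<forall>i<n. x ! i" "\<not> x ! n" "\<not> x ! (n + 1 + n * n)" by (auto simp: x' nth_append)
  ultimately show "instance_bits (length x) n ((!) x)"
    unfolding instance_bits_def using adj irr len by (auto simp: insert_commute)
qed

definition bit_graph :: "nat \<Rightarrow> (nat \<Rightarrow> bool) \<Rightarrow> nat set set" where
  "bit_graph n X = {{i, j} | i j. i < n \<and> j < n \<and> X (n + 1 + (i * n + j))}"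

lemma instance_bits_decode:
  assumes b: "instance_bits (length x) n ((!) x)"
  obtains m where "simple_graph {..<n} (bit_graph n ((!) x))" "x = encode_instance n (bit_graph n ((!) x)) (int m)"
    "drop (n + n * n + 2) x = binary m"
    "\<And>i j. i < n \<Longrightarrow> j < n \<Longrightarrow> x ! (n + 1 + (i * n + j)) \<longleftrightarrow> {i, j} \<in> bit_graph n ((!) x)"
proof -
  let ?E = "bit_graph n ((!) x)"
  have irr: "i \<noteq> j" if "i < n" "j < n" "x ! (n + 1 + (i * n + j))" for i j
    using b that unfolding instance_bits_def by blast
  have "card {i, j} = 2" if "i < n" "j < n" "x ! (n + 1 + (i * n + j))" for i j
    using irr[OF that] by simp
  hence G: "simple_graph {..<n} ?E"
    unfolding simple_graph_def bit_graph_def by auto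
  have adj: "x ! (n + 1 + (i * n + j)) \<longleftrightarrow> {i, j} \<in> ?E" if "i < n" "j < n" for i j
    using that b unfolding bit_graph_def instance_bits_def by (auto simp: doubleton_eq_iff)
  let ?ds = "drop (n + n * n + 2) x"
  have len: "n + n * n + 2 \<le> length x" using b by (simp add: instance_bits_def)
  have "?ds = [] \<or> last ?ds"
  proof (cases "length x = n + n * n + 2")
    case False
    hence "?ds \<noteq> []" "x ! (length x - 1)" "x \<noteq> []" using len b by (auto simp: instance_bits_def)
    moreover from this have "last ?ds = x ! (length x - 1)"
      using last_conv_nth[of x] last_drop[of "n + n * n + 2" x] by auto
    ultimately show ?thesis by blast
  qed simp
  then obtain m where m: "?ds = binary m" using binary_surj by blast
  have "x = encode_instance n ?E (int m)"
  proof (rule nth_equalityI)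
    have lm: "length (binary m) = length x - (n + n * n + 2)" unfolding m[symmetric] by simp
    show l: "length x = length (encode_instance n ?E (int m))"
      using len lm by (simp add: encode_instance_eq)
    fix i assume i: "i < length x"
    consider "i < n" | "i = n" | "n < i" "i < n + 1 + n * n" | "i = n + 1 + n * n" | "n + n * n + 2 \<le> i"
      by linarith
    thus "x ! i = encode_instance n ?E (int m) ! i"
    proof cases
      case 3
      then obtain r where r: "i = n + 1 + r" "r < n * n" by (metis Suc_eq_plus1 add_less_cancel_left less_iff_Suc_add add_Suc_right add_Suc)
      have n0: "n > 0" using r(2) by (cases n) auto
      have rd: "r div n < n" "r mod n < n" using r(2) n0 by (auto simp: less_mult_imp_div_less)
      have "x ! i \<longleftrightarrow> {r div n, r mod n} \<in> ?E" using adj[OF rd] r(1) by simp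
      thus ?thesis using r by (simp add: encode_instance_eq nth_append)
    next
      case 5
      then obtain r where r: "i = n + n * n + 2 + r" using le_Suc_ex by blast
      hence "x ! i = ?ds ! r" using i len by simp
      moreover have "encode_instance n ?E (int m) ! i = binary m ! r"
        by (simp add: encode_instance_eq nth_append r)
      ultimately show ?thesis using m by simp
    qed (use b in \<open>auto simp: encode_instance_eq nth_append instance_bits_def\<close>)
  qed
  thus thesis using that G adj m by blast
qed

definition symb :: "nat list \<Rightarrow> nat \<Rightarrow> nat \<Rightarrow> bool" where
  "symb w s i \<longleftrightarrow> content_of w (int i) = s"

lemma dfp_symb: "dfn F \<Longrightarrow> dfp (\<lambda>w v. symb w s (F w v))"
  unfolding symb_def by (rule dfp_is)

text \<open>The bound \<open>c \<le> m\<close> with \<open>m\<close> in binary is tested by comparing the digits of \<open>m\<close> with those of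
  all numbers less than \<open>c\<close>: only numbers polynomial in the length of the input occur.\<close>

definition verifier :: "nat list \<Rightarrow> bool" where
  "verifier w \<longleftrightarrow> (\<exists>l<length w. symb w 3 l \<and> (\<exists>n<length w. instance_bits l n (symb w 2) \<and>
     cert n (\<lambda>i j. symb w 2 (n + 1 + (i * n + j))) (\<lambda>i j. symb w 2 (l + 1 + (i * n + j)))
       (\<lambda>t v. symb w 2 (l + 1 + (n * n + (t * n + v)))) \<and>
     (\<forall>m<edge_count n (\<lambda>i j. symb w 2 (l + 1 + (i * n + j))).
        \<not> (l - (n + n * n + 2) = (\<Sum>q<Suc m. of_bool (pow2 q)) \<and>
           (\<forall>p<Suc m. pow2 p \<longrightarrow>
              (symb w 2 (n + n * n + 2 + (\<Sum>q<p. of_bool (pow2 q))) \<longleftrightarrow> \<not> 2 dvd m div p))))))"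

lemma dfp_verifier: "dfp (\<lambda>w v. verifier w)"
  unfolding verifier_def instance_bits_def cert_def edge_count_def
  by (intro df_intros dfp_symb)

lemma sum_pow2_mono: "pow2 p \<Longrightarrow> p < Suc m \<Longrightarrow> (\<Sum>q<p. of_bool (pow2 q)) < (\<Sum>q<Suc m. of_bool (pow2 q) :: nat)"
proof -
  assume p: "pow2 p" "p < Suc m"
  have "(\<Sum>q<p. of_bool (pow2 q)) < (\<Sum>q<Suc p. of_bool (pow2 q) :: nat)" using p by simp
  also have "\<dots> \<le> (\<Sum>q<Suc m. of_bool (pow2 q))" using p by (intro sum_mono2) auto
  finally show ?thesis .
qed

text \<open>Used for the numbers \<open>m\<close> below the size of the matching: as
  \<open>binary\<close> is injective, none of them having the given digits means that the bound is
  at least that size.\<close>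

lemma digits_iff:
  assumes X: "\<And>i. i < length x \<Longrightarrow> X i = x ! i" and n: "n + n * n + 2 \<le> length x"
  shows "(length x - (n + n * n + 2) = (\<Sum>q<Suc m. of_bool (pow2 q)) \<and>
      (\<forall>p<Suc m. pow2 p \<longrightarrow> (X (n + n * n + 2 + (\<Sum>q<p. of_bool (pow2 q))) \<longleftrightarrow> \<not> 2 dvd m div p)))
    \<longleftrightarrow> drop (n + n * n + 2) x = binary m"
proof (cases "length x - (n + n * n + 2) = (\<Sum>q<Suc m. of_bool (pow2 q))")
  case True
  have "X (n + n * n + 2 + (\<Sum>q<p. of_bool (pow2 q))) = drop (n + n * n + 2) x ! (\<Sum>q<p. of_bool (pow2 q))"
    if "pow2 p" "p < Suc m" for p
    using sum_pow2_mono[OF that] True n by (subst X) (simp_all del: sum.lessThan_Suc)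
  thus ?thesis unfolding eq_binary_iff using True by (simp cong: imp_cong del: sum.lessThan_Suc)
next
  case False
  thus ?thesis unfolding eq_binary_iff by (simp del: sum.lessThan_Suc)
qed

lemma instance_bits_cong:
  assumes X: "\<And>i. i < l \<Longrightarrow> X i = Y i"
  shows "instance_bits l n X = instance_bits l n Y"
proof (cases "n + n * n + 2 \<le> l")
  case True
  have "X (n + 1 + (i * n + j)) = Y (n + 1 + (i * n + j))" if "i < n" "j < n" for i j
    using X pair_less[OF that] True by simp
  thus ?thesis unfolding instance_bits_def using X True by (auto simp del: add_Suc_right)
qed (simp add: instance_bits_def)

context
  fixes x y :: "bool list"
begin

lemma symb_word_pair_left: "i < length x \<Longrightarrow> symb (word_pair x y) 2 i = x ! i"
  by (auto simp: symb_def word_pair_def word_def content_of_def nth_append)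

text \<open>Positions beyond the certificate are blank, so the missing bits of a short certificate
  read as false.\<close>

lemma symb_word_pair_right: "symb (word_pair x y) 2 (length x + 1 + i) \<longleftrightarrow> i < length y \<and> y ! i"
  by (auto simp: symb_def word_pair_def word_def content_of_def nth_append nat_add_distrib)

lemma symb_word_pair_sep: "symb (word_pair x y) 3 i \<longleftrightarrow> i = length x"
  by (auto simp: symb_def word_pair_def word_def content_of_def nth_append nth_Cons')

lemma verifier_word_pair: "verifier (word_pair x y) \<longleftrightarrow>
   (\<exists>n<length (word_pair x y). instance_bits (length x) n ((!) x) \<and>
     cert n (\<lambda>i j. x ! (n + 1 + (i * n + j))) (\<lambda>i j. i * n + j < length y \<and> y ! (i * n + j))
       (\<lambda>t v. n * n + (t * n + v) < length y \<and> y ! (n * n + (t * n + v))) \<and>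
     (\<forall>m<edge_count n (\<lambda>i j. i * n + j < length y \<and> y ! (i * n + j)).
        drop (n + n * n + 2) x \<noteq> binary m))" (is "_ \<longleftrightarrow> (\<exists>n<_. ?R n)")
proof -
  let ?w = "word_pair x y"
  have len: "length x < length ?w" by (simp add: word_pair_def word_def)
  have one: "(\<exists>l<length ?w. l = length x \<and> P l) \<longleftrightarrow> P (length x)" for P
    using len by auto
  have b: "instance_bits (length x) n (symb ?w 2) = instance_bits (length x) n ((!) x)" for n
    by (rule instance_bits_cong) (rule symb_word_pair_left)
  have c: "cert n (\<lambda>i j. symb ?w 2 (n + 1 + (i * n + j))) K St = cert n (\<lambda>i j. x ! (n + 1 + (i * n + j))) K St"
    if "instance_bits (length x) n ((!) x)" for n K St
  proof (rule cert_cong)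
    fix i j assume "i < n" "j < n"
    thus "symb ?w 2 (n + 1 + (i * n + j)) = x ! (n + 1 + (i * n + j))"
      using that pair_less[of i n j n] by (intro symb_word_pair_left) (simp add: instance_bits_def)
  qed auto
  have "verifier ?w \<longleftrightarrow> (\<exists>n<length ?w. instance_bits (length x) n (symb ?w 2) \<and>
     cert n (\<lambda>i j. symb ?w 2 (n + 1 + (i * n + j))) (\<lambda>i j. i * n + j < length y \<and> y ! (i * n + j))
       (\<lambda>t v. n * n + (t * n + v) < length y \<and> y ! (n * n + (t * n + v))) \<and>
     (\<forall>m<edge_count n (\<lambda>i j. i * n + j < length y \<and> y ! (i * n + j)).
        \<not> (length x - (n + n * n + 2) = (\<Sum>q<Suc m. of_bool (pow2 q)) \<and>
           (\<forall>p<Suc m. pow2 p \<longrightarrow>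
              (symb ?w 2 (n + n * n + 2 + (\<Sum>q<p. of_bool (pow2 q))) \<longleftrightarrow> \<not> 2 dvd m div p)))))"
    unfolding verifier_def symb_word_pair_sep one symb_word_pair_right ..
  also have "\<dots> \<longleftrightarrow> (\<exists>n<length ?w. ?R n)"
  proof -
    have "(length x - (n + n * n + 2) = (\<Sum>q<Suc m. of_bool (pow2 q)) \<and>
      (\<forall>p<Suc m. pow2 p \<longrightarrow> (symb ?w 2 (n + n * n + 2 + (\<Sum>q<p. of_bool (pow2 q))) \<longleftrightarrow> \<not> 2 dvd m div p)))
      \<longleftrightarrow> drop (n + n * n + 2) x = binary m" if "instance_bits (length x) n ((!) x)" for n m
      using that by (intro digits_iff symb_word_pair_left) (auto simp: instance_bits_def)
    thus ?thesis unfolding b using c by (simp cong: conj_cong del: sum.lessThan_Suc)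
  qed
  finally show ?thesis .
qed

end

lemma edge_forcing_problem_iff:
  "x \<in> edge_forcing_problem \<longleftrightarrow>
     (\<exists>y. length y \<le> length x + 2 * (length x * length x) \<and> verifier (word_pair x y))"
proof
  assume "x \<in> edge_forcing_problem"
  then obtain n E k K where x: "x = encode_instance n E k" and G: "simple_graph {..<n} E"
    and K: "edge_forcing_set {..<n} E K" "int (card K) \<le> k"
    unfolding edge_forcing_problem_def by blast
  have k: "k \<ge> 0" using K(2) by linarith
  note I = instance_bits_encode[OF G k x]
  note c = cert_complete[OF G K(1)]
  \<comment> \<open>The matrix of \<open>K\<close>, then the stages \<open>0\<close> to
    \<open>n\<close>, all row by row: \<open>2 * n * n + n\<close> bits, whence the length
    bound.\<close>
  define y where "y = map (\<lambda>r. if r < n * n then {r div n, r mod n} \<in> K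
      else (r - n * n) mod n \<in> stage E (\<Union>K) ((r - n * n) div n)) [0..<n * n + Suc n * n]"
  have n: "n \<le> length x" using I(1) by (simp add: instance_bits_def)
  have "length y \<le> length x + 2 * (length x * length x)"
    using n mult_le_mono[OF n n] by (simp add: y_def)
  moreover have "verifier (word_pair x y)"
    unfolding verifier_word_pair
  proof (intro exI conjI allI impI)
    show "n < length (word_pair x y)" using n by (simp add: word_pair_def word_def)
    show "instance_bits (length x) n ((!) x)" by (rule I(1))
    have 1: "i * n + j < length y \<and> y ! (i * n + j) \<longleftrightarrow> {i, j} \<in> K" if "i < n" "j < n" for i j
      using pair_less[OF that] that by (auto simp: y_def)
    have 2: "n * n + (t * n + v) < length y \<and> y ! (n * n + (t * n + v)) \<longleftrightarrow> v \<in> stage E (\<Union>K) t"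
      if "t \<le> n" "v < n" for t v
    proof -
      have "t * n + v < n * n + n" using that mult_le_mono1[OF that(1), of n] by linarith
      thus ?thesis using that by (auto simp: y_def nth_append simp del: upt_Suc)
    qed
    have "cert n (\<lambda>i j. x ! (n + 1 + (i * n + j))) (\<lambda>i j. i * n + j < length y \<and> y ! (i * n + j))
       (\<lambda>t v. n * n + (t * n + v) < length y \<and> y ! (n * n + (t * n + v))) =
      cert n (\<lambda>i j. {i, j} \<in> E) (\<lambda>i j. {i, j} \<in> K) (\<lambda>t v. v \<in> stage E (\<Union>K) t)"
      by (rule cert_cong) (rule I(2) 1 2; assumption)+
    thus "cert n (\<lambda>i j. x ! (n + 1 + (i * n + j))) (\<lambda>i j. i * n + j < length y \<and> y ! (i * n + j))
       (\<lambda>t v. n * n + (t * n + v) < length y \<and> y ! (n * n + (t * n + v)))"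
      using c(1) by (rule iffD2)
    fix m assume "m < edge_count n (\<lambda>i j. i * n + j < length y \<and> y ! (i * n + j))"
    moreover have "edge_count n (\<lambda>i j. i * n + j < length y \<and> y ! (i * n + j)) = card K"
      unfolding c(2) edge_count_def
    proof (intro sum.cong refl)
      fix i j assume "i \<in> {..<n}" "j \<in> {..<i}"
      thus "(of_bool (i * n + j < length y \<and> y ! (i * n + j)) :: nat) = of_bool ({i, j} \<in> K)"
        using 1[of i j] by simp
    qed
    ultimately have "m \<noteq> nat k" using K(2) by linarith
    thus "drop (n + n * n + 2) x \<noteq> binary m" using I(3) binary_inject by metis
  qed
  ultimately show "\<exists>y. length y \<le> length x + 2 * (length x * length x) \<and> verifier (word_pair x y)"
    by blast
next
  assume "\<exists>y. length y \<le> length x + 2 * (length x * length x) \<and> verifier (word_pair x y)"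
  then obtain y n where b: "instance_bits (length x) n ((!) x)"
    and c: "cert n (\<lambda>i j. x ! (n + 1 + (i * n + j))) (\<lambda>i j. i * n + j < length y \<and> y ! (i * n + j))
       (\<lambda>t v. n * n + (t * n + v) < length y \<and> y ! (n * n + (t * n + v)))"
    and m: "\<forall>m<edge_count n (\<lambda>i j. i * n + j < length y \<and> y ! (i * n + j)). drop (n + n * n + 2) x \<noteq> binary m"
    unfolding verifier_word_pair by blast
  obtain k where k: "simple_graph {..<n} (bit_graph n ((!) x))"
    "x = encode_instance n (bit_graph n ((!) x)) (int k)" "drop (n + n * n + 2) x = binary k"
    "\<And>i j. i < n \<Longrightarrow> j < n \<Longrightarrow> x ! (n + 1 + (i * n + j)) \<longleftrightarrow> {i, j} \<in> bit_graph n ((!) x)"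
    using instance_bits_decode[OF b] by blast
  obtain L where L: "edge_forcing_set {..<n} (bit_graph n ((!) x)) L"
    "card L = edge_count n (\<lambda>i j. i * n + j < length y \<and> y ! (i * n + j))"
    using cert_sound[OF k(1,4) c] by blast
  have "int (card L) \<le> int k" using m k(3) L(2) by (metis not_less of_nat_le_iff)
  thus "x \<in> edge_forcing_problem"
    unfolding edge_forcing_problem_def using k(1,2) L(1) by blast
qed

lemma in_NP_edge_forcing_problem: "in_NP edge_forcing_problem"
proof -
  obtain e where e: "\<And>w v. eval e w v = of_bool (verifier w)"
    using dfp_verifier unfolding dfp_def dfn_def by blast
  obtain M k where M: "turing_machine M"
    "\<And>w. 0 \<notin> set w \<Longrightarrow> halts_within M w (poly (time_poly k) (length w))"
    "\<And>w. 0 \<notin> set w \<Longrightarrow> accepts M w \<longleftrightarrow> eval e w (\<lambda>_. 0) > 0"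
    using decide_exp by blast
  have w: "0 \<notin> set (word_pair x y)" for x y by (auto simp: word_pair_def word_def)
  have acc: "accepts M (word_pair x y) \<longleftrightarrow> verifier (word_pair x y)" for x y
    using M(3)[OF w] e by simp
  have q: "poly [:0, 1, 2:] n = n + 2 * (n * n)" for n :: nat
    by (simp add: algebra_simps)
  show ?thesis unfolding in_NP_def
    using M(1) M(2)[OF w] edge_forcing_problem_iff
    by (intro exI[of _ M] exI[of _ "time_poly k"] exI[of _ "[:0, 1, 2:]"]) (simp only: acc q simp_thms)
qed

section \<open>From satisfiability to edge forcing\<close>

text \<open>Literal \<open>l\<close> belongs to variable \<open>l div 2\<close> and is positive iff \<open>l\<close> is odd; \<open>inc l j\<close> says that
  it occurs in clause \<open>j\<close>.\<close>

definition satisfiable :: "nat \<Rightarrow> nat \<Rightarrow> (nat \<Rightarrow> nat \<Rightarrow> bool) \<Rightarrow> bool" where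
  "satisfiable n m inc \<longleftrightarrow> (\<exists>\<alpha>. \<forall>j<m. \<exists>l<2 * n. inc l j \<and> \<alpha> (l div 2) = odd l)"

text \<open>\<open>C v\<close> is joined to the two literals of variable \<open>v\<close>. For every literal \<open>l\<close> and each of the two
  copies \<open>e\<close> of clause \<open>e div 2\<close> there is a gate \<open>G 0 l e\<close> with a triangle \<open>G 0, G 1, G 2\<close>, passing
  \<open>L l\<close> on to \<open>G 3 l e\<close> and from there to \<open>D (e div 2)\<close>; the copies prevent \<open>D\<close> from forcing
  backwards. \<open>Sp 0\<close> with the triangle \<open>Sp 0, Sp 1, Sp 2\<close> forces \<open>Sp 3\<close> once all clauses are reached,
  whereupon the \<open>C v\<close> force the remaining literals.\<close>

datatype vert = C nat | L nat | D nat | Sp nat | G nat nat nat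

locale cnf =
  fixes n m :: nat and inc :: "nat \<Rightarrow> nat \<Rightarrow> bool"
begin

text \<open>Each edge is listed in one direction only; facts about edges are proved by the case
  distinction of \<open>arc\<close> and then symmetrised through \<open>adj\<close>.\<close>

fun arc :: "vert \<Rightarrow> vert \<Rightarrow> bool" where
  "arc (C v) (L l) \<longleftrightarrow> l < 2 * n \<and> v = l div 2"
| "arc (C v) (Sp r) \<longleftrightarrow> v < n \<and> r = 3"
| "arc (L l) (G r l' e) \<longleftrightarrow> l < 2 * n \<and> e < 2 * m \<and> l' = l \<and> r = 0"
| "arc (G r l e) (G r' l' e') \<longleftrightarrow> l < 2 * n \<and> e < 2 * m \<and> l' = l \<and> e' = e \<and>
     (r = 0 \<and> (r' = 1 \<or> r' = 2 \<or> r' = 3) \<or> r = 1 \<and> r' = 2)"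
| "arc (G r l e) (D j) \<longleftrightarrow> l < 2 * n \<and> e < 2 * m \<and> r = 3 \<and> j = e div 2 \<and> inc l j"
| "arc (Sp r) (Sp r') \<longleftrightarrow> r = 0 \<and> (r' = 1 \<or> r' = 2 \<or> r' = 3) \<or> r = 1 \<and> r' = 2"
| "arc (Sp r) (D j) \<longleftrightarrow> j < m \<and> r = 0"
| "arc _ _ \<longleftrightarrow> False"

definition adj :: "vert \<Rightarrow> vert \<Rightarrow> bool" where
  "adj x y \<longleftrightarrow> arc x y \<or> arc y x"

definition E :: "vert set set" where
  "E = {{x, y} | x y. arc x y}"

fun vertex :: "vert \<Rightarrow> bool" where
  "vertex (C v) \<longleftrightarrow> v < n"
| "vertex (L l) \<longleftrightarrow> l < 2 * n"
| "vertex (D j) \<longleftrightarrow> j < m"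
| "vertex (Sp r) \<longleftrightarrow> r < 4"
| "vertex (G r l e) \<longleftrightarrow> r < 4 \<and> l < 2 * n \<and> e < 2 * m"

definition V :: "vert set" where
  "V = {x. vertex x}"

text \<open>One edge for each variable, for each of the \<open>2 * n * (2 * m)\<close> gates and for
  the triangle at \<open>Sp 0\<close>.\<close>

definition budget :: nat where
  "budget = n + 2 * n * (2 * m) + 1"

lemma E_iff: "{x, y} \<in> E \<longleftrightarrow> adj x y"
  by (auto simp: E_def adj_def doubleton_eq_iff)

lemma arc_vertex: "arc x y \<Longrightarrow> vertex x \<and> vertex y \<and> x \<noteq> y"
  by (induction x y rule: arc.induct) auto

lemma adj_vertex: "adj x y \<Longrightarrow> vertex x \<and> vertex y \<and> x \<noteq> y"
  using arc_vertex by (auto simp: adj_def)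

lemma finite_V: "finite V"
proof -
  have "V \<subseteq> C ` {..<n} \<union> L ` {..<2 * n} \<union> D ` {..<m} \<union> Sp ` {..<4} \<union>
      (\<lambda>(r, l, e). G r l e) ` ({..<4} \<times> {..<2 * n} \<times> {..<2 * m})"
  proof
    fix x assume "x \<in> V"
    thus "x \<in> C ` {..<n} \<union> L ` {..<2 * n} \<union> D ` {..<m} \<union> Sp ` {..<4} \<union>
      (\<lambda>(r, l, e). G r l e) ` ({..<4} \<times> {..<2 * n} \<times> {..<2 * m})"
      by (cases x) (auto simp: V_def intro!: image_eqI[of _ "\<lambda>(r, l, e). G r l e" "(_, _, _)"])
  qed
  thus ?thesis by (rule finite_subset) auto
qed

lemma simple: "simple_graph V E"
  unfolding simple_graph_def using finite_V arc_vertex by (auto simp: E_def V_def)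

lemma adj_eqs:
  "adj (C v) y \<longleftrightarrow> (\<exists>l<2 * n. v = l div 2 \<and> y = L l) \<or> v < n \<and> y = Sp 3"
  "adj (L l) y \<longleftrightarrow> l < 2 * n \<and> (y = C (l div 2) \<or> (\<exists>e<2 * m. y = G 0 l e))"
  "adj (D j) y \<longleftrightarrow> j < m \<and> y = Sp 0 \<or> (\<exists>l<2 * n. \<exists>e<2 * m. j = e div 2 \<and> inc l j \<and> y = G 3 l e)"
  "adj (Sp 0) y \<longleftrightarrow> y = Sp 1 \<or> y = Sp 2 \<or> y = Sp 3 \<or> (\<exists>j<m. y = D j)"
  "adj (Sp 1) y \<longleftrightarrow> y = Sp 0 \<or> y = Sp 2"
  "adj (Sp 2) y \<longleftrightarrow> y = Sp 0 \<or> y = Sp 1"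
  "adj (Sp 3) y \<longleftrightarrow> y = Sp 0 \<or> (\<exists>v<n. y = C v)"
  "adj (G 0 l e) y \<longleftrightarrow> l < 2 * n \<and> e < 2 * m \<and> (y = L l \<or> y = G 1 l e \<or> y = G 2 l e \<or> y = G 3 l e)"
  "adj (G 1 l e) y \<longleftrightarrow> l < 2 * n \<and> e < 2 * m \<and> (y = G 0 l e \<or> y = G 2 l e)"
  "adj (G 2 l e) y \<longleftrightarrow> l < 2 * n \<and> e < 2 * m \<and> (y = G 0 l e \<or> y = G 1 l e)"
  "adj (G 3 l e) y \<longleftrightarrow> l < 2 * n \<and> e < 2 * m \<and> (y = G 0 l e \<or> y = D (e div 2) \<and> inc l (e div 2))"
  by (cases y; auto simp: adj_def)+

lemmas adj_simps = adj_eqs adj_eqs[unfolded One_nat_def]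

lemma vertex_cases:
  assumes "x \<in> V"
  obtains (C) v where "v < n" "x = C v" | (L) l where "l < 2 * n" "x = L l"
    | (D) j where "j < m" "x = D j" | (S0) "x = Sp 0" | (S1) "x = Sp 1" | (S2) "x = Sp 2" | (S3) "x = Sp 3"
    | (G0) l e where "l < 2 * n" "e < 2 * m" "x = G 0 l e" | (G1) l e where "l < 2 * n" "e < 2 * m" "x = G 1 l e"
    | (G2) l e where "l < 2 * n" "e < 2 * m" "x = G 2 l e" | (G3) l e where "l < 2 * n" "e < 2 * m" "x = G 3 l e"
proof -
  have four: "r = 0 \<or> r = 1 \<or> r = 2 \<or> r = 3" if "r < 4" for r :: nat using that by linarith
  show thesis using assms that four by (cases x) (auto simp: V_def; blast)+
qed

lemma stable_adjD:
  assumes "force_stable E S" "u \<in> S" "adj u v" "\<And>w. adj u w \<Longrightarrow> w \<noteq> v \<Longrightarrow> w \<in> S"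
  shows "v \<in> S"
  by (rule stableD[OF assms(1,2)]) (use assms(3,4) in \<open>auto simp: E_iff\<close>)

lemma stable_adjI:
  assumes "\<And>u x. u \<in> S \<Longrightarrow> adj u x \<Longrightarrow> x \<notin> S \<Longrightarrow> \<exists>y. y \<noteq> x \<and> adj u y \<and> y \<notin> S"
  shows "force_stable E S"
  unfolding force_stable_def neighbors_def E_iff using assms by blast

text \<open>Variables contribute the edge from \<open>C v\<close> to their true literal, triangles
  the edge opposite to \<open>G 0\<close> or \<open>Sp 0\<close>. Forcing runs from the triangles to
  \<open>G 0\<close> and \<open>Sp 0\<close>, from true literals through their gates to
  \<open>D\<close>, then from \<open>Sp 0\<close> to \<open>Sp 3\<close>, and only then from
  \<open>C v\<close> to the false literals.\<close>

lemma complete: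
  assumes "satisfiable n m inc"
  shows "\<exists>K. edge_forcing_set V E K \<and> card K \<le> budget"
proof -
  obtain \<alpha> where \<alpha>: "\<forall>j<m. \<exists>l<2 * n. inc l j \<and> \<alpha> (l div 2) = odd l"
    using assms unfolding satisfiable_def by blast
  define lit where "lit v = 2 * v + of_bool (\<alpha> v)" for v
  have lit: "lit v div 2 = v" "odd (lit v) = \<alpha> v" for v by (auto simp: lit_def)
  have lit_less: "lit v < 2 * n" if "v < n" for v using that by (auto simp: lit_def)
  have lit_eq: "l = lit (l div 2)" if "\<alpha> (l div 2) = odd l" for l
    using that by (auto simp: lit_def elim!: evenE oddE)
  let ?A = "(\<lambda>v. {C v, L (lit v)}) ` {..<n}"
  let ?B = "(\<lambda>(l, e). {G 1 l e, G 2 l e}) ` ({..<2 * n} \<times> {..<2 * m})"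
  let ?K = "?A \<union> ?B \<union> {{Sp 1, Sp 2}}"
  have "card ?K \<le> budget"
  proof -
    have "card ?A \<le> n" using card_image_le[of "{..<n}"] by simp
    moreover have "card ?B \<le> 2 * n * (2 * m)"
      using card_image_le[of "{..<2 * n} \<times> {..<2 * m}"] by (simp add: card_cartesian_product)
    ultimately show ?thesis
      using card_Un_le[of "?A \<union> ?B" "{{Sp 1, Sp 2}}"] card_Un_le[of ?A ?B] by (simp add: budget_def)
  qed
  moreover have "matching E ?K"
    unfolding matching_def
  proof
    show "?K \<subseteq> E" using lit lit_less by (auto simp: E_iff adj_def)
    have "lit v \<noteq> lit w" if "v \<noteq> w" for v w using that lit(1) by metis
    thus "pairwise disjnt ?K" by (auto simp: pairwise_def disjnt_def)
  qed
  moreover have "S = V" if S: "\<Union>?K \<subseteq> S" "S \<subseteq> V" "force_stable E S" for S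
  proof -
    note st = stable_adjD[OF S(3)]
    have sp: "Sp 1 \<in> S" "Sp 2 \<in> S" using S(1) by auto
    have g12: "G 1 l e \<in> S" "G 2 l e \<in> S" if "l < 2 * n" "e < 2 * m" for l e
    proof -
      have "{G 1 l e, G 2 l e} \<in> ?K" using that by blast
      hence "{G 1 l e, G 2 l e} \<subseteq> S" by (rule order_trans[OF Union_upper S(1)])
      thus "G 1 l e \<in> S" "G 2 l e \<in> S" by auto
    qed
    have "{C v, L (lit v)} \<subseteq> S" if "v < n" for v
    proof -
      have "{C v, L (lit v)} \<in> ?K" using that by blast
      thus ?thesis by (rule order_trans[OF Union_upper S(1)])
    qed
    hence c: "C v \<in> S" "L (lit v) \<in> S" if "v < n" for v using that by auto
    have sp0: "Sp 0 \<in> S" by (rule st[of "Sp 1"]) (use sp in \<open>auto simp: adj_simps\<close>)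
    have g0: "G 0 l e \<in> S" if "l < 2 * n" "e < 2 * m" for l e
      by (rule st[of "G 1 l e"]) (use that g12 in \<open>auto simp: adj_simps\<close>)
    have g3: "G 3 l e \<in> S" if "l < 2 * n" "e < 2 * m" "L l \<in> S" for l e
      by (rule st[of "G 0 l e"]) (use that g12 g0 in \<open>auto simp: adj_simps\<close>)
    have d: "D j \<in> S" if "j < m" for j
    proof -
      obtain l where l: "l < 2 * n" "inc l j" "\<alpha> (l div 2) = odd l" using \<alpha> \<open>j < m\<close> by blast
      have "L l \<in> S" using c(2)[of "l div 2"] lit_eq[OF l(3)] l(1) by auto
      \<comment> \<open>\<open>2 * j\<close> is one of the two copies of clause \<open>j\<close>;
        apart from \<open>D j\<close> the only neighbour of this vertex is \<open>G 0\<close>, which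
        is coloured.\<close>
      hence "G 3 l (2 * j) \<in> S" using g3 l that by simp
      thus ?thesis
        by (rule st) (use l that g0 in \<open>auto simp: adj_simps\<close>)
    qed
    \<comment> \<open>All other neighbours of \<open>Sp 0\<close> are coloured at this point; this
      is where every clause has to be satisfied.\<close>
    have sp3: "Sp 3 \<in> S" by (rule st[of "Sp 0"]) (use sp sp0 d in \<open>auto simp: adj_simps\<close>)
    have ll: "L l \<in> S" if "l < 2 * n" for l
    proof (cases "l = lit (l div 2)")
      case True
      thus ?thesis using c(2)[of "l div 2"] that by auto
    next
      case False
      have "l' = lit (l div 2)" if "l' div 2 = l div 2" "l' \<noteq> l" for l'
        using that False unfolding lit_def by (auto split: if_splits)
      hence "\<And>l'. l' div 2 = l div 2 \<Longrightarrow> l' \<noteq> l \<Longrightarrow> L l' \<in> S" using c(2)[of "l div 2"] that by auto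
      note other = this
      show ?thesis
      proof (rule st[of "C (l div 2)"])
        show "C (l div 2) \<in> S" using c that by auto
        show "adj (C (l div 2)) (L l)" using that unfolding adj_simps by blast
        fix w assume w: "adj (C (l div 2)) w" "w \<noteq> L l"
        from w(1) consider l' where "l div 2 = l' div 2" "w = L l'" | "w = Sp 3"
          unfolding adj_simps by blast
        thus "w \<in> S"
        proof cases
          case 1
          thus ?thesis using other[of l'] w(2) by simp
        qed (use sp3 in simp)
      qed
    qed
    have "V \<subseteq> S"
    proof
      fix x assume "x \<in> V"
      thus "x \<in> S" by (cases rule: vertex_cases) (use c ll d sp sp0 sp3 g0 g12 g3 in auto)
    qed
    thus ?thesis using S(2) by blast
  qed
  ultimately show ?thesis unfolding edge_forcing_set_iff[OF simple] by blast
qed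

section \<open>Forts\<close>

text \<open>Each vertex of a fort is labelled with the name of the fort. The fort of variable
  \<open>v\<close>, named \<open>C v\<close> although \<open>C v\<close> lies outside, consists of
  its literals and the \<open>G 3\<close> vertices of their gates; the other forts are the pairs
  \<open>G 1\<close>, \<open>G 2\<close> and \<open>Sp 1\<close>, \<open>Sp 2\<close>.\<close>

fun owner :: "vert \<Rightarrow> vert option" where
  "owner (L l) = Some (C (l div 2))"
| "owner (G r l e) = (if r = 1 \<or> r = 2 then Some (G 1 l e) else if r = 3 then Some (C (l div 2)) else None)"
| "owner (Sp r) = (if r = 1 \<or> r = 2 then Some (Sp 1) else None)"
| "owner _ = None"

text \<open>\<open>L l\<close> and \<open>G 3 l e\<close> both stand for literal \<open>l\<close>:
  an edge of the matching at either of them decides the variable.\<close>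

fun lit_of :: "vert \<Rightarrow> nat option" where
  "lit_of (L l) = Some l"
| "lit_of (G r l e) = (if r = 3 then Some l else None)"
| "lit_of _ = None"

definition slots :: "vert set" where
  "slots = C ` {..<n} \<union> (\<lambda>(l, e). G 1 l e) ` ({..<2 * n} \<times> {..<2 * m}) \<union> {Sp 1}"

definition fort :: "vert \<Rightarrow> vert set" where
  "fort s = {x \<in> V. owner x = Some s}"

lemma card_slots: "card slots = budget" "finite slots"
proof -
  have "card ((\<lambda>(l, e). G 1 l e) ` ({..<2 * n} \<times> {..<2 * m})) = 2 * n * (2 * m)"
    by (subst card_image) (auto simp: inj_on_def card_cartesian_product)
  moreover have "card (C ` {..<n}) = n" by (subst card_image) (auto simp: inj_on_def)
  ultimately show "card slots = budget"
    unfolding slots_def budget_def by (subst card_Un_disjoint; auto)+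
  show "finite slots" by (simp add: slots_def)
qed

text \<open>Ensures that one edge cannot serve two forts.\<close>

lemma arc_owner: "arc x y \<Longrightarrow> owner x = Some s \<Longrightarrow> owner y = Some s' \<Longrightarrow> s = s'"
  by (induction x y rule: arc.induct) (auto split: if_splits)

lemma adj_owner: "adj x y \<Longrightarrow> owner x = Some s \<Longrightarrow> owner y = Some s' \<Longrightarrow> s = s'"
  using arc_owner unfolding adj_def by blast

text \<open>Variable forts are independent sets, so the single edge granted to one meets it in one
  vertex and selects one literal.\<close>

lemma arc_lit_of: "arc x y \<Longrightarrow> lit_of x = None \<or> lit_of y = None"
  by (induction x y rule: arc.induct) (auto split: if_splits)

lemma adj_lit_of: "adj x y \<Longrightarrow> lit_of x = None \<or> lit_of y = None"
  using arc_lit_of[of x y] arc_lit_of[of y x] unfolding adj_def by auto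

text \<open>Exchanges \<open>2 * k\<close> and \<open>2 * k + 1\<close>, which are the two literals
  of a variable or the two copies of a clause.\<close>

definition flip :: "nat \<Rightarrow> nat" where
  "flip e = (if even e then e + 1 else e - 1)"

lemma flip: "flip e div 2 = e div 2" "flip e \<noteq> e" "e < 2 * k \<Longrightarrow> flip e < 2 * k"
  by (auto simp: flip_def elim!: evenE oddE)

text \<open>An outside vertex next to a fort has at least two neighbours in it: \<open>C v\<close>
  the two literals, \<open>G 0\<close> either a literal with its \<open>G 3\<close> or
  \<open>G 1\<close> with \<open>G 2\<close>, \<open>D\<close> the two copies of a gate, and
  \<open>Sp 0\<close> the pair \<open>Sp 1\<close>, \<open>Sp 2\<close>.\<close>

lemma fort_stable:
  assumes s: "s \<in> slots"
  shows "force_stable E (V - fort s)" and "fort s \<noteq> {}"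
proof -
  show "fort s \<noteq> {}"
  proof -
    have "\<exists>x\<in>V. owner x = Some s"
      using s unfolding slots_def
    proof (elim UnE)
      assume "s \<in> C ` {..<n}"
      then obtain v where "v < n" "s = C v" by auto
      thus ?thesis by (intro bexI[of _ "L (2 * v)"]) (auto simp: V_def)
    next
      assume "s \<in> (\<lambda>(l, e). G 1 l e) ` ({..<2 * n} \<times> {..<2 * m})"
      then obtain l e where "l < 2 * n" "e < 2 * m" "s = G 1 l e" by auto
      thus ?thesis by (intro bexI[of _ "G 1 l e"]) (auto simp: V_def)
    next
      assume "s \<in> {Sp 1}"
      thus ?thesis by (intro bexI[of _ "Sp 1"]) (auto simp: V_def)
    qed
    thus ?thesis by (auto simp: fort_def)
  qed
  show "force_stable E (V - fort s)"
  proof (rule stable_adjI)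
    fix u x assume u: "u \<in> V - fort s" and ux: "adj u x" and "x \<notin> V - fort s"
    hence x: "x \<in> V" "owner x = Some s" using adj_vertex[OF ux] by (auto simp: V_def fort_def)
    have nu: "owner u \<noteq> Some s" using u by (simp add: fort_def)
    have "\<exists>y. y \<noteq> x \<and> adj u y \<and> owner y = Some s"
      using x(1)
    proof (cases rule: vertex_cases)
      case (L l)
      have "adj (L l) u" using ux L by (simp add: adj_def disj_commute)
      then consider "u = C (l div 2)" | e where "e < 2 * m" "u = G 0 l e" by (auto simp: adj_simps)
      thus ?thesis
      proof cases
        case 1
        thus ?thesis using L x(2) flip[of l] by (intro exI[of _ "L (flip l)"]) (auto simp: adj_simps)
      next
        case 2
        thus ?thesis using L x(2) by (intro exI[of _ "G 3 l e"]) (auto simp: adj_simps)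
      qed
    next
      case S1
      have "adj (Sp 1) u" using ux S1 by (simp add: adj_def disj_commute)
      thus ?thesis using x(2) S1 nu by (intro exI[of _ "Sp 2"]) (auto simp: adj_simps)
    next
      case S2
      have "adj (Sp 2) u" using ux S2 by (simp add: adj_def disj_commute)
      thus ?thesis using x(2) S2 nu by (intro exI[of _ "Sp 1"]) (auto simp: adj_simps)
    next
      case (G1 l e)
      have "adj (G 1 l e) u" using ux G1 by (simp add: adj_def disj_commute)
      thus ?thesis using x(2) G1 nu by (intro exI[of _ "G 2 l e"]) (auto simp: adj_simps)
    next
      case (G2 l e)
      have "adj (G 2 l e) u" using ux G2 by (simp add: adj_def disj_commute)
      thus ?thesis using x(2) G2 nu by (intro exI[of _ "G 1 l e"]) (auto simp: adj_simps)
    next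
      case (G3 l e)
      have "adj (G 3 l e) u" using ux G3 by (simp add: adj_def disj_commute)
      then consider "u = G 0 l e" | "u = D (e div 2)" "inc l (e div 2)" by (auto simp: adj_simps)
      thus ?thesis
      proof cases
        case 1
        thus ?thesis using G3 x(2) by (intro exI[of _ "L l"]) (auto simp: adj_simps)
      next
        case 2
        thus ?thesis using G3 x(2) flip[of e] by (intro exI[of _ "G 3 l (flip e)"]) (auto simp: adj_simps)
      qed
    qed (use x(2) in auto)
    thus "\<exists>y. y \<noteq> x \<and> adj u y \<and> y \<notin> V - fort s"
      using adj_vertex by (auto simp: V_def fort_def)
  qed
qed

text \<open>As there are \<open>budget\<close> forts, every edge of \<open>K\<close> belongs to
  exactly one. The touched literal vertices define an assignment. If it left a clause unsatisfied,
  the vertices of false literals, the unsatisfied clauses and \<open>Sp 3\<close> would form a fort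
  that \<open>K\<close> misses.\<close>

lemma sound:
  assumes K: "edge_forcing_set V E K" "card K \<le> budget"
  shows "satisfiable n m inc"
proof -
  have mK: "K \<subseteq> E" and full: "\<And>S. \<Union>K \<subseteq> S \<Longrightarrow> S \<subseteq> V \<Longrightarrow> force_stable E S \<Longrightarrow> S = V"
    using K(1) unfolding edge_forcing_set_iff[OF simple] matching_def by blast+
  have KV: "\<Union>K \<subseteq> V" using mK simple by (auto simp: simple_graph_def)
  have "finite E" using simple unfolding simple_graph_def
    by (meson PowI finite_Pow_iff finite_subset subsetI)
  hence finK: "finite K" using mK finite_subset by blast
  have edge: "\<exists>y. \<kappa> = {x, y} \<and> adj x y" if \<kappa>: "\<kappa> \<in> K" "x \<in> \<kappa>" for \<kappa> x
  proof -
    have "\<kappa> \<in> E" using \<kappa>(1) mK by blast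
    then obtain a b where "\<kappa> = {a, b}" "arc a b" by (auto simp: E_def)
    thus ?thesis using \<kappa>(2) by (auto simp: adj_def insert_commute)
  qed
  have "\<exists>\<kappa>\<in>K. \<kappa> \<inter> fort s \<noteq> {}" if "s \<in> slots" for s
  proof (rule ccontr)
    assume "\<not> (\<exists>\<kappa>\<in>K. \<kappa> \<inter> fort s \<noteq> {})"
    hence "\<Union>K \<subseteq> V - fort s" using KV by blast
    hence "V - fort s = V" using full fort_stable(1)[OF that] by blast
    moreover have "fort s \<subseteq> V" by (auto simp: fort_def)
    ultimately show False using fort_stable(2)[OF that] by blast
  qed
  then obtain f where f: "\<And>s. s \<in> slots \<Longrightarrow> f s \<in> K \<and> f s \<inter> fort s \<noteq> {}" by metis
  have meet: "s = s'" if \<kappa>: "\<kappa> \<in> K" "\<kappa> \<inter> fort s \<noteq> {}" "\<kappa> \<inter> fort s' \<noteq> {}" for \<kappa> s s'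
  proof -
    obtain x x' where x: "x \<in> \<kappa>" "owner x = Some s" "x' \<in> \<kappa>" "owner x' = Some s'"
      using \<kappa>(2,3) by (auto simp: fort_def)
    obtain y where y: "\<kappa> = {x, y}" "adj x y" using edge[OF \<kappa>(1) x(1)] by blast
    show ?thesis using x y adj_owner[OF y(2)] by auto
  qed
  have "inj_on f slots"
  proof (rule inj_onI)
    fix s s' assume "s \<in> slots" "s' \<in> slots" "f s = f s'"
    thus "s = s'" using f[of s] f[of s'] meet[of "f s" s s'] by simp
  qed
  hence "card (f ` slots) = budget" by (simp add: card_image card_slots)
  \<comment> \<open>\<open>f\<close> is injective on the forts and \<open>K\<close> has no more
    elements than there are forts, so \<open>f\<close> is onto.\<close>
  hence img: "f ` slots = K" using finK f K(2) by (intro card_seteq) auto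
  have hit: "\<exists>s\<in>slots. \<kappa> \<inter> fort s \<noteq> {}" if "\<kappa> \<in> K" for \<kappa>
    using that f unfolding img[symmetric] by blast
  have uniq: "\<kappa> = \<kappa>'" if \<kappa>: "\<kappa> \<in> K" "\<kappa>' \<in> K" "\<kappa> \<inter> fort s \<noteq> {}" "\<kappa>' \<inter> fort s \<noteq> {}" for \<kappa> \<kappa>' s
  proof -
    obtain t t' where t: "t \<in> slots" "\<kappa> = f t" "t' \<in> slots" "\<kappa>' = f t'"
      using \<kappa>(1,2) unfolding img[symmetric] by blast
    hence "t = s" "t' = s" using f[of t] f[of t'] meet[of \<kappa> t s] meet[of \<kappa>' t' s] \<kappa> by auto
    thus ?thesis using t by simp
  qed
  \<comment> \<open>This excludes edges without an endpoint in a fort, in particular all edges at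
    \<open>Sp 3\<close>.\<close>
  have owned: "\<exists>z\<in>\<kappa>. owner z \<noteq> None" if "\<kappa> \<in> K" for \<kappa>
    using hit[OF that] by (fastforce simp: fort_def)
  \<comment> \<open>Variable \<open>v\<close> is true iff the edge of its fort touches the positive
    literal; by \<open>adj_lit_of\<close> it cannot touch both.\<close>
  define \<alpha> where "\<alpha> v \<longleftrightarrow> (\<exists>\<kappa>\<in>K. \<exists>x\<in>\<kappa>. lit_of x = Some (2 * v + 1))" for v
  define tr where "tr l \<longleftrightarrow> \<alpha> (l div 2) = odd l" for l
  have lit_owner: "owner x = Some (C (l div 2))" if "lit_of x = Some l" for x l
    using that by (cases x) (auto split: if_splits)
  have true: "tr l" if \<kappa>: "\<kappa> \<in> K" "x \<in> \<kappa>" "lit_of x = Some l" for \<kappa> x l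
  proof (cases "odd l")
    case True
    hence "l = 2 * (l div 2) + 1" by simp
    thus ?thesis using that True unfolding tr_def \<alpha>_def by metis
  next
    case False
    hence l: "l = 2 * (l div 2)" by simp
    have "\<not> \<alpha> (l div 2)"
    proof
      assume "\<alpha> (l div 2)"
      then obtain \<kappa>' x' where \<kappa>': "\<kappa>' \<in> K" "x' \<in> \<kappa>'" "lit_of x' = Some (2 * (l div 2) + 1)"
        unfolding \<alpha>_def by blast
      have "x \<in> fort (C (l div 2))" "x' \<in> fort (C (l div 2))"
        using \<kappa> \<kappa>' KV lit_owner[of x] lit_owner[of x'] by (auto simp: fort_def)
      hence "\<kappa> = \<kappa>'" using uniq[of \<kappa> \<kappa>' "C (l div 2)"] \<kappa> \<kappa>' by blast
      moreover have "x \<noteq> x'" using \<kappa>(3) \<kappa>'(3) l by auto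
      moreover obtain y where "\<kappa> = {x, y}" "adj x y" using edge[OF \<kappa>(1,2)] by blast
      ultimately show False using \<kappa>' \<kappa>(3) adj_lit_of[of x y] by auto
    qed
    thus ?thesis using False unfolding tr_def by simp
  qed
  define good where "good j \<longleftrightarrow> (\<exists>l<2 * n. inc l j \<and> tr l)" for j
  have "good j" if j: "j < m" for j
  proof (rule ccontr)
    assume bad: "\<not> good j"
    define S where "S = V - ({Sp 3} \<union> {x. \<exists>l. lit_of x = Some l \<and> \<not> tr l} \<union> {D i | i. \<not> good i})"
    have "\<Union>K \<subseteq> S"
    proof
      fix x assume "x \<in> \<Union>K"
      then obtain \<kappa> where \<kappa>: "\<kappa> \<in> K" "x \<in> \<kappa>" by blast
      obtain y where y: "\<kappa> = {x, y}" "adj x y" using edge[OF \<kappa>] by blast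
      have "x \<noteq> Sp 3"
      proof
        assume x: "x = Sp 3"
        hence "owner y = None" using y(2) by (auto simp: adj_simps)
        thus False using owned[OF \<kappa>(1)] y(1) x by auto
      qed
      moreover have "tr l" if "lit_of x = Some l" for l using true \<kappa> that by blast
      \<comment> \<open>An edge at a clause vertex has its other end in a fort, so at some
        \<open>G 3\<close>; the literal there is true and occurs in the clause.\<close>
      moreover have "good i" if x: "x = D i" for i
      proof -
        have "owner y \<noteq> None" using owned[OF \<kappa>(1)] y(1) x by auto
        then obtain l e where l: "l < 2 * n" "i = e div 2" "inc l i" "y = G 3 l e"
          using y(2) x by (auto simp: adj_simps)
        hence "tr l" using true[OF \<kappa>(1), of y l] y(1) by simp
        thus ?thesis using l unfolding good_def by blast
      qed
      ultimately show "x \<in> S" using \<kappa> KV unfolding S_def by blast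
    qed
    moreover have "S \<subseteq> V" by (auto simp: S_def)
    moreover have "force_stable E S"
    proof (rule stable_adjI)
      fix u x assume u: "u \<in> S" and ux: "adj u x" and xS: "x \<notin> S"
      have uV: "u \<in> V" "u \<noteq> Sp 3" "\<And>l. lit_of u = Some l \<Longrightarrow> tr l" "\<And>i. u = D i \<Longrightarrow> good i"
        using u by (auto simp: S_def)
      have out: "x = Sp 3 \<or> (\<exists>l. lit_of x = Some l \<and> \<not> tr l) \<or> (\<exists>i. x = D i \<and> \<not> good i)"
        using xS adj_vertex[OF ux] by (auto simp: S_def V_def)
      have outI: "Sp 3 \<notin> S" "\<And>l. \<not> tr l \<Longrightarrow> L l \<notin> S" "\<And>l e. \<not> tr l \<Longrightarrow> G 3 l e \<notin> S" "\<And>i. \<not> good i \<Longrightarrow> D i \<notin> S"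
        by (auto simp: S_def)
      from uV(1) show "\<exists>y. y \<noteq> x \<and> adj u y \<and> y \<notin> S"
      proof (cases rule: vertex_cases)
        case (C v)
        \<comment> \<open>The false literal of \<open>v\<close>; it and \<open>Sp 3\<close> are the
          two uncoloured neighbours of \<open>C v\<close>.\<close>
        define l where "l = (if \<alpha> v then 2 * v else 2 * v + 1)"
        have l: "\<not> tr l" "l div 2 = v" "l < 2 * n" using C by (auto simp: l_def tr_def)
        show ?thesis
        proof (cases "x = Sp 3")
          case True
          thus ?thesis using C l outI by (intro exI[of _ "L l"]) (auto simp: adj_simps)
        next
          case False
          thus ?thesis using C outI by (intro exI[of _ "Sp 3"]) (auto simp: adj_simps)
        qed
      next
        case (L l)
        thus ?thesis using ux out by (auto simp: adj_simps)
      next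
        case (D i)
        then obtain l e where "l < 2 * n" "e < 2 * m" "i = e div 2" "inc l i" "x = G 3 l e" "\<not> tr l"
          using ux out by (auto simp: adj_simps)
        thus ?thesis using D flip[of e] outI by (intro exI[of _ "G 3 l (flip e)"]) (auto simp: adj_simps)
      next
        case S0
        show ?thesis
        proof (cases "x = Sp 3")
          case True
          thus ?thesis using S0 j bad outI by (intro exI[of _ "D j"]) (auto simp: adj_simps)
        next
          case False
          thus ?thesis using S0 outI by (intro exI[of _ "Sp 3"]) (auto simp: adj_simps)
        qed
      next
        case S1
        have "x = Sp 0 \<or> x = Sp 2" using ux unfolding S1 adj_eqs by blast
        thus ?thesis using out by auto
      next
        case S2
        have "x = Sp 0 \<or> x = Sp 1" using ux unfolding S2 adj_eqs by blast
        thus ?thesis using out by auto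
      next
        case (G0 l e)
        hence nt: "\<not> tr l" using ux out by (auto simp: adj_simps)
        show ?thesis
        proof (cases "x = L l")
          case True
          thus ?thesis using G0 nt outI by (intro exI[of _ "G 3 l e"]) (auto simp: adj_simps)
        next
          case False
          thus ?thesis using G0 nt outI by (intro exI[of _ "L l"]) (auto simp: adj_simps)
        qed
      next
        case (G1 l e)
        have "x = G 0 l e \<or> x = G 2 l e" using ux unfolding G1(3) adj_eqs by blast
        thus ?thesis using out by auto
      next
        case (G2 l e)
        have "x = G 0 l e \<or> x = G 1 l e" using ux unfolding G2(3) adj_eqs by blast
        thus ?thesis using out by auto
      next
        case (G3 l e)
        have "tr l" using uV(3)[of l] G3(3) by simp
        hence gd: "inc l (e div 2) \<Longrightarrow> good (e div 2)" using G3(1) unfolding good_def by blast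
        have "x = G 0 l e \<or> x = D (e div 2) \<and> inc l (e div 2)" using ux unfolding G3(3) adj_eqs by blast
        thus ?thesis using gd out by auto
      qed (use uV in auto)
    qed
    ultimately have "S = V" by (rule full)
    moreover have "Sp 3 \<in> V" by (simp add: V_def)
    ultimately show False by (auto simp: S_def)
  qed
  thus ?thesis unfolding satisfiable_def good_def tr_def by blast
qed

end

section \<open>Renaming and numbering of vertices\<close>

text \<open>Stable sets are pulled back along the injection. The inequality of cardinalities
  suffices, because the converse direction uses the inverse map.\<close>

lemma edge_forcing_image:
  assumes G: "simple_graph V E" and inj: "inj_on \<phi> V" and K: "edge_forcing_set V E K"
  shows "simple_graph (\<phi> ` V) ((`) \<phi> ` E)"
    and "edge_forcing_set (\<phi> ` V) ((`) \<phi> ` E) ((`) \<phi> ` K)"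
    and "card ((`) \<phi> ` K) \<le> card K"
proof -
  have EV: "e \<subseteq> V" if "e \<in> E" for e using that G by (auto simp: simple_graph_def)
  show G': "simple_graph (\<phi> ` V) ((`) \<phi> ` E)"
    using G inj_on_subset[OF inj] by (auto simp: simple_graph_def card_image)
  have KE: "K \<subseteq> E" using K by (simp add: edge_forcing_set_def matching_def)
  have "finite E" using G unfolding simple_graph_def
    by (meson PowI finite_Pow_iff finite_subset subsetI)
  hence finK: "finite K" using KE finite_subset by blast
  thus "card ((`) \<phi> ` K) \<le> card K" by (rule card_image_le)
  have edge: "{\<phi> u, y} \<in> (`) \<phi> ` E \<longleftrightarrow> (\<exists>w. y = \<phi> w \<and> {u, w} \<in> E)" if u: "u \<in> V" for u y
  proof
    assume "{\<phi> u, y} \<in> (`) \<phi> ` E"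
    then obtain e where e: "e \<in> E" "{\<phi> u, y} = \<phi> ` e" by blast
    have "card e = 2" using e(1) G by (auto simp: simple_graph_def)
    then obtain a b where ab: "e = {a, b}" by (auto simp: card_2_iff)
    have V: "a \<in> V" "b \<in> V" using EV[OF e(1)] ab by auto
    from e(2) ab have "\<phi> u = \<phi> a \<and> y = \<phi> b \<or> \<phi> u = \<phi> b \<and> y = \<phi> a"
      by (auto simp: doubleton_eq_iff)
    thus "\<exists>w. y = \<phi> w \<and> {u, w} \<in> E"
    proof
      assume "\<phi> u = \<phi> a \<and> y = \<phi> b"
      thus ?thesis using inj_onD[OF inj _ u V(1)] e(1) ab by auto
    next
      assume "\<phi> u = \<phi> b \<and> y = \<phi> a"
      thus ?thesis using inj_onD[OF inj _ u V(2)] e(1) ab by (auto simp: insert_commute)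
    qed
  next
    assume "\<exists>w. y = \<phi> w \<and> {u, w} \<in> E"
    then obtain w where "y = \<phi> w" "{u, w} \<in> E" by blast
    thus "{\<phi> u, y} \<in> (`) \<phi> ` E" by (intro image_eqI[of _ _ "{u, w}"]) auto
  qed
  show "edge_forcing_set (\<phi> ` V) ((`) \<phi> ` E) ((`) \<phi> ` K)"
    unfolding edge_forcing_set_iff[OF G']
  proof (intro conjI allI impI)
    have "disjnt (\<phi> ` e) (\<phi> ` f)" if "e \<in> K" "f \<in> K" "\<phi> ` e \<noteq> \<phi> ` f" for e f
    proof -
      have "disjnt e f" using K that unfolding edge_forcing_set_def matching_def pairwise_def by blast
      thus ?thesis using inj_on_image_Int[OF inj, of e f] EV KE that unfolding disjnt_def by auto
    qed
    thus "matching ((`) \<phi> ` E) ((`) \<phi> ` K)" using KE by (auto simp: matching_def pairwise_def)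
    fix S assume S: "\<Union> ((`) \<phi> ` K) \<subseteq> S" "S \<subseteq> \<phi> ` V" "force_stable ((`) \<phi> ` E) S"
    let ?S = "{x \<in> V. \<phi> x \<in> S}"
    have "force_stable E ?S"
      unfolding force_stable_def
    proof (intro ballI allI notI)
      fix u v assume u: "u \<in> ?S" and nb: "neighbors E u - ?S = {v}"
      have "v \<in> V" "{u, v} \<in> E" using nb EV by (auto simp: neighbors_def)
      moreover have "neighbors ((`) \<phi> ` E) (\<phi> u) - S = {\<phi> v}"
        using u nb EV by (auto simp: neighbors_def edge)
      ultimately show False using S(3) u unfolding force_stable_def by blast
    qed
    moreover have "\<Union>K \<subseteq> ?S" using S(1) KE EV by blast
    ultimately have "?S = V" using K unfolding edge_forcing_set_iff[OF G] by blast
    thus "S = \<phi> ` V" using S(2) by blast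
  qed
qed

lemma ex_edge_forcing_image:
  assumes G: "simple_graph V E" and inj: "inj_on \<phi> V"
  shows "(\<exists>K. edge_forcing_set (\<phi> ` V) ((`) \<phi> ` E) K \<and> card K \<le> k) \<longleftrightarrow>
     (\<exists>K. edge_forcing_set V E K \<and> card K \<le> k)"
proof
  assume "\<exists>K. edge_forcing_set V E K \<and> card K \<le> k"
  thus "\<exists>K. edge_forcing_set (\<phi> ` V) ((`) \<phi> ` E) K \<and> card K \<le> k"
    using edge_forcing_image(2,3)[OF G inj] order_trans by blast
next
  assume "\<exists>K. edge_forcing_set (\<phi> ` V) ((`) \<phi> ` E) K \<and> card K \<le> k"
  then obtain K where K: "edge_forcing_set (\<phi> ` V) ((`) \<phi> ` E) K" "card K \<le> k" by blast
  let ?\<psi> = "inv_into V \<phi>"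
  have EV: "e \<subseteq> V" if "e \<in> E" for e using that G by (auto simp: simple_graph_def)
  have G': "simple_graph (\<phi> ` V) ((`) \<phi> ` E)"
    using G inj_on_subset[OF inj] by (auto simp: simple_graph_def card_image)
  have inj': "inj_on ?\<psi> (\<phi> ` V)" by (rule inj_on_inv_into) auto
  have V: "?\<psi> ` \<phi> ` V = V" by (rule inv_into_image_cancel[OF inj]) auto
  have "?\<psi> ` \<phi> ` e = e" if "e \<in> E" for e by (rule inv_into_image_cancel[OF inj EV[OF that]])
  hence E: "(`) ?\<psi> ` (`) \<phi> ` E = E" by (simp add: image_image)
  show "\<exists>K. edge_forcing_set V E K \<and> card K \<le> k"
    using edge_forcing_image(2,3)[OF G' inj' K(1)] K(2) unfolding V E by (meson order_trans)
qed

text \<open>Numbers are allotted in the order \<open>C\<close>, \<open>L\<close>, \<open>D\<close>,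
  \<open>Sp\<close>, followed by blocks of four for the gates, so \<open>3 * n + m + 4\<close>
  numbers precede the gates.\<close>

definition gate_num :: "nat \<Rightarrow> nat \<Rightarrow> nat \<Rightarrow> nat \<Rightarrow> nat \<Rightarrow> nat" where
  "gate_num n m r l e = 3 * n + m + 4 + 4 * (l * (2 * m) + e) + r"

text \<open>\<open>arc\<close> on numbers, spelt out with bounded quantifiers so that the rules for
  definability apply. The summand \<open>0\<close> keeps the shape of
  \<open>num (Sp 0)\<close>.\<close>

definition narc :: "nat \<Rightarrow> nat \<Rightarrow> (nat \<Rightarrow> nat \<Rightarrow> bool) \<Rightarrow> nat \<Rightarrow> nat \<Rightarrow> bool" where
  "narc n m inc a b \<longleftrightarrow>
     (\<exists>l<2 * n. a = l div 2 \<and> b = n + l) \<or>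
     a < n \<and> b = 3 * n + m + 3 \<or>
     (\<exists>l<2 * n. \<exists>e<2 * m. a = n + l \<and> b = gate_num n m 0 l e) \<or>
     (\<exists>l<2 * n. \<exists>e<2 * m. a = gate_num n m 0 l e \<and> b = gate_num n m 1 l e) \<or>
     (\<exists>l<2 * n. \<exists>e<2 * m. a = gate_num n m 0 l e \<and> b = gate_num n m 2 l e) \<or>
     (\<exists>l<2 * n. \<exists>e<2 * m. a = gate_num n m 0 l e \<and> b = gate_num n m 3 l e) \<or>
     (\<exists>l<2 * n. \<exists>e<2 * m. a = gate_num n m 1 l e \<and> b = gate_num n m 2 l e) \<or>
     (\<exists>l<2 * n. \<exists>e<2 * m. a = gate_num n m 3 l e \<and> b = 3 * n + e div 2 \<and> inc l (e div 2)) \<or>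
     a = 3 * n + m + 0 \<and> b = 3 * n + m + 1 \<or>
     a = 3 * n + m + 0 \<and> b = 3 * n + m + 2 \<or>
     a = 3 * n + m + 0 \<and> b = 3 * n + m + 3 \<or>
     a = 3 * n + m + 1 \<and> b = 3 * n + m + 2 \<or>
     (\<exists>j<m. a = 3 * n + m + 0 \<and> b = 3 * n + j)"

definition graph_size :: "nat \<Rightarrow> nat \<Rightarrow> nat" where
  "graph_size n m = 3 * n + m + 4 + 4 * (2 * n * (2 * m))"

context cnf
begin

fun num :: "vert \<Rightarrow> nat" where
  "num (C v) = v"
| "num (L l) = n + l"
| "num (D j) = 3 * n + j"
| "num (Sp r) = 3 * n + m + r"
| "num (G r l e) = gate_num n m r l e"

lemma num_G_less: "r < 4 \<Longrightarrow> l < 2 * n \<Longrightarrow> e < 2 * m \<Longrightarrow> num (G r l e) < graph_size n m"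
proof -
  assume "r < 4" "l < 2 * n" "e < 2 * m"
  moreover have "k + 4 * X + r < k + 4 * Y" if "X < Y" "r < 4" for X Y k :: nat using that by linarith
  ultimately show ?thesis
    using pair_less[of l "2 * n" e "2 * m"] unfolding graph_size_def num.simps gate_num_def by blast
qed

fun unnum :: "nat \<Rightarrow> vert" where
  "unnum a = (if a < n then C a else if a < 3 * n then L (a - n) else if a < 3 * n + m then D (a - 3 * n)
     else if a < 3 * n + m + 4 then Sp (a - (3 * n + m))
     else let b = a - (3 * n + m + 4) in G (b mod 4) (b div 4 div (2 * m)) (b div 4 mod (2 * m)))"

lemma unnum_num: "vertex x \<Longrightarrow> unnum (num x) = x"
proof (cases x)
  case (G r l e)
  assume "vertex x"
  hence r: "r < 4" "l < 2 * n" "e < 2 * m" using G by auto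
  let ?b = "4 * (l * (2 * m) + e) + r"
  have b: "num x = 3 * n + m + 4 + ?b" using G by (simp add: gate_num_def)
  have U: "unnum (3 * n + m + 4 + q) = G (q mod 4) (q div 4 div (2 * m)) (q div 4 mod (2 * m))" for q
    by (simp add: Let_def)
  have "(4 * q + r) mod 4 = r" "(4 * q + r) div 4 = q" for q using r(1) by auto
  hence "?b mod 4 = r" "?b div 4 = l * (2 * m) + e" by blast+
  moreover have "(l * (2 * m) + e) div (2 * m) = l" "(l * (2 * m) + e) mod (2 * m) = e" using r(3) by auto
  ultimately show ?thesis unfolding b U by (simp only: G)
qed auto

lemma num_bij: "inj_on num V" "num ` V = {..<graph_size n m}"
proof -
  show "inj_on num V" using unnum_num by (metis V_def inj_onI mem_Collect_eq)
  show "num ` V = {..<graph_size n m}"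
  proof (intro set_eqI iffI)
    fix a assume "a \<in> num ` V"
    then obtain x where x: "vertex x" "a = num x" by (auto simp: V_def)
    show "a \<in> {..<graph_size n m}"
    proof (cases x)
      case (G r l e)
      thus ?thesis using x num_G_less by simp
    qed (use x in \<open>auto simp: graph_size_def\<close>)
  next
    fix a assume a: "a \<in> {..<graph_size n m}"
    have "vertex (unnum a) \<and> num (unnum a) = a"
    proof (cases "a < 3 * n + m + 4")
      case False
      define b where "b = a - (3 * n + m + 4)"
      have b: "a = 3 * n + m + 4 + b" "b < 4 * (2 * n * (2 * m))"
        using False a by (auto simp: b_def graph_size_def)
      have bd: "b div 4 < 2 * n * (2 * m)" using b(2) by (simp add: less_mult_imp_div_less mult.commute)
      have m: "0 < 2 * m" using b(2) by (cases m) auto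
      have "b div 4 div (2 * m) < 2 * n" using bd by (simp add: less_mult_imp_div_less)
      moreover have "b div 4 mod (2 * m) < 2 * m" using m by simp
      moreover have "4 * (b div 4 div (2 * m) * (2 * m) + b div 4 mod (2 * m)) + b mod 4 = b"
        using div_mult_mod_eq[of "b div 4" "2 * m"] mult_div_mod_eq[of 4 b] by simp
      moreover have "unnum a = G (b mod 4) (b div 4 div (2 * m)) (b div 4 mod (2 * m))"
        using False by (simp add: Let_def b_def)
      ultimately show ?thesis using b(1) by (simp add: gate_num_def)
    qed auto
    thus "a \<in> num ` V" by (metis V_def image_eqI mem_Collect_eq)
  qed
qed

lemma narc_iff: "narc n m inc a b \<longleftrightarrow> (\<exists>x y. arc x y \<and> a = num x \<and> b = num y)"
proof
  assume "\<exists>x y. arc x y \<and> a = num x \<and> b = num y"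
  then obtain x y where "arc x y" "a = num x" "b = num y" by blast
  thus "narc n m inc a b"
  proof (induction x y rule: arc.induct)
    case (4 r l e r' l' e')
    thus ?case unfolding narc_def num.simps arc.simps by blast
  next
    case (6 r r')
    thus ?case unfolding narc_def num.simps arc.simps by blast
  next
    case (1 v l)
    thus ?case unfolding narc_def num.simps arc.simps by (intro disjI1 exI[of _ l]) simp
  next
    case (2 v r)
    thus ?case unfolding narc_def num.simps arc.simps by (intro disjI2[OF disjI1]) simp
  next
    case (3 l r l' e)
    thus ?case unfolding narc_def num.simps arc.simps by (intro disjI2[OF disjI2[OF disjI1]]) blast
  next
    case (5 r l e j)
    hence h: "\<exists>l<2 * n. \<exists>e<2 * m. a = gate_num n m 3 l e \<and> b = 3 * n + e div 2 \<and> inc l (e div 2)"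
      unfolding num.simps arc.simps by blast
    show ?case unfolding narc_def by (simp only: h simp_thms)
  next
    case (7 r j)
    hence h: "\<exists>j<m. a = 3 * n + m + 0 \<and> b = 3 * n + j"
      unfolding num.simps arc.simps by blast
    show ?case unfolding narc_def by (simp only: h simp_thms)
  qed (simp_all only: arc.simps)
next
  assume "narc n m inc a b"
  thus "\<exists>x y. arc x y \<and> a = num x \<and> b = num y"
    unfolding narc_def
  proof (elim disjE exE conjE)
    fix l assume "l < 2 * n" "a = l div 2" "b = n + l"
    thus ?thesis by (intro exI[of _ "C (l div 2)"] exI[of _ "L l"]) auto
  next
    assume "a < n" "b = 3 * n + m + 3"
    thus ?thesis by (intro exI[of _ "C a"] exI[of _ "Sp 3"]) auto
  next
    fix l e assume "l < 2 * n" "e < 2 * m" "a = n + l" "b = gate_num n m 0 l e"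
    thus ?thesis by (intro exI[of _ "L l"] exI[of _ "G 0 l e"]) auto
  next
    fix l e assume "l < 2 * n" "e < 2 * m" "a = gate_num n m 0 l e" "b = gate_num n m 1 l e"
    thus ?thesis by (intro exI[of _ "G 0 l e"] exI[of _ "G 1 l e"]) auto
  next
    fix l e assume "l < 2 * n" "e < 2 * m" "a = gate_num n m 0 l e" "b = gate_num n m 2 l e"
    thus ?thesis by (intro exI[of _ "G 0 l e"] exI[of _ "G 2 l e"]) auto
  next
    fix l e assume "l < 2 * n" "e < 2 * m" "a = gate_num n m 0 l e" "b = gate_num n m 3 l e"
    thus ?thesis by (intro exI[of _ "G 0 l e"] exI[of _ "G 3 l e"]) auto
  next
    fix l e assume "l < 2 * n" "e < 2 * m" "a = gate_num n m 1 l e" "b = gate_num n m 2 l e"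
    thus ?thesis by (intro exI[of _ "G 1 l e"] exI[of _ "G 2 l e"]) auto
  next
    fix l e assume "l < 2 * n" "e < 2 * m" "a = gate_num n m 3 l e" "b = 3 * n + e div 2" "inc l (e div 2)"
    thus ?thesis by (intro exI[of _ "G 3 l e"] exI[of _ "D (e div 2)"]) auto
  next
    assume "a = 3 * n + m + 0" "b = 3 * n + m + 1"
    thus ?thesis by (intro exI[of _ "Sp 0"] exI[of _ "Sp 1"]) auto
  next
    assume "a = 3 * n + m + 0" "b = 3 * n + m + 2"
    thus ?thesis by (intro exI[of _ "Sp 0"] exI[of _ "Sp 2"]) auto
  next
    assume "a = 3 * n + m + 0" "b = 3 * n + m + 3"
    thus ?thesis by (intro exI[of _ "Sp 0"] exI[of _ "Sp 3"]) auto
  next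
    assume "a = 3 * n + m + 1" "b = 3 * n + m + 2"
    thus ?thesis by (intro exI[of _ "Sp 1"] exI[of _ "Sp 2"]) auto
  next
    fix j assume "j < m" "a = 3 * n + m + 0" "b = 3 * n + j"
    thus ?thesis by (intro exI[of _ "Sp 0"] exI[of _ "D j"]) auto
  qed
qed

lemma num_edge: "{a, b} \<in> (`) num ` E \<longleftrightarrow> narc n m inc a b \<or> narc n m inc b a"
proof -
  have "{a, b} \<in> (`) num ` E \<longleftrightarrow> (\<exists>x y. arc x y \<and> {a, b} = num ` {x, y})"
    unfolding E_def by blast
  also have "\<dots> \<longleftrightarrow> (\<exists>x y. arc x y \<and> {a, b} = {num x, num y})"
    by simp
  also have "\<dots> \<longleftrightarrow> narc n m inc a b \<or> narc n m inc b a"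
    unfolding narc_iff doubleton_eq_iff by blast
  finally show ?thesis .
qed

lemma in_problem_iff:
  "encode_instance (graph_size n m) ((`) num ` E) (int budget) \<in> edge_forcing_problem \<longleftrightarrow> satisfiable n m inc"
proof -
  let ?N = "graph_size n m" and ?E = "(`) num ` E"
  have G: "simple_graph {..<?N} ?E"
    using simple inj_on_subset[OF num_bij(1)] unfolding num_bij(2)[symmetric]
    by (auto simp: simple_graph_def card_image)
  have "encode_instance ?N ?E (int budget) \<in> edge_forcing_problem \<longleftrightarrow>
      (\<exists>K. edge_forcing_set {..<?N} ?E K \<and> int (card K) \<le> int budget)"
  proof
    assume "encode_instance ?N ?E (int budget) \<in> edge_forcing_problem"
    then obtain n' E' k' K where "encode_instance ?N ?E (int budget) = encode_instance n' E' k'"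
      "simple_graph {..<n'} E'" "edge_forcing_set {..<n'} E' K" "int (card K) \<le> k'"
      unfolding edge_forcing_problem_def by blast
    thus "\<exists>K. edge_forcing_set {..<?N} ?E K \<and> int (card K) \<le> int budget"
      using encode_instance_inject[OF G] by blast
  next
    assume "\<exists>K. edge_forcing_set {..<?N} ?E K \<and> int (card K) \<le> int budget"
    thus "encode_instance ?N ?E (int budget) \<in> edge_forcing_problem"
      using G unfolding edge_forcing_problem_def by blast
  qed
  also have "\<dots> \<longleftrightarrow> (\<exists>K. edge_forcing_set V E K \<and> card K \<le> budget)"
    using ex_edge_forcing_image[OF simple num_bij(1)] by (simp add: num_bij(2))
  also have "\<dots> \<longleftrightarrow> satisfiable n m inc"
    using complete sound by blast
  finally show ?thesis .
qed

end

lemma word_append: "word (a @ b) = word a @ word b"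
  by (simp add: word_def)

lemma word_concat: "word (concat xs) = concat (map word xs)"
  unfolding word_def[abs_def] map_concat ..

text \<open>Reduces hardness to describing NP computations by CNF formulas of definable size and
  incidence. \<open>dinc\<close> allows arbitrary definable arguments since \<open>inc\<close>
  occurs under binders in \<open>narc\<close>.\<close>

lemma polytime_reducible_cnf:
  fixes N M :: "nat list \<Rightarrow> nat" and inc :: "nat list \<Rightarrow> nat \<Rightarrow> nat \<Rightarrow> bool"
  assumes dN: "dfn (\<lambda>w v. N w)" and dM: "dfn (\<lambda>w v. M w)"
    and dinc: "\<And>F H. dfn F \<Longrightarrow> dfn H \<Longrightarrow> dfp (\<lambda>w v. inc w (F w v) (H w v))"
    and sat: "\<And>x. x \<in> A \<longleftrightarrow> satisfiable (N (word x)) (M (word x)) (inc (word x))"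
  shows "polytime_reducible A edge_forcing_problem"
proof -
  define size where "size w = graph_size (N w) (M w)" for w
  define k where "k w = cnf.budget (N w) (M w)" for w
  define adj where "adj w a b \<longleftrightarrow> narc (N w) (M w) (inc w) a b \<or> narc (N w) (M w) (inc w) b a" for w a b
  define f where "f x = encode_instance (size (word x))
    ((`) (cnf.num (N (word x)) (M (word x))) ` cnf.E (N (word x)) (M (word x)) (inc (word x))) (int (k (word x)))" for x
  \<comment> \<open>The number of vertices in unary, its terminator, the matrix, the sign of the
    bound, and its digits, found at the powers of \<open>2\<close> up to \<open>k w\<close>.\<close>
  define out :: "nat list \<Rightarrow> nat list" where "out w = concat (map (\<lambda>i. [2]) [0..<size w]) @ [1] @
      concat (map (\<lambda>i. concat (map (\<lambda>j. if adj w i j then [2] else [1]) [0..<size w])) [0..<size w]) @ [1] @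
      concat (map (\<lambda>p. if pow2 p then if \<not> 2 dvd k w div p then [2] else [1] else []) [0..<Suc (k w)])" for w
  have dsize: "dfn (\<lambda>w v. size w)" unfolding size_def graph_size_def
    by (intro df_intros dN dM)
  have dk: "dfn (\<lambda>w v. k w)" unfolding k_def cnf.budget_def
    by (intro df_intros dN dM)
  have dnarc: "dfp (\<lambda>w v. narc (N w) (M w) (inc w) (F w v) (H w v))" if "dfn F" "dfn H" for F H
    unfolding narc_def gate_num_def
    by (intro df_intros dN dM dinc that that[THEN dfn_rename])
  have "dfo (\<lambda>w v. out w)"
    unfolding out_def adj_def
    by (intro dfo_append dfo_concat dfo_single dfo_if dfo_Nil dfp_disj dnarc dsize dk df_intros) auto
  moreover have "out (word x) = word (f x)" for x
  proof -
    let ?w = "word x"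
    have adj: "{i, j} \<in> (`) (cnf.num (N ?w) (M ?w)) ` cnf.E (N ?w) (M ?w) (inc ?w) \<longleftrightarrow> adj ?w i j" for i j
      unfolding adj_def by (rule cnf.num_edge)
    have bin: "binary (k ?w) = concat (map (\<lambda>p. if pow2 p then [\<not> 2 dvd k ?w div p] else []) [0..<Suc (k ?w)])"
      unfolding binary_eq_concat using binary_conv[of "k ?w"] by blast
    have 1: "word (replicate l True) = concat (map (\<lambda>i. [2]) [0..<l])" for l
      by (simp add: word_def map_replicate_const)
    have 2: "word (map g [0..<l]) = concat (map (\<lambda>j. if g j then [2] else [1]) [0..<l])" for g l
      by (induction l) (auto simp: word_def)
    have 3: "word (concat (map (\<lambda>p. if pow2 p then [g p] else []) xs)) =
      concat (map (\<lambda>p. if pow2 p then if g p then [2] else [1] else []) xs)" for g xs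
      by (induction xs) (auto simp: word_def)
    show ?thesis
      unfolding out_def f_def encode_instance_def encode_graph_def encode_int_def adj
      by (simp only: word_append word_concat 1 map_map comp_def 2 int_nat_eq abs_of_nat nat_int bin 3)
        (simp add: word_def bin[symmetric] 3[unfolded word_def] bin)
  qed
  ultimately have "polytime_computable f" by (rule polytime_computable_dfo)
  moreover have "x \<in> A \<longleftrightarrow> f x \<in> edge_forcing_problem" for x
    unfolding sat f_def size_def k_def by (rule cnf.in_problem_iff[symmetric])
  ultimately show ?thesis unfolding polytime_reducible_def by blast
qed

section \<open>Turing machine computations as satisfiability problems\<close>

text \<open>Halting states are given transitions that change nothing, in agreement with
  \<open>step\<close>, so that the clauses treat all states alike.\<close>

definition act :: "machine \<Rightarrow> nat \<times> nat list \<Rightarrow> nat \<times> (nat \<times> dir) list" where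
  "act M a = (if fst a = accept_state M \<or> fst a = reject_state M
     then (fst a, map (\<lambda>s. (s, Stay)) (snd a)) else trans M (fst a) (snd a))"

definition joint :: "machine \<Rightarrow> (nat \<times> nat list) set" where
  "joint M = {(q, ss). q < num_states M \<and> length ss = num_tapes M \<and> (\<forall>s\<in>set ss. s < num_symbols M)}"

text \<open>Facts are five-digit numbers in base \<open>B\<close>, hence there are
  \<open>B ^ 5\<close> variables; the clauses have seven parameters and are numbered below
  \<open>B ^ 7\<close>.\<close>

definition fact_num :: "nat \<Rightarrow> nat \<Rightarrow> nat \<Rightarrow> nat \<Rightarrow> nat \<Rightarrow> nat \<Rightarrow> nat" where
  "fact_num B \<kappa> t i c s = (((\<kappa> * B + t) * B + i) * B + c) * B + s"

definition pos :: "nat \<Rightarrow> nat" where "pos f = 2 * f + 1"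
definition neg :: "nat \<Rightarrow> nat" where "neg f = 2 * f"

text \<open>Facts of kind 0: at time \<open>t\<close> the state is \<open>s\<close>; kind 1: the head of tape \<open>i\<close> is on cell \<open>c\<close>;
  kind 2: cell \<open>c\<close> of tape \<open>i\<close> contains \<open>s\<close>; kind 3: the head of tape \<open>i\<close> reads \<open>s\<close>. Cell \<open>c\<close> is at
  position \<open>c - T\<close>. The clauses are Horn clauses that derive the facts of the actual computation, except
  for clause 3, by which the certificate (at most \<open>Q\<close> symbols after the separator) is guessed.\<close>

definition premise :: "machine \<Rightarrow> nat \<Rightarrow> nat \<times> nat list \<Rightarrow> nat \<Rightarrow> nat \<Rightarrow> bool" where
  "premise M B a t l \<longleftrightarrow> l = neg (fact_num B 0 t 0 0 (fst a)) \<or>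
     (\<exists>i\<in>{..<num_tapes M}. l = neg (fact_num B 3 t i 0 (snd a ! i)))"

text \<open>The cells of the certificate, at positions \<open>T + length w + 1\<close> to
  \<open>T + length w + Q\<close>, are left out: they are subject to the clauses of kinds 3 and
  4.\<close>

definition initial :: "nat list \<Rightarrow> nat \<Rightarrow> nat \<Rightarrow> nat \<Rightarrow> nat \<Rightarrow> nat \<Rightarrow> bool" where
  "initial w T Q i c s \<longleftrightarrow>
     s = 0 \<and> (i \<noteq> 0 \<or> c < T \<or> T + length w + 1 + Q \<le> c) \<or>
     i = 0 \<and> T \<le> c \<and> c < T + length w \<and> (s = 1 \<and> symb w 1 (c - T) \<or> s = 2 \<and> symb w 2 (c - T)) \<or>
     i = 0 \<and> c = T + length w \<and> s = 3"

text \<open>Outside the intended ranges of the parameters all implications are vacuous, so the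
  clause contains every literal and is trivially true. Kind 4 carries a blank on to the next
  certificate cell, so that the guessed symbols form a word. Kinds 6 to 8 yield the next state, head
  position and written symbol, kind 9 preserves the other cells. \<open>u\<close> selects a row of
  the transition table through \<open>h\<close>.\<close>

definition clause :: "machine \<Rightarrow> (nat \<times> nat list \<Rightarrow> nat) \<Rightarrow> nat list \<Rightarrow> nat \<Rightarrow> nat \<Rightarrow> nat \<Rightarrow>
    nat \<Rightarrow> nat \<Rightarrow> nat \<Rightarrow> nat \<Rightarrow> nat \<Rightarrow> nat \<Rightarrow> nat \<Rightarrow> nat \<Rightarrow> bool" where
  "clause M h w T Q B \<kappa> t i c d s u l \<longleftrightarrow>
     (\<kappa> = 0 \<longrightarrow> l = pos (fact_num B 0 0 0 0 0)) \<and>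
     (\<kappa> = 1 \<and> i < num_tapes M \<longrightarrow> l = pos (fact_num B 1 0 i T 0)) \<and>
     (\<kappa> = 2 \<and> i < num_tapes M \<and> c < 2 * T + 1 \<and> initial w T Q i c s \<longrightarrow> l = pos (fact_num B 2 0 i c s)) \<and>
     (\<kappa> = 3 \<and> T + length w + 1 \<le> c \<and> c < T + length w + 1 + Q \<longrightarrow>
        l = pos (fact_num B 2 0 0 c 0) \<or> l = pos (fact_num B 2 0 0 c 1) \<or> l = pos (fact_num B 2 0 0 c 2)) \<and>
     (\<kappa> = 4 \<and> T + length w + 1 \<le> c \<and> c + 1 < T + length w + 1 + Q \<longrightarrow>
        l = neg (fact_num B 2 0 0 c 0) \<or> l = pos (fact_num B 2 0 0 (c + 1) 0)) \<and>
     (\<kappa> = 5 \<and> t < T \<and> i < num_tapes M \<and> c < 2 * T + 1 \<and> s < num_symbols M \<longrightarrow>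
        l = neg (fact_num B 1 t i c 0) \<or> l = neg (fact_num B 2 t i c s) \<or> l = pos (fact_num B 3 t i 0 s)) \<and>
     (\<forall>a\<in>joint M. \<kappa> = 6 \<and> t < T \<and> u = h a \<longrightarrow>
        premise M B a t l \<or> l = pos (fact_num B 0 (t + 1) 0 0 (fst (act M a)))) \<and>
     (\<forall>a\<in>joint M. \<forall>k\<in>{..<num_tapes M}. \<kappa> = 7 \<and> t < T \<and> u = h a \<and> i = k \<and> 1 \<le> c \<and> c < 2 * T \<longrightarrow>
        premise M B a t l \<or> l = neg (fact_num B 1 t i c 0) \<or>
        l = pos (fact_num B 1 (t + 1) i (c + nat (1 + dir_offset (snd (snd (act M a) ! k))) - 1) 0)) \<and>
     (\<forall>a\<in>joint M. \<forall>k\<in>{..<num_tapes M}. \<kappa> = 8 \<and> t < T \<and> u = h a \<and> i = k \<and> c < 2 * T + 1 \<longrightarrow>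
        premise M B a t l \<or> l = neg (fact_num B 1 t i c 0) \<or>
        l = pos (fact_num B 2 (t + 1) i c (fst (snd (act M a) ! k)))) \<and>
     (\<kappa> = 9 \<and> t < T \<and> i < num_tapes M \<and> c < 2 * T + 1 \<and> d < 2 * T + 1 \<and> c \<noteq> d \<and> s < num_symbols M \<longrightarrow>
        l = neg (fact_num B 2 t i c s) \<or> l = neg (fact_num B 1 t i d 0) \<or> l = pos (fact_num B 2 (t + 1) i c s)) \<and>
     (\<kappa> = 10 \<longrightarrow> l = neg (fact_num B 0 T 0 0 (reject_state M)))"

definition clause_inc :: "machine \<Rightarrow> (nat \<times> nat list \<Rightarrow> nat) \<Rightarrow> nat list \<Rightarrow> nat \<Rightarrow> nat \<Rightarrow> nat \<Rightarrow> nat \<Rightarrow> nat \<Rightarrow> bool" where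
  "clause_inc M h w T Q B l j \<longleftrightarrow> clause M h w T Q B (j div B div B div B div B div B div B)
     (j div B div B div B div B div B mod B) (j div B div B div B div B mod B) (j div B div B div B mod B)
     (j div B div B mod B) (j div B mod B) (j mod B) l"

lemma dfp_ball_finite:
  assumes "finite S" "\<And>c. c \<in> S \<Longrightarrow> dfp (P c)"
  shows "dfp (\<lambda>w v. \<forall>c\<in>S. P c w v)"
  using dfp_not[OF dfp_bex_finite[OF assms(1), of "\<lambda>c w v. \<not> P c w v"]] dfp_not[OF assms(2)] by simp

lemma finite_joint: "finite (joint M)"
proof -
  have "joint M \<subseteq> {..<num_states M} \<times> {ss. set ss \<subseteq> {..<num_symbols M} \<and> length ss = num_tapes M}"
    by (auto simp: joint_def)
  thus ?thesis by (rule finite_subset) (auto intro: finite_lists_length_eq)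
qed

text \<open>\<open>M\<close> and \<open>h\<close> are fixed, so the transition table enters as a
  finite conjunction over constants.\<close>

lemma dfp_clause_inc:
  assumes "dfn (\<lambda>w v. T w)" "dfn (\<lambda>w v. Q w)" "dfn (\<lambda>w v. B w)" "dfn F" "dfn H"
  shows "dfp (\<lambda>w v. clause_inc M h w (T w) (Q w) (B w) (F w v) (H w v))"
  unfolding clause_inc_def clause_def premise_def initial_def fact_num_def pos_def neg_def
  by (intro df_intros dfp_symb dfp_ball_finite dfp_bex_finite finite_joint finite_lessThan assms)

lemma satisfiable_clause_iff:
  assumes B: "B > 0"
  shows "satisfiable (B ^ 5) (B ^ 7) (clause_inc M h w T Q B) \<longleftrightarrow>
    (\<exists>\<alpha>. \<forall>\<kappa> t i c d s u. \<kappa> < B \<longrightarrow> t < B \<longrightarrow> i < B \<longrightarrow> c < B \<longrightarrow> d < B \<longrightarrow> s < B \<longrightarrow> u < B \<longrightarrow>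
      (\<exists>l<2 * B ^ 5. clause M h w T Q B \<kappa> t i c d s u l \<and> \<alpha> (l div 2) = odd l))"
    (is "_ \<longleftrightarrow> (\<exists>\<alpha>. ?R \<alpha>)")
proof -
  have "(\<forall>j<B ^ 7. \<exists>l<2 * B ^ 5. clause_inc M h w T Q B l j \<and> \<alpha> (l div 2) = odd l) \<longleftrightarrow> ?R \<alpha>" for \<alpha>
  proof
    assume L: "\<forall>j<B ^ 7. \<exists>l<2 * B ^ 5. clause_inc M h w T Q B l j \<and> \<alpha> (l div 2) = odd l"
    show "?R \<alpha>"
    proof (intro allI impI)
      fix \<kappa> t i c d s u assume b: "\<kappa> < B" "t < B" "i < B" "c < B" "d < B" "s < B" "u < B"
      let ?j = "(((((\<kappa> * B + t) * B + i) * B + c) * B + d) * B + s) * B + u"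
      note pl = pair_less
      have "?j < B * B * B * B * B * B * B" by (intro pl b)
      hence j: "?j < B ^ 7" by (simp add: power_numeral_reduce)
      have dm: "(x * B + y) div B = x" "(x * B + y) mod B = y" if "y < B" for x y using that by auto
      from L[rule_format, OF j] show "\<exists>l<2 * B ^ 5. clause M h w T Q B \<kappa> t i c d s u l \<and> \<alpha> (l div 2) = odd l"
        unfolding clause_inc_def by (simp only: dm b)
    qed
  next
    assume R: "?R \<alpha>"
    show "\<forall>j<B ^ 7. \<exists>l<2 * B ^ 5. clause_inc M h w T Q B l j \<and> \<alpha> (l div 2) = odd l"
    proof (intro allI impI)
      fix j assume "j < B ^ 7"
      hence "j < B * B * B * B * B * B * B" by (simp add: power_numeral_reduce)
      hence "j div B div B div B div B div B div B < B" by (intro less_mult_imp_div_less)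
      thus "\<exists>l<2 * B ^ 5. clause_inc M h w T Q B l j \<and> \<alpha> (l div 2) = odd l"
        unfolding clause_inc_def by (intro R[rule_format] mod_less_divisor B)
    qed
  qed
  thus ?thesis unfolding satisfiable_def by simp
qed

section \<open>Runs of the machine\<close>

definition wf_config :: "machine \<Rightarrow> config \<Rightarrow> bool" where
  "wf_config M c \<longleftrightarrow> fst c < num_states M \<and> length (snd c) = num_tapes M \<and>
     (\<forall>i<num_tapes M. \<forall>z. fst (snd c ! i) z < num_symbols M)"

definition reading :: "config \<Rightarrow> nat \<times> nat list" where
  "reading c = (fst c, map read_tape (snd c))"

lemma read_tape_eq: "read_tape \<tau> = fst \<tau> (snd \<tau>)"
  by (cases \<tau>) simp

lemma reading_joint: "wf_config M c \<Longrightarrow> reading c \<in> joint M"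
  by (auto simp: wf_config_def reading_def joint_def read_tape_eq in_set_conv_nth) (metis fst_conv)

lemma act_joint:
  assumes M: "turing_machine M" and a: "a \<in> joint M"
  shows "fst (act M a) < num_states M" "length (snd (act M a)) = num_tapes M"
    "\<And>i. i < num_tapes M \<Longrightarrow> fst (snd (act M a) ! i) < num_symbols M"
proof -
  obtain q ss where qs: "a = (q, ss)" "q < num_states M" "length ss = num_tapes M" "\<forall>s\<in>set ss. s < num_symbols M"
    using a by (auto simp: joint_def)
  obtain q' as where tr: "trans M q ss = (q', as)" by (cases "trans M q ss")
  hence t: "q' < num_states M" "length as = num_tapes M" "\<forall>(s, d)\<in>set as. s < num_symbols M"
    using M qs unfolding turing_machine_def by blast+
  show "fst (act M a) < num_states M" "length (snd (act M a)) = num_tapes M"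
    using qs t tr by (auto simp: act_def)
  show "fst (snd (act M a) ! i) < num_symbols M" if "i < num_tapes M" for i
    using that qs t tr by (auto simp: act_def all_set_conv_all_nth split: prod.splits)
      (metis fst_conv surj_pair)+
qed

lemma step_act:
  assumes "wf_config M c"
  shows "fst (step M c) = fst (act M (reading c))"
    and "turing_machine M \<Longrightarrow> i < num_tapes M \<Longrightarrow> snd (step M c) ! i = act_tape (snd (act M (reading c)) ! i) (snd c ! i)"
    and "turing_machine M \<Longrightarrow> length (snd (step M c)) = num_tapes M"
proof -
  have len: "length (snd c) = num_tapes M" using assms by (simp add: wf_config_def)
  have id: "act_tape (read_tape \<tau>, Stay) \<tau> = \<tau>" for \<tau> by (cases \<tau>) auto
  show "fst (step M c) = fst (act M (reading c))"
    by (auto simp: step_def halted_def act_def reading_def split: prod.splits)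
  assume M: "turing_machine M"
  have l: "length (snd (act M (reading c))) = num_tapes M"
    using act_joint(2)[OF M reading_joint[OF assms]] .
  show "length (snd (step M c)) = num_tapes M"
    using len l by (auto simp: step_def halted_def act_def reading_def split: prod.splits)
  assume i: "i < num_tapes M"
  show "snd (step M c) ! i = act_tape (snd (act M (reading c)) ! i) (snd c ! i)"
  proof (cases "halted M c")
    case True
    thus ?thesis using i len id by (auto simp: step_def halted_def act_def reading_def)
  next
    case False
    hence "snd (step M c) = map2 act_tape (snd (act M (reading c))) (snd c)"
      by (auto simp: step_def halted_def act_def reading_def split: prod.splits)
    thus ?thesis using i len l by simp
  qed
qed

lemma wf_config_step:
  assumes M: "turing_machine M" and c: "wf_config M c"
  shows "wf_config M (step M c)"
proof -
  note a = act_joint[OF M reading_joint[OF c]]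
  have "fst (snd (step M c) ! i) z < num_symbols M" if i: "i < num_tapes M" for i z
  proof -
    obtain f p where \<tau>: "snd c ! i = (f, p)" by (cases "snd c ! i")
    obtain s d where sd: "snd (act M (reading c)) ! i = (s, d)" by (cases "snd (act M (reading c)) ! i")
    have "s < num_symbols M" using a(3)[OF i] sd by simp
    moreover have "f z < num_symbols M" using c i \<tau> unfolding wf_config_def by (metis fst_conv)
    ultimately show ?thesis using step_act(2)[OF c M i] \<tau> sd by simp
  qed
  thus ?thesis using a(1) step_act(1)[OF c] step_act(3)[OF c M] by (simp add: wf_config_def)
qed

lemma wf_config_run:
  assumes M: "turing_machine M"
  shows "wf_config M (run M (word_pair x y) t)"
proof (induction t)
  case 0
  have "content_of (word_pair x y) z < num_symbols M" for z
  proof -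
    have "\<forall>s\<in>set (word_pair x y). s < 4" by (auto simp: word_pair_def word_def)
    moreover have "content_of (word_pair x y) z = 0 \<or> content_of (word_pair x y) z \<in> set (word_pair x y)"
      by (auto simp: content_of_def)
    ultimately show ?thesis using M unfolding turing_machine_def by fastforce
  qed
  moreover have "num_tapes M \<ge> 1" "num_symbols M \<ge> 4" "num_states M > 0"
    using M by (auto simp: turing_machine_def)
  ultimately show ?case
    by (auto simp: run_def init_config_def wf_config_def nth_Cons' content_of_def)
next
  case (Suc t)
  thus ?case unfolding run_Suc by (rule wf_config_step[OF M])
qed

lemma content_word: "content_of (word x) (int e) = (if e < length x then if x ! e then 2 else 1 else 0)"
  by (auto simp: content_of_def word_def)

lemma content_word_pair: "content_of (word_pair x y) (int e) =
    (if e < length x then if x ! e then 2 else 1 else if e = length x then 3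
     else if e - length x - 1 < length y then if y ! (e - length x - 1) then 2 else 1 else 0)"
  by (auto simp: content_of_def word_pair_def word_def nth_append nth_Cons')

lemma content_word_pair_right:
  "content_of (word_pair x y) (int (length x + 1 + j)) = (if j < length y then if y ! j then 2 else 1 else 0)"
  unfolding content_word_pair by simp

lemma content_neg: "z < 0 \<Longrightarrow> content_of w z = 0"
  by (simp add: content_of_def)

lemma pos_neg_simps [simp]: "pos f div 2 = f" "neg f div 2 = f" "odd (pos f)" "even (neg f)"
  by (auto simp: pos_def neg_def)

section \<open>The tableau of a computation\<close>

text \<open>\<open>B\<close> exceeds all parameters: the eleven kinds of clauses, the
  \<open>2 * T + 1\<close> positions, and the numbers of tapes, symbols, states and table rows. The
  last assumption places the whole input inside the cells from \<open>-T\<close> to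
  \<open>T\<close>.\<close>

locale tableau =
  fixes M :: machine and h :: "nat \<times> nat list \<Rightarrow> nat" and x :: "bool list" and T Q B :: nat
  assumes tm: "turing_machine M"
    and h_less: "\<And>a. a \<in> joint M \<Longrightarrow> h a < B" and h_inj: "inj_on h (joint M)"
    and B: "12 \<le> B" "2 * T + 1 < B" "num_tapes M \<le> B" "num_symbols M \<le> B" "num_states M \<le> B"
    and T: "length x + 1 + Q \<le> T"
begin

abbreviation "fct \<equiv> fact_num B"
abbreviation "cls \<equiv> clause M h (word x) T Q B"

lemma length_word [simp]: "length (word x) = length x"
  by (simp add: word_def)

lemma fact_less: "\<kappa> < B \<Longrightarrow> t < B \<Longrightarrow> i < B \<Longrightarrow> c < B \<Longrightarrow> s < B \<Longrightarrow> fct \<kappa> t i c s < B ^ 5"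
proof -
  assume a: "\<kappa> < B" "t < B" "i < B" "c < B" "s < B"
  have "fct \<kappa> t i c s < B * B * B * B * B"
    unfolding fact_num_def by (intro pair_less a)
  thus ?thesis by (simp add: power_numeral_reduce)
qed

definition st :: "bool list \<Rightarrow> nat \<Rightarrow> nat" where
  "st y t = fst (run M (word_pair x y) t)"
definition hp :: "bool list \<Rightarrow> nat \<Rightarrow> nat \<Rightarrow> int" where
  "hp y t i = snd (snd (run M (word_pair x y) t) ! i)"
definition cl :: "bool list \<Rightarrow> nat \<Rightarrow> nat \<Rightarrow> int \<Rightarrow> nat" where
  "cl y t i = fst (snd (run M (word_pair x y) t) ! i)"
definition rd :: "bool list \<Rightarrow> nat \<Rightarrow> nat \<times> nat list" where
  "rd y t = reading (run M (word_pair x y) t)"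

lemma rd_joint: "rd y t \<in> joint M"
  unfolding rd_def by (rule reading_joint[OF wf_config_run[OF tm]])

lemma fst_rd: "fst (rd y t) = st y t"
  by (simp add: rd_def reading_def st_def)

lemma snd_rd: "i < num_tapes M \<Longrightarrow> snd (rd y t) ! i = cl y t i (hp y t i)"
  using wf_config_run[OF tm, of x y t]
  by (simp add: rd_def reading_def cl_def hp_def read_tape_eq wf_config_def)

lemma joint_eqI:
  assumes "a \<in> joint M" "fst a = st y t" "\<And>i. i < num_tapes M \<Longrightarrow> snd a ! i = cl y t i (hp y t i)"
  shows "a = rd y t"
proof (rule prod_eqI)
  show "fst a = fst (rd y t)" using assms(2) fst_rd by simp
  have "length (snd a) = num_tapes M" "length (snd (rd y t)) = num_tapes M"
    using assms(1) rd_joint[of y t] by (auto simp: joint_def)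
  thus "snd a = snd (rd y t)" using assms(3) snd_rd by (intro nth_equalityI) auto
qed

lemma st_Suc: "st y (Suc t) = fst (act M (rd y t))"
  unfolding st_def rd_def run_Suc by (rule step_act(1)[OF wf_config_run[OF tm]])

lemma tape_Suc:
  assumes "i < num_tapes M"
  shows "hp y (Suc t) i = hp y t i + dir_offset (snd (snd (act M (rd y t)) ! i))"
    "cl y (Suc t) i = (cl y t i)(hp y t i := fst (snd (act M (rd y t)) ! i))"
proof -
  obtain f p where fp: "snd (run M (word_pair x y) t) ! i = (f, p)" by (cases "snd (run M (word_pair x y) t) ! i")
  obtain s d where sd: "snd (act M (rd y t)) ! i = (s, d)" by (cases "snd (act M (rd y t)) ! i")
  have "snd (run M (word_pair x y) (Suc t)) ! i = act_tape (s, d) (f, p)"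
    using step_act(2)[OF wf_config_run[OF tm] tm assms, of x y t] fp sd unfolding run_Suc rd_def by simp
  thus "hp y (Suc t) i = hp y t i + dir_offset (snd (snd (act M (rd y t)) ! i))"
    "cl y (Suc t) i = (cl y t i)(hp y t i := fst (snd (act M (rd y t)) ! i))"
    using fp sd by (auto simp: hp_def cl_def)
qed

lemma cl_less: "i < num_tapes M \<Longrightarrow> cl y t i z < num_symbols M"
  using wf_config_run[OF tm, of x y t] by (simp add: wf_config_def cl_def)

lemma tape_0:
  assumes "i < num_tapes M"
  shows "st y 0 = 0" "hp y 0 i = 0" "cl y 0 i = (if i = 0 then content_of (word_pair x y) else (\<lambda>_. 0))"
  using assms by (auto simp: st_def hp_def cl_def run_def init_config_def nth_Cons' content_of_def fun_eq_iff)

text \<open>A head moves at most one cell in a step, so up to time \<open>T\<close> it stays in the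
  window; before time \<open>T\<close> it is strictly inside, where the clauses of kind 7
  apply.\<close>

lemma hp_bound: "i < num_tapes M \<Longrightarrow> \<bar>hp y t i\<bar> \<le> int t"
proof (induction t)
  case 0
  thus ?case by (simp add: tape_0)
next
  case (Suc t)
  have "\<bar>dir_offset d\<bar> \<le> 1" for d by (cases d) auto
  hence "\<bar>dir_offset (snd (snd (act M (rd y t)) ! i))\<bar> \<le> 1" .
  moreover have "\<bar>hp y t i\<bar> \<le> int t" using Suc by simp
  ultimately show ?case unfolding tape_Suc(1)[OF Suc.prems] of_nat_Suc by linarith
qed

lemma initial_cl:
  assumes "i < num_tapes M" "initial (word x) T Q i c s" "length y \<le> Q"
  shows "cl y 0 i (int c - int T) = s"
proof (cases "c < T")
  case True
  thus ?thesis using assms tape_0(3)[OF assms(1), of y] by (auto simp: initial_def content_neg)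
next
  case False
  then obtain e where e: "c = T + e" using le_Suc_ex not_less by blast
  hence "int c - int T = int e" by simp
  thus ?thesis using assms tape_0(3)[OF assms(1), of y] e
    by (auto simp: initial_def content_word_pair content_word symb_def split: if_splits)
qed

lemma cl_initial:
  assumes "i < num_tapes M" "length y \<le> Q" "\<not> (i = 0 \<and> T + length x + 1 \<le> c \<and> c < T + length x + 1 + Q)"
  shows "initial (word x) T Q i c (cl y 0 i (int c - int T))"
proof (cases "c < T")
  case True
  thus ?thesis using tape_0(3)[OF assms(1), of y] by (auto simp: initial_def content_neg)
next
  case False
  then obtain e where e: "c = T + e" using le_Suc_ex not_less by blast
  hence "int c - int T = int e" by simp
  thus ?thesis using assms tape_0(3)[OF assms(1), of y] e
    by (auto simp: initial_def content_word_pair content_word symb_def split: if_splits)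
qed

lemma cl_cert: "cl y 0 0 (int (T + length x + 1 + j) - int T) = (if j < length y then if y ! j then 2 else 1 else 0)"
proof -
  have nt: "0 < num_tapes M" using tm by (auto simp: turing_machine_def)
  have z: "int (T + length x + 1 + j) - int T = int (length x + 1 + j)" by simp
  show ?thesis unfolding z tape_0(3)[OF nt] by (simp only: content_word_pair_right if_True simp_thms)
qed

text \<open>Facts are given their truth value in the run on \<open>y\<close>; then each clause has a
  false premise or a true conclusion.\<close>

lemma accepting_imp_sat:
  assumes y: "length y \<le> Q" and acc: "st y T \<noteq> reject_state M"
  shows "\<exists>\<alpha>. \<forall>\<kappa> t i c d s u. \<kappa> < B \<longrightarrow> t < B \<longrightarrow> i < B \<longrightarrow> c < B \<longrightarrow> d < B \<longrightarrow> s < B \<longrightarrow> u < B \<longrightarrow>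
      (\<exists>l<2 * B ^ 5. cls \<kappa> t i c d s u l \<and> \<alpha> (l div 2) = odd l)"
proof -
  define holds where "holds \<kappa> t i c s \<longleftrightarrow>
    (if \<kappa> = 0 then st y t = s else if \<kappa> = 1 then hp y t i = int c - int T
     else if \<kappa> = 2 then cl y t i (int c - int T) = s else cl y t i (hp y t i) = s)" for \<kappa> t i c s :: nat
  define \<alpha> where "\<alpha> f \<longleftrightarrow> holds (f div B div B div B div B) (f div B div B div B mod B) (f div B div B mod B)
    (f div B mod B) (f mod B)" for f
  have \<alpha>: "\<alpha> (fct \<kappa> t i c s) \<longleftrightarrow> holds \<kappa> t i c s" if "t < B" "i < B" "c < B" "s < B" for \<kappa> t i c s
  proof -
    have dm: "(a * B + b) div B = a" "(a * B + b) mod B = b" if "b < B" for a b using that by auto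
    show ?thesis unfolding \<alpha>_def fact_num_def by (simp only: dm that)
  qed
  have k4: "0 < B" "1 < B" "2 < B" "3 < B" using B(1) by auto
  have "0 < B ^ 5" using k4 by simp
  hence B5: "1 < 2 * B ^ 5" by linarith
  show ?thesis
  proof (rule exI[of _ \<alpha>], intro allI impI)
    fix \<kappa> t i c d s u assume b: "\<kappa> < B" "t < B" "i < B" "c < B" "d < B" "s < B" "u < B"
    let ?g = "\<exists>l<2 * B ^ 5. cls \<kappa> t i c d s u l \<and> \<alpha> (l div 2) = odd l"
    have P: ?g if "cls \<kappa> t i c d s u (pos (fct \<kappa>' t' i' c' s'))" "holds \<kappa>' t' i' c' s'"
      "\<kappa>' < B" "t' < B" "i' < B" "c' < B" "s' < B" for \<kappa>' t' i' c' s'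
      using that fact_less[of \<kappa>' t' i' c' s'] \<alpha>[of t' i' c' s' \<kappa>']
      by (intro exI[of _ "pos (fct \<kappa>' t' i' c' s')"]) (auto simp: pos_def)
    have N: ?g if "cls \<kappa> t i c d s u (neg (fct \<kappa>' t' i' c' s'))" "\<not> holds \<kappa>' t' i' c' s'"
      "\<kappa>' < B" "t' < B" "i' < B" "c' < B" "s' < B" for \<kappa>' t' i' c' s'
      using that fact_less[of \<kappa>' t' i' c' s'] \<alpha>[of t' i' c' s' \<kappa>']
      by (intro exI[of _ "neg (fct \<kappa>' t' i' c' s')"]) (auto simp: neg_def)
    \<comment> \<open>A clause without restriction contains both literals of fact \<open>0\<close>,
      one of which is true.\<close>
    have Z: ?g if all: "\<And>l. cls \<kappa> t i c d s u l"
    proof (cases "\<alpha> 0")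
      case True
      thus ?thesis using all B5 by (intro exI[of _ "pos 0"]) (auto simp: pos_def)
    next
      case False
      thus ?thesis using all B5 k4 by (intro exI[of _ "neg 0"]) (auto simp: neg_def)
    qed
    \<comment> \<open>A table row other than the one in use differs from it in the state or in a
      symbol read, which makes a premise false.\<close>
    have prem: ?g if pr: "\<And>l. premise M B a t l \<Longrightarrow> cls \<kappa> t i c d s u l" and a: "a \<in> joint M" "a \<noteq> rd y t" for a
    proof (cases "fst a = st y t")
      case False
      have "fst a < B" using a(1) B(5) by (auto simp: joint_def)
      thus ?thesis using False k4 b pr by (intro N[of 0 t 0 0 "fst a"]) (auto simp: holds_def premise_def)
    next
      case True
      then obtain k where k: "k < num_tapes M" "snd a ! k \<noteq> cl y t k (hp y t k)"
        using joint_eqI[OF a(1)] a(2) by blast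
      have "snd a ! k < num_symbols M" using a(1) k(1) by (auto simp: joint_def)
      hence "snd a ! k < B" "k < B" using k(1) B(3,4) by auto
      thus ?thesis using k k4 b pr by (intro N[of 3 t k 0 "snd a ! k"]) (auto simp: holds_def premise_def)
    qed
    consider "\<kappa> = 0" | "\<kappa> = 1" | "\<kappa> = 2" | "\<kappa> = 3" | "\<kappa> = 4" | "\<kappa> = 5" | "\<kappa> = 6" | "\<kappa> = 7" | "\<kappa> = 8" | "\<kappa> = 9"
      | "\<kappa> = 10" | "\<kappa> > 10"
    proof -
      have "\<kappa> = 0 \<or> \<kappa> = 1 \<or> \<kappa> = 2 \<or> \<kappa> = 3 \<or> \<kappa> = 4 \<or> \<kappa> = 5 \<or> \<kappa> = 6 \<or> \<kappa> = 7 \<or> \<kappa> = 8 \<or>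
        \<kappa> = 9 \<or> \<kappa> = 10 \<or> \<kappa> > 10" by presburger
      thus thesis using that by blast
    qed
    thus ?g
    proof cases
      case 1
      have "num_tapes M > 0" using tm by (auto simp: turing_machine_def)
      thus ?thesis using 1 k4 tape_0(1)[of 0 y] by (intro P[of 0 0 0 0 0]) (auto simp: clause_def holds_def)
    next
      case 2
      show ?thesis
      proof (cases "i < num_tapes M")
        case True
        thus ?thesis using 2 k4 b B(2) tape_0(2)[OF True, of y]
          by (intro P[of 1 0 i T 0]) (auto simp: clause_def holds_def)
      qed (intro Z, use 2 in \<open>simp add: clause_def\<close>)
    next
      case 3
      show ?thesis
      proof (cases "i < num_tapes M \<and> initial (word x) T Q i c s")
        case True
        thus ?thesis using 3 k4 b initial_cl[of i c s y] y
          by (intro P[of 2 0 i c s]) (auto simp: clause_def holds_def)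
      qed (intro Z, use 3 in \<open>auto simp: clause_def\<close>)
    next
      case 4
      show ?thesis
      proof (cases "T + length x + 1 \<le> c \<and> c < T + length x + 1 + Q")
        case True
        let ?s = "cl y 0 0 (int c - int T)"
        obtain j where j: "c = T + length x + 1 + j" using True le_Suc_ex by blast
        have "?s = 0 \<or> ?s = 1 \<or> ?s = 2" unfolding j cl_cert by simp
        thus ?thesis
        proof (elim disjE)
          assume "?s = 0"
          thus ?thesis using 4 k4 b by (intro P[of 2 0 0 c 0]) (auto simp: clause_def holds_def)
        next
          assume "?s = 1"
          thus ?thesis using 4 k4 b by (intro P[of 2 0 0 c 1]) (auto simp: clause_def holds_def)
        next
          assume "?s = 2"
          thus ?thesis using 4 k4 b by (intro P[of 2 0 0 c 2]) (auto simp: clause_def holds_def)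
        qed
      qed (intro Z, use 4 in \<open>auto simp: clause_def\<close>)
    next
      case 5
      show ?thesis
      proof (cases "T + length x + 1 \<le> c \<and> c + 1 < T + length x + 1 + Q")
        case True
        obtain j where j: "c = T + length x + 1 + j" using True le_Suc_ex by blast
        have c1: "c + 1 < B" using True T B(2) by linarith
        have j1: "c + 1 = T + length x + 1 + (j + 1)" using j by simp
        have "cl y 0 0 (int (c + 1) - int T) = 0" if "cl y 0 0 (int c - int T) = 0"
          using that unfolding j1 unfolding j cl_cert by (simp split: if_splits)
        hence "\<not> holds 2 0 0 c 0 \<or> holds 2 0 0 (c + 1) 0"
          by (cases "cl y 0 0 (int c - int T) = 0") (auto simp: holds_def)
        thus ?thesis
        proof
          assume "\<not> holds 2 0 0 c 0"
          thus ?thesis using 5 k4 b by (intro N[of 2 0 0 c 0]) (auto simp: clause_def)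
        next
          assume "holds 2 0 0 (c + 1) 0"
          thus ?thesis using 5 k4 b c1 by (intro P[of 2 0 0 "c + 1" 0]) (auto simp: clause_def)
        qed
      qed (intro Z, use 5 in \<open>auto simp: clause_def\<close>)
    next
      case 6
      have "\<not> holds 1 t i c 0 \<or> \<not> holds 2 t i c s \<or> holds 3 t i 0 s" by (auto simp: holds_def)
      thus ?thesis
      proof (elim disjE)
        assume "\<not> holds 1 t i c 0"
        thus ?thesis using 6 k4 b by (intro N[of 1 t i c 0]) (auto simp: clause_def)
      next
        assume "\<not> holds 2 t i c s"
        thus ?thesis using 6 k4 b by (intro N[of 2 t i c s]) (auto simp: clause_def)
      next
        assume "holds 3 t i 0 s"
        thus ?thesis using 6 k4 b by (intro P[of 3 t i 0 s]) (auto simp: clause_def)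
      qed
    next
      case 7
      show ?thesis
      proof (cases "t < T \<and> (\<exists>a\<in>joint M. u = h a)")
        case True
        then obtain a where a: "a \<in> joint M" "u = h a" by blast
        \<comment> \<open>\<open>h\<close> is injective on the table, so the clause with this
          \<open>u\<close> speaks about \<open>a\<close> only.\<close>
        hence uq: "a' = a" if "a' \<in> joint M" "u = h a'" for a' using that h_inj by (auto dest: inj_onD)
        show ?thesis
        proof (cases "a = rd y t")
          case rd: True
          have "holds 0 (t + 1) 0 0 (fst (act M a))" using rd st_Suc by (simp add: holds_def)
          moreover have "fst (act M a) < B" using act_joint(1)[OF tm a(1)] B(5) by linarith
          moreover have "t + 1 < B" using True B(2) by linarith
          moreover have "cls \<kappa> t i c d s u (pos (fct 0 (t + 1) 0 0 (fst (act M a))))"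
            using 7 uq by (auto simp: clause_def)
          ultimately show ?thesis using k4 by (intro P)
        next
          case False
          show ?thesis
            by (rule prem[OF _ a(1) False]) (use 7 uq in \<open>auto simp: clause_def\<close>)
        qed
      qed (intro Z, use 7 in \<open>auto simp: clause_def\<close>)
    next
      case 8
      show ?thesis
      proof (cases "t < T \<and> (\<exists>a\<in>joint M. u = h a) \<and> i < num_tapes M \<and> 1 \<le> c \<and> c < 2 * T")
        case True
        then obtain a where a: "a \<in> joint M" "u = h a" by blast
        hence uq: "a' = a" if "a' \<in> joint M" "u = h a'" for a' using that h_inj by (auto dest: inj_onD)
        \<comment> \<open>The condition \<open>1 \<le> c\<close> keeps the truncated subtraction
          exact, and \<open>c < 2 * T\<close> keeps the result below \<open>B\<close>.\<close>
        let ?c = "c + nat (1 + dir_offset (snd (snd (act M a) ! i))) - 1"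
        have c: "1 \<le> c" "c < 2 * T" using True by auto
        have "int (c + nat (1 + dir_offset r) - 1) = int c + dir_offset r \<and> c + nat (1 + dir_offset r) - 1 < B" for r
          using c B(2) by (cases r) auto
        hence off: "int ?c = int c + dir_offset (snd (snd (act M a) ! i))" "?c < B" by blast+
        show ?thesis
        proof (cases "a = rd y t")
          case rd: True
          show ?thesis
          proof (cases "holds 1 t i c 0")
            case True
            hence "holds 1 (t + 1) i ?c 0" using rd tape_Suc(1)[of i y t] off(1) \<open>t < T \<and> _\<close>
              by (auto simp: holds_def)
            moreover have "t + 1 < B" using \<open>t < T \<and> _\<close> B(2) by linarith
            moreover have "cls \<kappa> t i c d s u (pos (fct 1 (t + 1) i ?c 0))"
              using 8 uq by (auto simp: clause_def)
            ultimately show ?thesis using k4 b off(2) by (intro P)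
          next
            case False
            moreover have "cls \<kappa> t i c d s u (neg (fct 1 t i c 0))" using 8 by (auto simp: clause_def)
            ultimately show ?thesis using k4 b by (intro N)
          qed
        next
          case False
          show ?thesis
            by (rule prem[OF _ a(1) False]) (use 8 uq in \<open>auto simp: clause_def\<close>)
        qed
      qed (intro Z, use 8 in \<open>auto simp: clause_def\<close>)
    next
      case 9
      show ?thesis
      proof (cases "t < T \<and> (\<exists>a\<in>joint M. u = h a) \<and> i < num_tapes M")
        case True
        then obtain a where a: "a \<in> joint M" "u = h a" by blast
        hence uq: "a' = a" if "a' \<in> joint M" "u = h a'" for a' using that h_inj by (auto dest: inj_onD)
        show ?thesis
        proof (cases "a = rd y t")
          case rd: True
          show ?thesis
          proof (cases "holds 1 t i c 0")
            case True
            hence "holds 2 (t + 1) i c (fst (snd (act M a) ! i))" using rd tape_Suc(2)[of i y t] \<open>t < T \<and> _\<close>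
              by (auto simp: holds_def)
            moreover have "t + 1 < B" using \<open>t < T \<and> _\<close> B(2) by linarith
            moreover have "fst (snd (act M a) ! i) < B"
              using act_joint(3)[OF tm a(1), of i] \<open>t < T \<and> _\<close> B(4) by linarith
            moreover have "cls \<kappa> t i c d s u (pos (fct 2 (t + 1) i c (fst (snd (act M a) ! i))))"
              using 9 uq by (auto simp: clause_def)
            ultimately show ?thesis using k4 b by (intro P)
          next
            case False
            moreover have "cls \<kappa> t i c d s u (neg (fct 1 t i c 0))" using 9 by (auto simp: clause_def)
            ultimately show ?thesis using k4 b by (intro N)
          qed
        next
          case False
          show ?thesis
            by (rule prem[OF _ a(1) False]) (use 9 uq in \<open>auto simp: clause_def\<close>)
        qed
      qed (intro Z, use 9 in \<open>auto simp: clause_def\<close>)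
    next
      case 10
      show ?thesis
      proof (cases "t < T \<and> i < num_tapes M \<and> c \<noteq> d")
        case True
        have t1: "t + 1 < B" using True B(2) by linarith
        have "\<not> holds 2 t i c s \<or> \<not> holds 1 t i d 0 \<or> holds 2 (t + 1) i c s"
          using True tape_Suc(2)[of i y t] by (auto simp: holds_def)
        thus ?thesis
        proof (elim disjE)
          assume "\<not> holds 2 t i c s"
          thus ?thesis using 10 k4 b by (intro N[of 2 t i c s]) (auto simp: clause_def)
        next
          assume "\<not> holds 1 t i d 0"
          thus ?thesis using 10 k4 b by (intro N[of 1 t i d 0]) (auto simp: clause_def)
        next
          assume "holds 2 (t + 1) i c s"
          thus ?thesis using 10 k4 b t1 by (intro P[of 2 "t + 1" i c s]) (auto simp: clause_def)
        qed
      qed (intro Z, use 10 in \<open>auto simp: clause_def\<close>)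
    next
      case 11
      have "T < B" using B(2) by linarith
      moreover have "reject_state M < B" using tm B(5) by (auto simp: turing_machine_def)
      moreover have "\<not> holds 0 T 0 0 (reject_state M)" using acc by (simp add: holds_def)
      moreover have "cls \<kappa> t i c d s u (neg (fct 0 T 0 0 (reject_state M)))" using 11 by (simp add: clause_def)
      ultimately show ?thesis using k4 by (intro N)
    next
      case 12
      show ?thesis by (intro Z) (use 12 in \<open>auto simp: clause_def\<close>)
    qed
  qed
qed

text \<open>The Horn clauses force all true facts of the run on a word \<open>y\<close> read off
  from \<open>\<alpha>\<close>. Further facts may be true as well, but the one forbidden by kind 10
  cannot hold in the run.\<close>

lemma sat_imp_accepting:
  assumes sat: "\<And>\<kappa> t i c d s u. \<kappa> < B \<Longrightarrow> t < B \<Longrightarrow> i < B \<Longrightarrow> c < B \<Longrightarrow> d < B \<Longrightarrow> s < B \<Longrightarrow> u < B \<Longrightarrow>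
      \<exists>l<2 * B ^ 5. cls \<kappa> t i c d s u l \<and> \<alpha> (l div 2) = odd l"
  shows "\<exists>y. length y \<le> Q \<and> st y T \<noteq> reject_state M"
proof -
  have nums: "(0::nat) < B" "1 < B" "2 < B" "3 < B" "4 < B" "5 < B" "6 < B" "7 < B" "8 < B" "9 < B" "10 < B"
    using B(1) by auto
  have nt: "0 < num_tapes M" using tm by (auto simp: turing_machine_def)
  have TB: "t < T \<Longrightarrow> t < B" "c < 2 * T + 1 \<Longrightarrow> c < B" for t c using B(2) by linarith+
  have kB: "i < num_tapes M \<Longrightarrow> i < B" "s < num_symbols M \<Longrightarrow> s < B" for i s using B(3,4) by linarith+
  have R0: "\<alpha> (fct 0 0 0 0 0)"
    using sat[of 0 0 0 0 0 0 0] nums by (auto simp: clause_def)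
  have R1: "\<alpha> (fct 1 0 i T 0)" if "i < num_tapes M" for i
    using sat[of 1 0 i 0 0 0 0] nums kB(1)[OF that] that by (auto simp: clause_def)
  have R2: "\<alpha> (fct 2 0 i c s)" if "i < num_tapes M" "c < 2 * T + 1" "initial (word x) T Q i c s" for i c s
  proof -
    have "s < 4" using that(3) by (auto simp: initial_def)
    thus ?thesis using sat[of 2 0 i c 0 s 0] nums kB(1)[OF that(1)] TB(2)[OF that(2)] that
      by (auto simp: clause_def)
  qed
  have R3: "\<alpha> (fct 2 0 0 c 0) \<or> \<alpha> (fct 2 0 0 c 1) \<or> \<alpha> (fct 2 0 0 c 2)"
    if "T + length x + 1 \<le> c" "c < T + length x + 1 + Q" for c
  proof -
    have "c < B" using that T B(2) by linarith
    thus ?thesis using sat[of 3 0 0 c 0 0 0] nums that by (auto simp: clause_def)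
  qed
  have R4: "\<alpha> (fct 2 0 0 (c + 1) 0)"
    if "T + length x + 1 \<le> c" "c + 1 < T + length x + 1 + Q" "\<alpha> (fct 2 0 0 c 0)" for c
  proof -
    have "c < B" using that T B(2) by linarith
    thus ?thesis using sat[of 4 0 0 c 0 0 0] nums that by (auto simp: clause_def)
  qed
  have R5: "\<alpha> (fct 3 t i 0 s)" if "t < T" "i < num_tapes M" "c < 2 * T + 1" "s < num_symbols M"
    "\<alpha> (fct 1 t i c 0)" "\<alpha> (fct 2 t i c s)" for t i c s
    using sat[of 5 t i c 0 s 0] nums TB(1)[OF that(1)] kB(1)[OF that(2)] TB(2)[OF that(3)] kB(2)[OF that(4)] that
    by (auto simp: clause_def)
  have R6: "\<alpha> (fct 0 (t + 1) 0 0 (fst (act M a)))" if p: "t < T" "a \<in> joint M" "\<alpha> (fct 0 t 0 0 (fst a))"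
    "\<And>i. i < num_tapes M \<Longrightarrow> \<alpha> (fct 3 t i 0 (snd a ! i))" for t a
  proof -
    obtain l where l: "cls 6 t 0 0 0 0 (h a) l" "\<alpha> (l div 2) = odd l"
      using sat[of 6 t 0 0 0 0 "h a"] nums TB(1)[OF p(1)] h_less[OF p(2)] by blast
    have "\<forall>a'\<in>joint M. t < T \<and> h a = h a' \<longrightarrow>
        premise M B a' t l \<or> l = pos (fct 0 (t + 1) 0 0 (fst (act M a')))"
      using l(1) by (simp add: clause_def)
    hence "premise M B a t l \<or> l = pos (fct 0 (t + 1) 0 0 (fst (act M a)))"
      using p(1,2) by blast
    thus ?thesis using l(2) p(3,4) by (auto simp: premise_def)
  qed
  have R7: "\<alpha> (fct 1 (t + 1) i (c + nat (1 + dir_offset (snd (snd (act M a) ! i))) - 1) 0)"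
    if p: "t < T" "a \<in> joint M" "\<alpha> (fct 0 t 0 0 (fst a))"
    "\<And>i. i < num_tapes M \<Longrightarrow> \<alpha> (fct 3 t i 0 (snd a ! i))"
    "i < num_tapes M" "1 \<le> c" "c < 2 * T" "\<alpha> (fct 1 t i c 0)" for t a i c
  proof -
    have "c < B" using p B(2) by linarith
    then obtain l where l: "cls 7 t i c 0 0 (h a) l" "\<alpha> (l div 2) = odd l"
      using sat[of 7 t i c 0 0 "h a"] nums TB(1)[OF p(1)] h_less[OF p(2)] kB(1)[OF p(5)] by blast
    have "\<forall>a'\<in>joint M. \<forall>k\<in>{..<num_tapes M}. t < T \<and> h a = h a' \<and> i = k \<and> 1 \<le> c \<and> c < 2 * T \<longrightarrow>
        premise M B a' t l \<or> l = neg (fct 1 t i c 0) \<or>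
        l = pos (fct 1 (t + 1) i (c + nat (1 + dir_offset (snd (snd (act M a') ! k))) - 1) 0)"
      using l(1) by (simp add: clause_def)
    hence "premise M B a t l \<or> l = neg (fct 1 t i c 0) \<or>
        l = pos (fct 1 (t + 1) i (c + nat (1 + dir_offset (snd (snd (act M a) ! i))) - 1) 0)"
      using p(1,2,5-7) by blast
    thus ?thesis using l(2) p(3,4,8) by (auto simp: premise_def)
  qed
  have R8: "\<alpha> (fct 2 (t + 1) i c (fst (snd (act M a) ! i)))"
    if p: "t < T" "a \<in> joint M" "\<alpha> (fct 0 t 0 0 (fst a))"
    "\<And>i. i < num_tapes M \<Longrightarrow> \<alpha> (fct 3 t i 0 (snd a ! i))"
    "i < num_tapes M" "c < 2 * T + 1" "\<alpha> (fct 1 t i c 0)" for t a i c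
  proof -
    obtain l where l: "cls 8 t i c 0 0 (h a) l" "\<alpha> (l div 2) = odd l"
      using sat[of 8 t i c 0 0 "h a"] nums TB(1)[OF p(1)] TB(2)[OF p(6)] h_less[OF p(2)] kB(1)[OF p(5)] by blast
    have "\<forall>a'\<in>joint M. \<forall>k\<in>{..<num_tapes M}. t < T \<and> h a = h a' \<and> i = k \<and> c < 2 * T + 1 \<longrightarrow>
        premise M B a' t l \<or> l = neg (fct 1 t i c 0) \<or> l = pos (fct 2 (t + 1) i c (fst (snd (act M a') ! k)))"
      using l(1) by (simp add: clause_def)
    hence "premise M B a t l \<or> l = neg (fct 1 t i c 0) \<or> l = pos (fct 2 (t + 1) i c (fst (snd (act M a) ! i)))"
      using p(1,2,5,6) by blast
    thus ?thesis using l(2) p(3,4,7) by (auto simp: premise_def)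
  qed
  have R9: "\<alpha> (fct 2 (t + 1) i c s)" if "t < T" "i < num_tapes M" "c < 2 * T + 1" "d < 2 * T + 1" "c \<noteq> d"
    "s < num_symbols M" "\<alpha> (fct 2 t i c s)" "\<alpha> (fct 1 t i d 0)" for t i c d s
    using sat[of 9 t i c d s 0] nums TB(1)[OF that(1)] kB(1)[OF that(2)] TB(2)[OF that(3)] TB(2)[OF that(4)]
      kB(2)[OF that(6)] that
    by (auto simp: clause_def)
  have R10: "\<not> \<alpha> (fct 0 T 0 0 (reject_state M))"
    using sat[of 10 0 0 0 0 0 0] nums by (auto simp: clause_def)
  define c0 where "c0 = T + length x + 1"
  \<comment> \<open>The certificate ends at its first blank cell, or after \<open>Q\<close>
    symbols.\<close>
  define J where "J = (LEAST j. j = Q \<or> \<alpha> (fct 2 0 0 (c0 + j) 0))"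
  define y where "y = map (\<lambda>j. \<alpha> (fct 2 0 0 (c0 + j) 2)) [0..<J]"
  have J: "J \<le> Q" unfolding J_def by (rule Least_le) simp
  \<comment> \<open>Kind 4 carries the blank at \<open>J\<close> through the remaining
    cells.\<close>
  have blank: "\<alpha> (fct 2 0 0 (c0 + j) 0)" if "J \<le> j" "j < Q" for j
    using that
  proof (induction j rule: dec_induct)
    case base
    have "J = Q \<or> \<alpha> (fct 2 0 0 (c0 + J) 0)" unfolding J_def by (rule LeastI[of _ Q]) simp
    thus ?case using base by simp
  next
    case (step j)
    thus ?case using R4[of "c0 + j"] by (simp add: c0_def)
  qed
  have nonblank: "\<not> \<alpha> (fct 2 0 0 (c0 + j) 0)" if "j < J" for j
    using not_less_Least[of j "\<lambda>j. j = Q \<or> \<alpha> (fct 2 0 0 (c0 + j) 0)"] that unfolding J_def by blast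
  have ylen: "length y \<le> Q" using J by (simp add: y_def)
  \<comment> \<open>If both bit facts hold at a cell, \<open>y\<close> takes symbol
    \<open>2\<close>; before \<open>J\<close> one of them is guaranteed by kind 3, as the blank fact
    fails there.\<close>
  have cert: "\<alpha> (fct 2 0 0 (c0 + j) (cl y 0 0 (int (c0 + j) - int T)))" if j: "j < Q" for j
  proof -
    have v: "cl y 0 0 (int (c0 + j) - int T) = (if j < J then if \<alpha> (fct 2 0 0 (c0 + j) 2) then 2 else 1 else 0)"
      unfolding c0_def cl_cert by (simp add: y_def c0_def)
    show ?thesis
    proof (cases "j < J")
      case True
      thus ?thesis using v nonblank[OF True] R3[of "c0 + j"] j by (auto simp: c0_def)
    next
      case False
      thus ?thesis using v blank[of j] j by simp
    qed
  qed
  \<comment> \<open>Only truth of the actual facts is claimed, never falsity of others. The symbols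
    read are derived inside each step by kind 5.\<close>
  have inv: "\<alpha> (fct 0 t 0 0 (st y t)) \<and> (\<forall>i<num_tapes M. \<alpha> (fct 1 t i (nat (hp y t i + int T)) 0) \<and>
      (\<forall>c<2 * T + 1. \<alpha> (fct 2 t i c (cl y t i (int c - int T)))))" if "t \<le> T" for t
    using that
  proof (induction t)
    case 0
    have "\<alpha> (fct 2 0 i c (cl y 0 i (int c - int T)))" if i: "i < num_tapes M" and c: "c < 2 * T + 1" for i c
    proof (cases "i = 0 \<and> T + length x + 1 \<le> c \<and> c < T + length x + 1 + Q")
      case True
      then obtain j where "c = c0 + j" "j < Q" unfolding c0_def
        by (metis le_Suc_ex nat_add_left_cancel_less)
      thus ?thesis using cert[of j] True by simp
    next
      case False
      thus ?thesis using R2[OF i c cl_initial[OF i ylen]] by blast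
    qed
    thus ?case using R0 R1 tape_0(1)[OF nt] tape_0(2) by simp
  next
    case (Suc t)
    hence t: "t < T" by simp
    have IH: "\<alpha> (fct 0 t 0 0 (st y t))" "\<And>i. i < num_tapes M \<Longrightarrow> \<alpha> (fct 1 t i (nat (hp y t i + int T)) 0)"
      "\<And>i c. i < num_tapes M \<Longrightarrow> c < 2 * T + 1 \<Longrightarrow> \<alpha> (fct 2 t i c (cl y t i (int c - int T)))"
      using Suc t by auto
    let ?c = "\<lambda>i. nat (hp y t i + int T)"
    have c: "int (?c i) = hp y t i + int T" "1 \<le> ?c i" "?c i < 2 * T" if "i < num_tapes M" for i
      using hp_bound[OF that, of y t] t by linarith+
    let ?a = "rd y t"
    have rd: "\<alpha> (fct 3 t i 0 (snd ?a ! i))" if i: "i < num_tapes M" for i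
      using R5[OF t i, of "?c i"] c[OF i] cl_less[OF i] IH(2)[OF i] IH(3)[OF i, of "?c i"] snd_rd[OF i]
      by simp
    have a0: "\<alpha> (fct 0 t 0 0 (fst ?a))" using IH(1) by (simp add: fst_rd)
    have "\<alpha> (fct 0 (Suc t) 0 0 (st y (Suc t)))"
      using R6[OF t rd_joint a0 rd] by (simp add: st_Suc)
    moreover have "\<alpha> (fct 1 (Suc t) i (nat (hp y (Suc t) i + int T)) 0)" if i: "i < num_tapes M" for i
    proof -
      let ?d = "snd (snd (act M ?a) ! i)"
      have "?c i + nat (1 + dir_offset ?d) - 1 = nat (hp y (Suc t) i + int T)"
        using tape_Suc(1)[OF i, of y t] c[OF i] by (cases ?d) auto
      thus ?thesis using R7[OF t rd_joint a0 rd i c(2,3)[OF i] IH(2)[OF i]] by simp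
    qed
    moreover have "\<alpha> (fct 2 (Suc t) i k (cl y (Suc t) i (int k - int T)))"
      if i: "i < num_tapes M" and k: "k < 2 * T + 1" for i k
    proof (cases "k = ?c i")
      case True
      have "int k - int T = hp y t i" using True c(1)[OF i] by simp
      thus ?thesis using R8[OF t rd_joint a0 rd i k] IH(2)[OF i] True tape_Suc(2)[OF i, of y t] by simp
    next
      case False
      hence "int k - int T \<noteq> hp y t i" using c(1)[OF i] by auto
      moreover have "?c i < 2 * T + 1" using c(3)[OF i] by simp
      ultimately show ?thesis
        using R9[OF t i k _ False cl_less[OF i] IH(3)[OF i k] IH(2)[OF i]] tape_Suc(2)[OF i, of y t] by simp
    qed
    ultimately show ?case by blast
  qed
  have "st y T \<noteq> reject_state M" using inv[of T] R10 by auto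
  thus ?thesis using ylen by blast
qed

end

lemma poly_nat_mono: "a \<le> b \<Longrightarrow> poly (p :: nat poly) a \<le> poly p b"
  by (induction p) (auto intro: add_mono mult_mono)

lemma NP_hard_edge_forcing_problem: "NP_hard edge_forcing_problem"
  unfolding NP_hard_def
proof (intro allI impI)
  fix A assume "in_NP A"
  then obtain M and p q :: "nat poly" where tm: "turing_machine M"
    and halt: "\<And>x y. halts_within M (word_pair x y) (poly p (length (word_pair x y)))"
    and mem: "\<And>x. x \<in> A \<longleftrightarrow> (\<exists>y. length y \<le> poly q (length x) \<and> accepts M (word_pair x y))"
    unfolding in_NP_def by blast
  obtain h where h: "bij_betw h (joint M) {0..<card (joint M)}"
    using ex_bij_betw_finite_nat[OF finite_joint] by blast
  define Q where "Q w = poly q (length w)" for w :: "nat list"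
  \<comment> \<open>Monotonicity of \<open>p\<close> makes this a halting time for all certificates
    of length at most \<open>Q w\<close>; the further summands satisfy the last assumption of
    \<open>tableau\<close>.\<close>
  define T where "T w = poly p (length w + 1 + Q w) + length w + 1 + Q w" for w
  define B where "B w = 2 * T w + 12 + num_tapes M + num_symbols M + num_states M + card (joint M)" for w
  have dQ: "dfn (\<lambda>w v. Q w)" unfolding Q_def by (intro df_intros)
  have dT: "dfn (\<lambda>w v. T w)" unfolding T_def by (intro df_intros dQ)
  have dB: "dfn (\<lambda>w v. B w)" unfolding B_def by (intro df_intros dT)
  show "polytime_reducible A edge_forcing_problem"
  proof (rule polytime_reducible_cnf[where N = "\<lambda>w. B w ^ 5" and M = "\<lambda>w. B w ^ 7"
        and inc = "\<lambda>w. clause_inc M h w (T w) (Q w) (B w)"])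
    show "dfn (\<lambda>w v. B w ^ 5)" "dfn (\<lambda>w v. B w ^ 7)" by (intro df_intros dB)+
    show "dfp (\<lambda>w v. clause_inc M h w (T w) (Q w) (B w) (F w v) (H w v))" if "dfn F" "dfn H" for F H
      by (rule dfp_clause_inc[OF dT dQ dB that])
    fix x
    let ?w = "word x"
    have lw: "length ?w = length x" by (simp add: word_def)
    interpret tableau M h x "T ?w" "Q ?w" "B ?w"
    proof
      show "h a < B ?w" if "a \<in> joint M" for a
        using bij_betwE[OF h] that by (fastforce simp: B_def)
      show "inj_on h (joint M)" using h by (rule bij_betw_imp_inj_on)
    qed (auto simp: tm B_def T_def lw)
    \<comment> \<open>The machine has halted by this time, so not rejecting is the same as
      accepting.\<close>
    have acc: "accepts M (word_pair x y) \<longleftrightarrow> st y (T ?w) \<noteq> reject_state M" if y: "length y \<le> Q ?w" for y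
    proof -
      have "poly p (length (word_pair x y)) \<le> T ?w"
        using poly_nat_mono[of "length (word_pair x y)" "length ?w + 1 + Q ?w" p] y
        by (simp add: T_def word_pair_def word_def)
      hence "halted M (run M (word_pair x y) (T ?w))"
        using halts_within_mono[OF halt] by (simp add: halts_within_def)
      moreover have "accept_state M \<noteq> reject_state M" using tm by (simp add: turing_machine_def)
      ultimately show ?thesis unfolding accepts_def st_def halted_def
        using run_halted_unique[of M "word_pair x y"] unfolding halted_def by metis
    qed
    have "x \<in> A \<longleftrightarrow> (\<exists>y. length y \<le> Q ?w \<and> st y (T ?w) \<noteq> reject_state M)"
      unfolding mem using acc by (auto simp: Q_def lw)
    also have "\<dots> \<longleftrightarrow> satisfiable (B ?w ^ 5) (B ?w ^ 7) (clause_inc M h ?w (T ?w) (Q ?w) (B ?w))"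
    proof -
      have "B ?w > 0" by (simp add: B_def)
      note iff = satisfiable_clause_iff[OF this]
      show ?thesis
      proof
        assume "\<exists>y. length y \<le> Q ?w \<and> st y (T ?w) \<noteq> reject_state M"
        thus "satisfiable (B ?w ^ 5) (B ?w ^ 7) (clause_inc M h ?w (T ?w) (Q ?w) (B ?w))"
          unfolding iff using accepting_imp_sat by blast
      next
        assume "satisfiable (B ?w ^ 5) (B ?w ^ 7) (clause_inc M h ?w (T ?w) (Q ?w) (B ?w))"
        then obtain \<alpha> where R: "\<forall>\<kappa> t i c d s u. \<kappa> < B ?w \<longrightarrow> t < B ?w \<longrightarrow> i < B ?w \<longrightarrow> c < B ?w \<longrightarrow> d < B ?w \<longrightarrow>
            s < B ?w \<longrightarrow> u < B ?w \<longrightarrow> (\<exists>l<2 * B ?w ^ 5. cls \<kappa> t i c d s u l \<and> \<alpha> (l div 2) = odd l)"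
          unfolding iff by blast
        show "\<exists>y. length y \<le> Q ?w \<and> st y (T ?w) \<noteq> reject_state M"
          by (rule sat_imp_accepting[of \<alpha>]) (rule R[rule_format])
      qed
    qed
    finally show "x \<in> A \<longleftrightarrow> satisfiable (B ?w ^ 5) (B ?w ^ 7) (clause_inc M h ?w (T ?w) (Q ?w) (B ?w))" .
  qed
qed

theorem theorem2p3: "NP_complete edge_forcing_problem"
  unfolding NP_complete_def using in_NP_edge_forcing_problem NP_hard_edge_forcing_problem by blast

end
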